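(* Fix $0<\gamma\le 1$ and $p\in[2,4]$. Call a pair $(R,M)$ admissible if $R\ge1$, $\sqrt R\in\mathbb{N}$, $M$ is a positive integer dividing $R$, and $\frac12R^{1-\gamma}\le M\le 2R^{1-\gamma}$. Assume that for every $\epsilon>0$ there is $C_\epsilon$ such that $$\|EF\|_{L^p(B_R)}^p\le C_\epsilon R^\epsilon \Big(\frac{R}{M}\Big)^{\frac{p}{2}-1}\sum_{j=1}^{R/M}\|E_{P_j}F\|_{L^p(w_{B_R})}^p$$ for all admissible $(R,M)$, all balls $B_R\subset\mathbb{R}^3$ of radius $R$, all integrable $F:[0,1]^2\to\mathbb{C}$ and all partitions of $\mathcal{Q}_R$ into $M$-sets $P_1,\ldots,P_{R/M}$. Then for every $\epsilon>0$ there is $C'_\epsilon$ such that $$\int_{B_{\sqrt{R}}}|EF|^p\le C'_\epsilon R^\epsilon\Big(R^{\frac{3+p}{2}}+R^3\Big(\frac{R}{M}\Big)^{\frac{p}{2}-1}\Big)$$ for all admissible $(R,M)$, all balls $B_{\sqrt R}\subset\mathbb{R}^3$ of radius $\sqrt R$ and all measurable $F:[0,1]^2\to\mathbb{C}$ with $\|F\|_\infty\le R$.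
   Context: Write $e(t)=e^{2\pi i t}$. For measurable $S\subset[0,1]^2$, integrable $F$ and $x\in\mathbb{R}^3$, $E_SF(x)=\int_SF(\xi)e((\xi,|\xi|^2)\cdot x)\,d\xi$, and $EF=E_{[0,1]^2}F$. $\mathcal{Q}_R$ is the collection of the $R$ squares $[\frac{j}{\sqrt R},\frac{j+1}{\sqrt R}]\times[\frac{i}{\sqrt R},\frac{i+1}{\sqrt R}]\subset[0,1]^2$. An $M$-set is a union of $M$ distinct squares of $\mathcal{Q}_R$ (identified with the collection of these squares). For a ball $B_R$ with center $c$ and radius $R$, $w_{B_R}(x)=(1+|x-c|/R)^{-100}$ is a rapidly decaying approximation of $1_{B_R}$, and $\|f\|_{L^p(w_{B_R})}=(\int|f|^pw_{B_R})^{1/p}$. *)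

theory Defs
  imports "HOL-Probability.Essential_Supremum"
begin

definition char_e :: "real \<Rightarrow> complex" where
  "char_e t = exp (2 * of_real pi * \<i> * of_real t)"

definition unit_square :: "(real ^ 2) set" where
  "unit_square = cbox 0 1"

definition lift_paraboloid :: "real ^ 2 \<Rightarrow> real ^ 3" where
  "lift_paraboloid \<xi> = vector [\<xi> $ 1, \<xi> $ 2, (norm \<xi>)\<^sup>2]"

definition extension :: "(real ^ 2) set \<Rightarrow> (real ^ 2 \<Rightarrow> complex) \<Rightarrow> real ^ 3 \<Rightarrow> complex" where
  "extension S F x = (LINT \<xi>:S|lebesgue. F \<xi> * char_e (lift_paraboloid \<xi> \<bullet> x))"

text \<open>For \<open>\<surd>R\<close> a positive integer, this is the collection of the \<open>R\<close> squares of side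
  \<open>1 / \<surd>R\<close> that tile \<open>[0,1]\<^sup>2\<close>.\<close>

definition squares :: "nat \<Rightarrow> (real ^ 2) set set" where
  "squares R = {Q. Q \<subseteq> unit_square \<and> (\<exists>j i :: nat.
     Q = cbox (vector [real j / sqrt R, real i / sqrt R])
              (vector [(real j + 1) / sqrt R, (real i + 1) / sqrt R]))}"

text \<open>An \<open>M\<close>-set is represented by the collection of its squares; the corresponding subset of
  \<open>[0,1]\<^sup>2\<close> is the union of the collection.\<close>

definition M_set :: "nat \<Rightarrow> nat \<Rightarrow> (real ^ 2) set set \<Rightarrow> bool" where
  "M_set R M P \<longleftrightarrow> P \<subseteq> squares R \<and> finite P \<and> card P = M"

definition M_set_partition :: "nat \<Rightarrow> nat \<Rightarrow> (nat \<Rightarrow> (real ^ 2) set set) \<Rightarrow> bool" where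
  "M_set_partition R M P \<longleftrightarrow>
     (\<forall>j\<in>{1..R div M}. M_set R M (P j)) \<and>
     disjoint_family_on P {1..R div M} \<and>
     (\<Union>j\<in>{1..R div M}. P j) = squares R"

definition admissible :: "real \<Rightarrow> nat \<Rightarrow> nat \<Rightarrow> bool" where
  "admissible \<gamma> R M \<longleftrightarrow>
     R \<ge> 1 \<and> sqrt (real R) \<in> \<nat> \<and> M > 0 \<and> M dvd R \<and>
     1 / 2 * real R powr (1 - \<gamma>) \<le> real M \<and> real M \<le> 2 * real R powr (1 - \<gamma>)"

definition ball_weight :: "real ^ 3 \<Rightarrow> real \<Rightarrow> real ^ 3 \<Rightarrow> real" where
  "ball_weight c r x = (1 + norm (x - c) / r) powr (-100)"

text \<open>The Bochner integral is \<open>0\<close> when it diverges. This plays no role below: the norm is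
  only applied to \<open>extension S F\<close> with \<open>F\<close> integrable, which is bounded and continuous, and to
  finite measures.\<close>

definition Lp_norm :: "real \<Rightarrow> 'a measure \<Rightarrow> ('a \<Rightarrow> complex) \<Rightarrow> real" where
  "Lp_norm p \<mu> f = (LINT x|\<mu>. norm (f x) powr p) powr (1 / p)"

abbreviation weighted_ball :: "real ^ 3 \<Rightarrow> real \<Rightarrow> (real ^ 3) measure" where
  "weighted_ball c r \<equiv> density lebesgue (\<lambda>x. ennreal (ball_weight c r x))"

definition Linf_norm :: "'a measure \<Rightarrow> ('a \<Rightarrow> complex) \<Rightarrow> ereal" where
  "Linf_norm \<mu> f = esssup \<mu> (\<lambda>x. ereal (norm (f x)))"

end

theory Submission
  imports Defs "HOL-Probability.Probability_Measure" "HOL-Real_Asymp.Real_Asymp"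
begin

text \<open>Throughout \<open>R = N\<^sup>2\<close> with \<open>N\<close> a natural number, \<open>\<theta> = M / R\<close>, and \<open>E\<close> is the extension operator. The bound
concerns \<open>EF\<close> on a ball of radius \<open>\<surd>R = N\<close> only. By a translation the centre may be taken to be the
origin, and at that scale \<open>F\<close> matters only through its average over each of the \<open>R\<close> squares:
frequencies within one square are indistinguishable on a ball of radius \<open>N / 1000\<close>, up to errors
which have the same form again but carry a small constant in front, and which can therefore be
absorbed (\<open>worst_expsum_le_packet_sum\<close>). So \<open>F\<close> may be replaced by a step function with values of
modulus at most \<open>R\<close> on the squares. For such \<open>F\<close> the piece \<open>b\<^sub>q = E\<^sub>qF\<close> of a square \<open>q\<close> is one wave packet
through the origin: \<open>\<bar>b\<^sub>q\<bar> \<le> 1\<close>, with decay away from a tube of width \<open>N\<close> and length \<open>R\<close>. The squares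
give a bush of \<open>R\<close> tubes through one point, which separate away from it.

The decoupling inequality is applied on balls of radius \<open>R\<close> and averaged over random partitions
into \<open>M\<close>-sets. For a random part \<open>P\<^sub>j\<close> the sum \<open>E\<^bsub>P\<^sub>j\<^esub>F\<close> is the mean \<open>\<theta> EF\<close> plus a fluctuation of
typical size \<open>(\<theta> S)\<^bsup>1/2\<^esup>\<close>, where \<open>S = \<Sum>\<bar>b\<^sub>q\<bar>\<^sup>2\<close> (\<open>random_choice_moment\<close>, \<open>average_over_selections\<close>).
With the decoupling constant and the sum over the parts the mean contributes \<open>\<theta>\<^bsup>p/2\<^esup> \<parallel>EF\<parallel>\<^sup>p\<close>, which
\<open>\<theta> \<le> 2 R powr (- \<gamma>)\<close> makes negligible for large \<open>R\<close>; it is absorbed into the left side. What is left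
is a reverse square function estimate,
\[ \int |EF|^p \lesssim R^\epsilon \int \left( (R/M)^{p/2-1} S + S^{p/2} \right). \]
Both sides are integrated against the weight \<open>(1 + \<bar>x\<bar> / R)\<^bsup>-20\<^esup>\<close>, since the decoupling inequality
controls a ball by a weight and the absorption needs the same quantity on both sides
(\<open>local_to_weighted\<close>, \<open>packet_sum_bound\<close>).

For the bush the integrals of \<open>S\<close> and of \<open>S\<^bsup>3/2\<^esup>\<close> are both at most of order \<open>R\<^sup>3 log R\<close>
(\<open>bush_estimate\<close>). Together with \<open>S \<le> R\<close> this bounds the integral of \<open>S\<^bsup>p/2\<^esup>\<close> by
\<open>R\<^sup>3 + R\<^bsup>(3+p)/2\<^esup>\<close> up to a logarithm, for every \<open>p\<close> between 2 and 4: for \<open>p \<le> 3\<close> it is at most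
\<open>S + S\<^bsup>3/2\<^esup>\<close>, and for \<open>p > 3\<close> at most \<open>R\<^bsup>(p-3)/2\<^esup> S\<^bsup>3/2\<^esup>\<close>. This gives the two terms of the conclusion.\<close>

section \<open>Moments of sums of independent random choices\<close>

lemma sum_PiE_lessThan_Suc:
  fixes f :: "(nat \<Rightarrow> 'b) \<Rightarrow> 'c::comm_monoid_add"
  shows "(\<Sum>s\<in>PiE {..<Suc n} (\<lambda>_. A). f s) = (\<Sum>s\<in>PiE {..<n} (\<lambda>_. A). \<Sum>y\<in>A. f (s(n := y)))"
proof -
  have "(\<Sum>s\<in>PiE {..<Suc n} (\<lambda>_. A). f s)
      = (\<Sum>(y, s)\<in>A \<times> PiE {..<n} (\<lambda>_. A). f (s(n := y)))"
    unfolding lessThan_Suc PiE_insert_eq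
    by (subst sum.reindex[OF inj_combinator]) (auto simp: case_prod_unfold)
  also have "\<dots> = (\<Sum>y\<in>A. \<Sum>s\<in>PiE {..<n} (\<lambda>_. A). f (s(n := y)))"
    by (simp add: sum.cartesian_product)
  also have "\<dots> = (\<Sum>s\<in>PiE {..<n} (\<lambda>_. A). \<Sum>y\<in>A. f (s(n := y)))"
    by (rule sum.swap)
  finally show ?thesis .
qed

text \<open>The functions \<open>s\<close> on \<open>{..<M}\<close> with values in \<open>{..<L}\<close> model \<open>M\<close> independent uniform choices, and expected
values are sums over them divided by \<open>L ^ M\<close>. The fourth moment bound is Rosenthal's inequality for
centred summands: by induction on \<open>M\<close>, all terms of \<open>\<bar>X + Y\<bar>\<^sup>4\<close> that are linear in \<open>Y\<close> or in \<open>X\<close> average to 0,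
and the mixed term is at most \<open>6 V v\<close>, which \<open>3 (V + v)\<^sup>2 - 3 V\<^sup>2\<close> dominates.\<close>

lemma independent_sum_moments:
  fixes z :: "nat \<Rightarrow> nat \<Rightarrow> 'a::real_inner" and L :: nat
  assumes L: "L > 0" and zero: "\<And>m. m < M \<Longrightarrow> (\<Sum>l<L. z m l) = 0"
  defines "V \<equiv> \<lambda>M. (\<Sum>m<M. \<Sum>l<L. (norm (z m l))\<^sup>2) / L"
    and "W \<equiv> \<lambda>M. (\<Sum>m<M. \<Sum>l<L. (norm (z m l)) ^ 4) / L"
    and "X \<equiv> \<lambda>M s. (\<Sum>m<M. z m (s m))"
    and "E \<equiv> \<lambda>M. PiE {..<M} (\<lambda>_. {..<L})"
  shows "(\<Sum>s\<in>E M. X M s) = 0"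
    and "(\<Sum>s\<in>E M. (norm (X M s))\<^sup>2) = real L ^ M * V M"
    and "(\<Sum>s\<in>E M. (norm (X M s)) ^ 4) \<le> real L ^ M * (3 * (V M)\<^sup>2 + W M)"
proof -
  have X_upd: "X (Suc M) (s(M := y)) = X M s + z M y" for M s y
    unfolding X_def by simp
  have card_E: "card (E M) = L ^ M" for M
    unfolding E_def by (simp add: card_PiE)
  have "(\<Sum>s\<in>E M. X M s) = 0 \<and> (\<Sum>s\<in>E M. (norm (X M s))\<^sup>2) = real L ^ M * V M \<and>
     (\<Sum>s\<in>E M. (norm (X M s)) ^ 4) \<le> real L ^ M * (3 * (V M)\<^sup>2 + W M)"
    using zero
  proof (induction M)
    case 0
    show ?case by (simp add: X_def E_def V_def W_def)
  next
    case (Suc M)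
    from Suc have IH0: "(\<Sum>s\<in>E M. X M s) = 0"
      and IH2: "(\<Sum>s\<in>E M. (norm (X M s))\<^sup>2) = real L ^ M * V M"
      and IH4: "(\<Sum>s\<in>E M. (norm (X M s)) ^ 4) \<le> real L ^ M * (3 * (V M)\<^sup>2 + W M)"
      by auto
    have zM: "(\<Sum>l<L. z M l) = 0" using Suc.prems by auto
    define v where "v = (\<Sum>l<L. (norm (z M l))\<^sup>2)"
    define w where "w = (\<Sum>l<L. (norm (z M l)) ^ 4)"
    have VS: "V (Suc M) = V M + v / L" and WS: "W (Suc M) = W M + w / L"
      by (simp_all add: V_def W_def v_def w_def add_divide_distrib)
    have red: "(\<Sum>s\<in>E (Suc M). f (X (Suc M) s)) = (\<Sum>s\<in>E M. \<Sum>y<L. f (X M s + z M y))"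
      for f :: "'a \<Rightarrow> 'c::comm_monoid_add"
      unfolding E_def sum_PiE_lessThan_Suc by (simp add: X_upd)
    have cross1: "(\<Sum>y<L. c * (x \<bullet> z M y)) = 0" for c x
      by (simp add: sum_distrib_left[symmetric] inner_sum_right[symmetric] zM)
    have cross2: "(\<Sum>s\<in>E M. c * (X M s \<bullet> y)) = 0" for c y
      by (simp add: sum_distrib_left[symmetric] inner_sum_left[symmetric] IH0)
    have exp2: "(norm (x + y))\<^sup>2 = (norm x)\<^sup>2 + (norm y)\<^sup>2 + 2 * (x \<bullet> y)" for x y :: 'a
      by (simp add: power2_norm_eq_inner inner_add_left inner_add_right inner_commute)
    have exp4: "(norm (x + y)) ^ 4 \<le> (norm x) ^ 4 + (norm y) ^ 4 + 6 * ((norm x)\<^sup>2 * (norm y)\<^sup>2)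
        + (4 * (norm x)\<^sup>2) * (x \<bullet> y) + (4 * (norm y)\<^sup>2) * (x \<bullet> y)" for x y :: 'a
    proof -
      have "(norm (x + y)) ^ 4 = ((norm x)\<^sup>2 + (norm y)\<^sup>2 + 2 * (x \<bullet> y))\<^sup>2"
        unfolding exp2[symmetric] by (simp flip: power_mult)
      also have "\<dots> = (norm x) ^ 4 + (norm y) ^ 4 + 2 * ((norm x)\<^sup>2 * (norm y)\<^sup>2) + 4 * (x \<bullet> y)\<^sup>2
          + (4 * (norm x)\<^sup>2) * (x \<bullet> y) + (4 * (norm y)\<^sup>2) * (x \<bullet> y)"
        by (simp add: power2_eq_square power4_eq_xxxx algebra_simps)
      also have "(x \<bullet> y)\<^sup>2 \<le> (norm x)\<^sup>2 * (norm y)\<^sup>2"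
        using Cauchy_Schwarz_ineq[of x y] by (simp add: power2_norm_eq_inner)
      finally show ?thesis by simp
    qed
    have c0: "(\<Sum>s\<in>E (Suc M). X (Suc M) s) = 0"
      using red[of "\<lambda>x. x"] by (simp add: sum.distrib zM sum_constant_scaleR
          scaleR_sum_right[symmetric] IH0)
    have c2: "(\<Sum>s\<in>E (Suc M). (norm (X (Suc M) s))\<^sup>2) = real L ^ Suc M * V (Suc M)"
    proof -
      have "(\<Sum>s\<in>E (Suc M). (norm (X (Suc M) s))\<^sup>2)
          = (\<Sum>s\<in>E M. \<Sum>y<L. (norm (X M s))\<^sup>2 + (norm (z M y))\<^sup>2 + 2 * (X M s \<bullet> z M y))"
        unfolding red[of "\<lambda>x. (norm x)\<^sup>2"] exp2 ..
      also have "\<dots> = (\<Sum>s\<in>E M. L * (norm (X M s))\<^sup>2 + v)"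
        by (simp add: sum.distrib cross1 v_def)
      also have "\<dots> = real L ^ Suc M * V (Suc M)"
        using L by (simp add: sum.distrib sum_distrib_left[symmetric] IH2 card_E VS field_simps)
      finally show ?thesis .
    qed
    have c4: "(\<Sum>s\<in>E (Suc M). (norm (X (Suc M) s)) ^ 4)
        \<le> real L ^ Suc M * (3 * (V (Suc M))\<^sup>2 + W (Suc M))"
    proof -
      have "(\<Sum>s\<in>E (Suc M). (norm (X (Suc M) s)) ^ 4)
          \<le> (\<Sum>s\<in>E M. \<Sum>y<L. (norm (X M s)) ^ 4 + (norm (z M y)) ^ 4
            + 6 * ((norm (X M s))\<^sup>2 * (norm (z M y))\<^sup>2)
            + (4 * (norm (X M s))\<^sup>2) * (X M s \<bullet> z M y) + (4 * (norm (z M y))\<^sup>2) * (X M s \<bullet> z M y))"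
        unfolding red[of "\<lambda>x. norm x ^ 4"] by (intro sum_mono exp4)
      also have "\<dots> = (\<Sum>s\<in>E M. \<Sum>y<L. (norm (X M s)) ^ 4 + (norm (z M y)) ^ 4
            + 6 * ((norm (X M s))\<^sup>2 * (norm (z M y))\<^sup>2))
          + (\<Sum>s\<in>E M. \<Sum>y<L. (4 * (norm (X M s))\<^sup>2) * (X M s \<bullet> z M y))
          + (\<Sum>y<L. \<Sum>s\<in>E M. (4 * (norm (z M y))\<^sup>2) * (X M s \<bullet> z M y))"
        by (subst (4) sum.swap) (simp only: sum.distrib)
      also have "\<dots> = (\<Sum>s\<in>E M. \<Sum>y<L. (norm (X M s)) ^ 4 + (norm (z M y)) ^ 4
            + 6 * ((norm (X M s))\<^sup>2 * (norm (z M y))\<^sup>2))"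
        by (simp only: cross1 cross2 sum.neutral_const add_0_right)
      also have "\<dots> = (\<Sum>s\<in>E M. L * (norm (X M s)) ^ 4 + w + 6 * v * (norm (X M s))\<^sup>2)"
        by (simp add: sum.distrib w_def v_def sum_distrib_left sum_distrib_right ac_simps)
      also have "\<dots> = L * (\<Sum>s\<in>E M. (norm (X M s)) ^ 4) + real L ^ M * w + 6 * v * (real L ^ M * V M)"
        by (simp add: sum.distrib sum_distrib_left[symmetric] IH2 card_E)
      also have "\<dots> \<le> L * (real L ^ M * (3 * (V M)\<^sup>2 + W M)) + real L ^ M * w + 6 * v * (real L ^ M * V M)"
        using IH4 by (intro add_right_mono mult_left_mono) auto
      also have "\<dots> = real L ^ Suc M * (3 * (V M)\<^sup>2 + 6 * (V M) * (v / L) + W (Suc M))"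
        using L unfolding WS by (simp add: field_simps)
      also have "\<dots> \<le> real L ^ Suc M * (3 * (V (Suc M))\<^sup>2 + W (Suc M))"
        unfolding VS by (intro mult_left_mono add_right_mono) (auto simp: power2_eq_square algebra_simps)
      finally show ?thesis .
    qed
    show ?case using c0 c2 c4 by simp
  qed
  then show "(\<Sum>s\<in>E M. X M s) = 0"
    and "(\<Sum>s\<in>E M. (norm (X M s))\<^sup>2) = real L ^ M * V M"
    and "(\<Sum>s\<in>E M. (norm (X M s)) ^ 4) \<le> real L ^ M * (3 * (V M)\<^sup>2 + W M)" by auto
qed

lemma powr_add_le:
  fixes a b p :: real
  assumes "0 \<le> a" "0 \<le> b" "0 \<le> p" "p \<le> 4"
  shows "(a + b) powr p \<le> 16 * (a powr p + b powr p)"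
proof -
  have "(a + b) powr p \<le> (2 * max a b) powr p"
    using assms by (intro powr_mono2) auto
  also have "\<dots> = 2 powr p * (max a b) powr p"
    using assms by (simp add: powr_mult)
  also have "\<dots> \<le> 2 powr 4 * (max a b) powr p"
    using assms by (intro mult_right_mono powr_mono) auto
  also have "\<dots> \<le> 16 * (a powr p + b powr p)"
    by (simp add: max_def)
  finally show ?thesis .
qed

text \<open>Interpolation between the second and fourth moments without Hoelder's inequality: one of the two
terms dominates according to whether \<open>x\<close> is below or above the free threshold \<open>l\<close>.\<close>

lemma powr_le_square_fourth:
  fixes x l p :: real
  assumes "0 \<le> x" "0 < l" "2 \<le> p" "p \<le> 4"
  shows "x powr p \<le> l powr (p - 2) * x ^ 2 + l powr (p - 4) * x ^ 4"
proof (cases "x = 0")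
  case False
  with assms have x: "x > 0" by simp
  show ?thesis
  proof (cases "x \<le> l")
    case True
    have "x powr p = x powr (p - 2) * x ^ 2"
      using x by (simp add: powr_diff)
    also have "\<dots> \<le> l powr (p - 2) * x ^ 2"
      using x True assms by (intro mult_right_mono powr_mono2) auto
    finally show ?thesis using x assms by (simp add: add_increasing2)
  next
    case False
    have "x powr p = x powr (p - 4) * x ^ 4"
      using x by (simp add: powr_diff)
    also have "\<dots> \<le> l powr (p - 4) * x ^ 4"
      using x False assms by (intro mult_right_mono powr_mono2') auto
    finally show ?thesis using x assms by (simp add: add_increasing)
  qed
qed (use assms in auto)

text \<open>The sum is \<open>\<mu>\<close> plus a centred part with variance at most \<open>\<tau>\<close>. As the entries are bounded by 1, the
fourth moments are controlled by the second ones, so the fourth moment of the centred part is at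
most \<open>3 \<tau>\<^sup>2 + 4 \<tau>\<close>; the threshold \<open>\<surd>(1 + \<tau>)\<close> balances the second and the fourth moment.\<close>

lemma random_choice_moment:
  fixes z :: "nat \<Rightarrow> nat \<Rightarrow> 'a::real_inner" and L :: nat and p :: real
  assumes L: "L > 0" and p: "2 \<le> p" "p \<le> 4"
    and bound: "\<And>m l. m < M \<Longrightarrow> l < L \<Longrightarrow> norm (z m l) \<le> 1"
  defines "\<tau> \<equiv> (\<Sum>m<M. \<Sum>l<L. (norm (z m l))\<^sup>2) / L"
    and "\<mu> \<equiv> (\<Sum>m<M. \<Sum>l<L. z m l) /\<^sub>R L"
  shows "(\<Sum>s\<in>PiE {..<M} (\<lambda>_. {..<L}). norm (\<Sum>m<M. z m (s m)) powr p)
    \<le> real L ^ M * (16 * (norm \<mu> powr p + 5 * (\<tau> * (1 + \<tau>) powr (p / 2 - 1))))"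
proof -
  define E where "E = PiE {..<M} (\<lambda>_::nat. {..<L})"
  define a where "a m = (\<Sum>l<L. z m l) /\<^sub>R L" for m
  define y where "y m l = z m l - a m" for m l
  define V where "V = (\<Sum>m<M. \<Sum>l<L. (norm (y m l))\<^sup>2) / L"
  define W where "W = (\<Sum>m<M. \<Sum>l<L. (norm (y m l)) ^ 4) / L"
  define X where "X s = (\<Sum>m<M. y m (s m))" for s
  have cardE: "card E = L ^ M" unfolding E_def by (simp add: card_PiE)
  have sum_y: "(\<Sum>l<L. y m l) = 0" for m
    using L by (simp add: y_def a_def sum_subtractf sum_constant_scaleR)
  have var: "(\<Sum>l<L. (norm (y m l))\<^sup>2) \<le> (\<Sum>l<L. (norm (z m l))\<^sup>2)" for m
  proof -
    have "(\<Sum>l<L. (norm (z m l))\<^sup>2) = (\<Sum>l<L. (norm (y m l))\<^sup>2 + (norm (a m))\<^sup>2 + 2 * (y m l \<bullet> a m))"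
      unfolding y_def by (intro sum.cong refl)
        (simp add: power2_norm_eq_inner inner_diff_left inner_diff_right inner_commute)
    also have "\<dots> = (\<Sum>l<L. (norm (y m l))\<^sup>2) + L * (norm (a m))\<^sup>2"
      by (simp add: sum.distrib sum_distrib_left[symmetric] inner_sum_left[symmetric] sum_y)
    finally show ?thesis by simp
  qed
  have V_le: "V \<le> \<tau>"
    unfolding V_def \<tau>_def by (intro divide_right_mono sum_mono var) auto
  have V0: "V \<ge> 0" unfolding V_def by (intro divide_nonneg_nonneg sum_nonneg) auto
  have a_le: "norm (a m) \<le> 1" if "m < M" for m
  proof -
    have "norm (\<Sum>l<L. z m l) \<le> (\<Sum>l<L. 1)"
      using bound[OF that] by (intro sum_norm_le) auto
    then show ?thesis using L by (simp add: a_def field_simps)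
  qed
  have W_le: "W \<le> 4 * V"
  proof -
    have "(norm (y m l)) ^ 4 \<le> 4 * (norm (y m l))\<^sup>2" if "m < M" "l < L" for m l
    proof -
      have "norm (y m l) \<le> 2"
        unfolding y_def using norm_triangle_ineq4[of "z m l" "a m"] bound[OF that] a_le[OF that(1)] by linarith
      then have "(norm (y m l))\<^sup>2 \<le> 2\<^sup>2" by (intro power_mono) auto
      then have "(norm (y m l))\<^sup>2 * (norm (y m l))\<^sup>2 \<le> 4 * (norm (y m l))\<^sup>2"
        by (intro mult_right_mono) auto
      then show ?thesis by (simp add: power4_eq_xxxx power2_eq_square)
    qed
    then have "(\<Sum>m<M. \<Sum>l<L. (norm (y m l)) ^ 4) \<le> (\<Sum>m<M. \<Sum>l<L. 4 * (norm (y m l))\<^sup>2)"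
      by (intro sum_mono) auto
    then show ?thesis unfolding W_def V_def
      by (simp add: sum_distrib_left[symmetric] divide_right_mono)
  qed
  have \<tau>0: "\<tau> \<ge> 0" using V0 V_le by simp
  \<comment> \<open>At this threshold \<open>\<tau>\<close> times \<open>l powr (p - 2)\<close> bounds both contributions up to a constant.\<close>
  define l where "l = sqrt (1 + \<tau>)"
  have l: "l > 0" "l\<^sup>2 = 1 + \<tau>" unfolding l_def using \<tau>0 by auto
  have m2: "(\<Sum>s\<in>E. (norm (X s))\<^sup>2) = real L ^ M * V"
    and m4: "(\<Sum>s\<in>E. (norm (X s)) ^ 4) \<le> real L ^ M * (3 * V\<^sup>2 + W)"
    using independent_sum_moments[of L M y, OF L sum_y]
    unfolding E_def X_def V_def W_def by auto
  have split: "(\<Sum>m<M. z m (s m)) = \<mu> + X s" for s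
  proof -
    have "\<mu> = (\<Sum>m<M. a m)" unfolding \<mu>_def a_def by (simp add: scaleR_sum_right)
    then show ?thesis unfolding X_def y_def by (simp add: sum_subtractf)
  qed
  have lpow: "l powr (p - 4) * l\<^sup>2 = l powr (p - 2)"
    using l powr_add[of l "p - 4" 2] by simp
  have "(\<Sum>s\<in>E. norm (X s) powr p)
      \<le> (\<Sum>s\<in>E. l powr (p - 2) * (norm (X s))\<^sup>2 + l powr (p - 4) * (norm (X s)) ^ 4)"
    using l p by (intro sum_mono powr_le_square_fourth) auto
  also have "\<dots> = l powr (p - 2) * (\<Sum>s\<in>E. (norm (X s))\<^sup>2) + l powr (p - 4) * (\<Sum>s\<in>E. (norm (X s)) ^ 4)"
    by (simp add: sum.distrib sum_distrib_left)
  also have "\<dots> \<le> l powr (p - 2) * (real L ^ M * \<tau>) + l powr (p - 4) * (real L ^ M * (4 * \<tau> * l\<^sup>2))"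
  proof (intro add_mono mult_left_mono)
    show "(\<Sum>s\<in>E. (norm (X s))\<^sup>2) \<le> real L ^ M * \<tau>"
      unfolding m2 using V_le by (intro mult_left_mono) auto
    have "3 * V\<^sup>2 + W \<le> 3 * \<tau>\<^sup>2 + 4 * \<tau>"
      using V_le V0 W_le power_mono[of V \<tau> 2] by linarith
    also have "\<dots> \<le> 4 * \<tau> * l\<^sup>2" unfolding l(2) using \<tau>0 by (simp add: power2_eq_square algebra_simps)
    finally have "3 * V\<^sup>2 + W \<le> 4 * \<tau> * l\<^sup>2" .
    then show "(\<Sum>s\<in>E. (norm (X s)) ^ 4) \<le> real L ^ M * (4 * \<tau> * l\<^sup>2)"
      using m4 by (smt (verit) mult_left_mono of_nat_0_le_iff zero_le_power)
  qed auto
  also have "\<dots> = real L ^ M * (5 * (\<tau> * l powr (p - 2)))"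
    unfolding lpow[symmetric] by (simp add: algebra_simps)
  also have "l powr (p - 2) = (1 + \<tau>) powr (p / 2 - 1)"
  proof -
    have "l = (1 + \<tau>) powr (1 / 2)" unfolding l_def using \<tau>0 by (simp add: powr_half_sqrt)
    then show ?thesis by (simp add: powr_powr diff_divide_distrib)
  qed
  finally have Xp: "(\<Sum>s\<in>E. norm (X s) powr p) \<le> real L ^ M * (5 * (\<tau> * (1 + \<tau>) powr (p / 2 - 1)))" .
  have "(\<Sum>s\<in>E. norm (\<Sum>m<M. z m (s m)) powr p) \<le> (\<Sum>s\<in>E. 16 * (norm \<mu> powr p + norm (X s) powr p))"
  proof (intro sum_mono)
    fix s
    have "norm (\<Sum>m<M. z m (s m)) powr p \<le> (norm \<mu> + norm (X s)) powr p"
      unfolding split using p by (intro powr_mono2 norm_triangle_ineq) auto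
    also have "\<dots> \<le> 16 * (norm \<mu> powr p + norm (X s) powr p)"
      using p by (intro powr_add_le) auto
    finally show "norm (\<Sum>m<M. z m (s m)) powr p \<le> 16 * (norm \<mu> powr p + norm (X s) powr p)" .
  qed
  also have "\<dots> = 16 * (real L ^ M * norm \<mu> powr p + (\<Sum>s\<in>E. norm (X s) powr p))"
    by (simp add: sum_distrib_left[symmetric] sum.distrib cardE)
  also have "\<dots> \<le> 16 * (real L ^ M * norm \<mu> powr p + real L ^ M * (5 * (\<tau> * (1 + \<tau>) powr (p / 2 - 1))))"
    by (intro mult_left_mono add_left_mono Xp) auto
  also have "\<dots> = real L ^ M * (16 * (norm \<mu> powr p + 5 * (\<tau> * (1 + \<tau>) powr (p / 2 - 1))))"
    by (simp add: algebra_simps)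
  finally show ?thesis unfolding E_def .
qed

section \<open>Integration over the squares\<close>

lemma char_e_add: "char_e (a + b) = char_e a * char_e b"
  by (simp add: char_e_def distrib_left exp_add)

lemma norm_char_e [simp]: "norm (char_e t) = 1"
  by (simp add: char_e_def norm_exp_eq_Re)

lemma continuous_on_char_e [continuous_intros]:
  "continuous_on S f \<Longrightarrow> continuous_on S (\<lambda>x. char_e (f x))"
  unfolding char_e_def by (intro continuous_intros)

lemma measurable_char_e [measurable]: "char_e \<in> borel_measurable borel"
  by (intro borel_measurable_continuous_onI continuous_intros)

lemma measurable_vec_nth [measurable]:
  "(\<lambda>x::real^'n. x $ i) \<in> borel_measurable borel"
  by (intro borel_measurable_continuous_onI continuous_intros)

lemma norm_square_real2: "(norm (\<xi> :: real^2))\<^sup>2 = (\<xi> $ 1)\<^sup>2 + (\<xi> $ 2)\<^sup>2"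
  unfolding power2_norm_eq_inner by (simp add: inner_vec_def sum_2 power2_eq_square)

lemma lift_inner:
  "lift_paraboloid \<xi> \<bullet> x = \<xi> $ 1 * x $ 1 + \<xi> $ 2 * x $ 2 + ((\<xi> $ 1)\<^sup>2 + (\<xi> $ 2)\<^sup>2) * x $ 3"
  by (simp add: lift_paraboloid_def inner_vec_def sum_3 norm_square_real2)

lemma measurable_lift_inner [measurable (raw)]:
  assumes [measurable]: "f \<in> borel_measurable M" "g \<in> borel_measurable M"
  shows "(\<lambda>w. lift_paraboloid (f w) \<bullet> g w) \<in> borel_measurable M"
  unfolding lift_inner by measurable

text \<open>The pair \<open>q\<close> is the index of a square, and \<open>u\<close> in the unit square is the relative position in it, so
that all squares are parametrised by one and the same probability space.\<close>

definition grid_point :: "nat \<Rightarrow> nat \<times> nat \<Rightarrow> real ^ 2 \<Rightarrow> real ^ 2" where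
  "grid_point N q u = (1 / real N) *\<^sub>R vector [real (fst q), real (snd q)] + (1 / real N) *\<^sub>R u"

definition grid :: "nat \<Rightarrow> (nat \<times> nat) set" where
  "grid N = {..<N} \<times> {..<N}"

definition cell :: "nat \<Rightarrow> nat \<times> nat \<Rightarrow> (real ^ 2) set" where
  "cell N q = cbox (vector [real (fst q) / real N, real (snd q) / real N])
                   (vector [(real (fst q) + 1) / real N, (real (snd q) + 1) / real N])"

abbreviation unit_measure :: "'a::euclidean_space measure" where
  "unit_measure \<equiv> restrict_space lborel (cbox 0 One)"

lemma One_real2: "(One :: real ^ 2) = 1"
proof (rule euclidean_eqI)
  fix b :: "real ^ 2" assume b: "b \<in> Basis"
  then obtain i where "b = axis i 1" by (auto simp: Basis_vec_def)
  then have "1 \<bullet> b = 1" by (simp add: inner_axis)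
  then show "One \<bullet> b = 1 \<bullet> b" using inner_sum_left_Basis[OF b, of "\<lambda>_. 1"] by simp
qed

lemma unit_square_eq: "unit_square = cbox 0 (One :: real ^ 2)"
  by (simp add: unit_square_def One_real2)

lemma mem_unit_square:
  "u \<in> unit_square \<longleftrightarrow> 0 \<le> u $ 1 \<and> u $ 1 \<le> 1 \<and> 0 \<le> u $ 2 \<and> u $ 2 \<le> 1"
  by (auto simp: unit_square_def mem_box_cart forall_2)

lemma space_unit_measure [simp]: "space (unit_measure :: 'a::euclidean_space measure) = cbox 0 One"
  by (simp add: space_restrict_space)

lemma prob_space_unit_measure: "prob_space (unit_measure :: 'a::euclidean_space measure)"
proof (rule prob_spaceI)
  show "emeasure (unit_measure :: 'a measure) (space unit_measure) = 1"
    by (simp add: emeasure_restrict_space emeasure_lborel_cbox_eq)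
qed

lemma grid_point_nth [simp]:
  "grid_point N q u $ 1 = (real (fst q) + u $ 1) / real N"
  "grid_point N q u $ 2 = (real (snd q) + u $ 2) / real N"
  by (simp_all add: grid_point_def add_divide_distrib)

lemma measurable_grid_point [measurable]: "grid_point N q \<in> borel_measurable borel"
  unfolding grid_point_def by measurable

lemma finite_grid [simp]: "finite (grid N)" and card_grid: "card (grid N) = N\<^sup>2"
  by (auto simp: grid_def power2_eq_square)

lemma grid_point_in_cell:
  assumes "N > 0" shows "grid_point N q u \<in> cell N q \<longleftrightarrow> u \<in> unit_square"
  using assms by (auto simp: cell_def mem_box_cart forall_2 mem_unit_square field_simps)

lemma grid_point_in_unit_square:
  assumes "q \<in> grid N" "u \<in> unit_square" shows "grid_point N q u \<in> unit_square"
  using assms by (auto simp: grid_def mem_unit_square field_simps)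

lemma cell_subset_unit_square:
  assumes "q \<in> grid N" shows "cell N q \<subseteq> unit_square"
proof
  fix \<xi> assume "\<xi> \<in> cell N q"
  then have *: "real (fst q) / real N \<le> \<xi> $ 1" "\<xi> $ 1 \<le> (real (fst q) + 1) / real N"
      "real (snd q) / real N \<le> \<xi> $ 2" "\<xi> $ 2 \<le> (real (snd q) + 1) / real N"
    by (auto simp: cell_def mem_box_cart forall_2)
  have "(real (fst q) + 1) / real N \<le> 1" "(real (snd q) + 1) / real N \<le> 1"
    "real (fst q) / real N \<ge> 0" "real (snd q) / real N \<ge> 0"
    using assms by (auto simp: grid_def field_simps)
  with * show "\<xi> \<in> unit_square" unfolding mem_unit_square by linarith
qed

text \<open>The point 1 belongs to no half-open interval and is put into the last closed one.\<close>

lemma unit_interval_cover: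
  fixes t :: real
  assumes "0 \<le> t" "t \<le> 1" "N > 0"
  shows "\<exists>j<N. real j / real N \<le> t \<and> t \<le> (real j + 1) / real N"
proof (cases "t = 1")
  case True
  then show ?thesis using assms by (intro exI[of _ "N - 1"]) (auto simp: of_nat_diff field_simps)
next
  case False
  define j where "j = nat \<lfloor>t * real N\<rfloor>"
  have j: "real j \<le> t * real N" "t * real N < real j + 1"
    unfolding j_def using assms by (auto intro!: of_nat_floor)
  moreover have "t * real N < real N" using False assms by simp
  then have "j < N" using j by linarith
  ultimately show ?thesis using assms by (intro exI[of _ j]) (auto simp: field_simps)
qed

lemma unit_square_eq_Union_cell:
  assumes "N > 0" shows "unit_square = (\<Union>q\<in>grid N. cell N q)"
proof (intro equalityI subsetI)
  fix \<xi> :: "real ^ 2" assume "\<xi> \<in> unit_square"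
  then obtain j i where "j < N" "real j / real N \<le> \<xi> $ 1 \<and> \<xi> $ 1 \<le> (real j + 1) / real N"
      "i < N" "real i / real N \<le> \<xi> $ 2 \<and> \<xi> $ 2 \<le> (real i + 1) / real N"
    using unit_interval_cover[of "\<xi> $ 1" N] unit_interval_cover[of "\<xi> $ 2" N] assms
    unfolding mem_unit_square by metis
  then show "\<xi> \<in> (\<Union>q\<in>grid N. cell N q)"
    by (intro UN_I[of "(j, i)"]) (auto simp: grid_def cell_def mem_box_cart forall_2)
qed (use cell_subset_unit_square in blast)

lemma squares_eq_cells:
  assumes N: "N > 0" and R: "sqrt (real R) = real N"
  shows "squares R = cell N ` grid N"
proof (intro equalityI subsetI)
  fix Q assume "Q \<in> squares R"
  then obtain j i :: nat where Q: "Q \<subseteq> unit_square" "Q = cell N (j, i)"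
    unfolding squares_def R cell_def by auto
  have "grid_point N (j, i) 1 \<in> Q" unfolding Q using N
    by (simp add: grid_point_in_cell mem_unit_square)
  with Q have "grid_point N (j, i) 1 \<in> unit_square" by auto
  then have "(j, i) \<in> grid N" using N by (simp add: mem_unit_square grid_def field_simps)
  then show "Q \<in> cell N ` grid N" using Q by auto
next
  fix Q assume "Q \<in> cell N ` grid N"
  then obtain q where "q \<in> grid N" "Q = cell N q" by auto
  then show "Q \<in> squares R"
    using cell_subset_unit_square[of q N] unfolding squares_def R cell_def by auto
qed

lemma inj_cell:
  assumes N: "N > 0" shows "inj (cell N)"
proof
  have *: "fst q \<le> fst r" "snd q \<le> snd r" if "cell N q = cell N r" for q r
  proof -
    have "grid_point N r 0 \<in> cell N q"
      unfolding that using N by (simp add: grid_point_in_cell mem_unit_square)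
    then show "fst q \<le> fst r" "snd q \<le> snd r"
      using N by (auto simp: cell_def mem_box_cart forall_2 field_simps)
  qed
  show "q = r" if "cell N q = cell N r" for q r
    using *[OF that] *[OF that[symmetric]] by (auto simp: prod_eq_iff)
qed

lemma cell_inter_negligible:
  assumes N: "N > 0" and "q \<noteq> r"
  shows "cell N q \<inter> cell N r \<in> null_sets lebesgue"
proof -
  have hyperplane: "negligible {\<xi> :: real^2. \<xi> $ k = c}" for k c
    using negligible_hyperplane[of "axis k 1 :: real^2" c] by (simp add: inner_axis' axis_eq_0_iff)
  have neg: "negligible (cell N q \<inter> cell N r)" if less: "fst q < fst r \<or> snd q < snd r" for q r
  proof (rule negligible_subset[OF negligible_Un[OF hyperplane hyperplane]])
    show "cell N q \<inter> cell N r \<subseteq> {\<xi>. \<xi> $ 1 = real (fst r) / N} \<union> {\<xi>. \<xi> $ 2 = real (snd r) / N}"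
    proof
      fix \<xi> assume "\<xi> \<in> cell N q \<inter> cell N r"
      then have "\<xi> $ 1 \<le> (real (fst q) + 1) / N" "real (fst r) / N \<le> \<xi> $ 1"
          "\<xi> $ 2 \<le> (real (snd q) + 1) / N" "real (snd r) / N \<le> \<xi> $ 2"
        by (auto simp: cell_def mem_box_cart forall_2)
      moreover have "(real (fst q) + 1) / N \<le> real (fst r) / N \<or> (real (snd q) + 1) / N \<le> real (snd r) / N"
        using less by (auto intro!: divide_right_mono)
      ultimately show "\<xi> \<in> {\<xi>. \<xi> $ 1 = real (fst r) / N} \<union> {\<xi>. \<xi> $ 2 = real (snd r) / N}"
        by auto
    qed
  qed
  have "negligible (cell N q \<inter> cell N r)"
  proof (cases "fst q < fst r \<or> snd q < snd r")
    case False
    with \<open>q \<noteq> r\<close> have "fst r < fst q \<or> snd r < snd q"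
      by (metis linorder_neqE_nat prod_eqI)
    then show ?thesis using neg[of r q] by (simp add: Int_commute)
  qed (rule neg)
  then show ?thesis by (simp add: negligible_iff_null_sets)
qed

lemma cell_borel [measurable]: "cell N q \<in> sets borel"
  by (simp add: cell_def)

lemma integral_cell:
  fixes f :: "real ^ 2 \<Rightarrow> complex"
  assumes N: "N > 0" and f [measurable]: "f \<in> borel_measurable borel"
  shows "(LINT \<xi>:cell N q|lebesgue. f \<xi>) = (\<integral>u. f (grid_point N q u) \<partial>unit_measure) / (real N)\<^sup>2"
proof -
  let ?t = "(1 / real N) *\<^sub>R vector [real (fst q), real (snd q)] :: real ^ 2"
  have "(LINT \<xi>:cell N q|lebesgue. f \<xi>) = (\<integral>\<xi>. indicator (cell N q) \<xi> *\<^sub>R f \<xi> \<partial>lborel)"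
    unfolding set_lebesgue_integral_def by (rule integral_completion) measurable
  also have "\<dots> = (\<integral>\<xi>. indicator (cell N q) \<xi> *\<^sub>R f \<xi>
      \<partial>density (distr lborel borel (\<lambda>x. ?t + (1 / real N) *\<^sub>R x)) (\<lambda>_. \<bar>1 / real N\<bar> ^ DIM(real^2)))"
    using N by (subst lborel_affine[of "1 / real N" ?t]) auto
  also have "\<dots> = (\<integral>u. (1 / (real N)\<^sup>2) *\<^sub>R (indicator (cell N q) (grid_point N q u) *\<^sub>R f (grid_point N q u)) \<partial>lborel)"
    by (subst integral_density) (auto simp: integral_distr grid_point_def power_divide)
  also have "\<dots> = (\<integral>u. indicator (cbox 0 One) u *\<^sub>R f (grid_point N q u) \<partial>lborel) / (real N)\<^sup>2"
    using N by (simp add: indicator_def grid_point_in_cell unit_square_eq scaleR_conv_of_real divide_inverse mult.commute)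
  also have "(\<integral>u. indicator (cbox 0 One) u *\<^sub>R f (grid_point N q u) \<partial>lborel)
      = (\<integral>u. f (grid_point N q u) \<partial>unit_measure)"
    by (subst integral_restrict_space) auto
  finally show ?thesis .
qed

lemma integral_Union_cells:
  fixes f :: "real ^ 2 \<Rightarrow> complex"
  assumes N: "N > 0" and J: "J \<subseteq> grid N" and f [measurable]: "f \<in> borel_measurable borel"
    and B: "\<And>\<xi>. norm (f \<xi>) \<le> B"
  shows "(LINT \<xi>:(\<Union>q\<in>J. cell N q)|lebesgue. f \<xi>)
    = (\<Sum>q\<in>J. (\<integral>u. f (grid_point N q u) \<partial>unit_measure)) / (real N)\<^sup>2"
proof -
  have fin: "finite J" using J finite_subset[OF _ finite_grid] by auto
  have "(LINT \<xi>:(\<Union>q\<in>J. cell N q)|lebesgue. f \<xi>) = (\<Sum>q\<in>J. (LINT \<xi>:cell N q|lebesgue. f \<xi>))"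
  proof (rule set_integral_finite_UN_AE[OF fin])
    fix q assume "q \<in> J"
    show "set_integrable lebesgue (cell N q) f"
      unfolding set_integrable_def
      by (rule integrable_completion[THEN iffD2], measurable)
         (intro integrableI_bounded_set_indicator[where B=B], auto simp: B cell_def emeasure_lborel_cbox_eq)
  next
    fix q r assume "q \<in> J" "r \<in> J"
    show "AE x in lebesgue. (x \<in> cell N q \<and> x \<in> cell N r) \<longrightarrow> q = r"
      using AE_not_in[OF cell_inter_negligible[OF N, of q r]] by (cases "q = r") auto
  qed auto
  then show ?thesis
    using integral_cell[OF N f] by (simp add: sum_divide_distrib)
qed

section \<open>Exponential sums with one frequency in each square\<close>

lemma powr_tangent_le:
  fixes t p :: real
  assumes "0 \<le> t" "1 \<le> p"
  shows "1 + p * (t - 1) \<le> t powr p"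
proof (cases "t = 0")
  case False
  have "p * (t - 1) \<le> t powr p - 1 powr p"
  proof (rule convex_on_imp_above_tangent[where A="{0<..}"])
    show "((\<lambda>x. x powr p) has_real_derivative p) (at 1 within {0<..})"
      by (auto intro!: derivative_eq_intros)
  qed (use assms False powr_convex in \<open>auto simp: interior_open\<close>)
  then show ?thesis by simp
qed (use assms in auto)

text \<open>Jensen's inequality, obtained from the tangent of \<open>t powr p\<close> at the mean of the norms. The tangent
inequality includes \<open>t = 0\<close>, where a norm may well be.\<close>

lemma norm_average_powr_le:
  fixes f :: "'a \<Rightarrow> 'b::{banach, second_countable_topology}"
  assumes M: "prob_space M" and [measurable]: "f \<in> borel_measurable M"
    and B: "\<And>x. x \<in> space M \<Longrightarrow> norm (f x) \<le> B" and p: "1 \<le> p"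
  shows "ennreal (norm (\<integral>x. f x \<partial>M) powr p) \<le> (\<integral>\<^sup>+x. ennreal (norm (f x) powr p) \<partial>M)"
proof -
  interpret prob_space M by (rule M)
  have int_f: "integrable M f"
    by (rule integrable_const_bound[of _ B]) (auto simp: B)
  then have int_n: "integrable M (\<lambda>x. norm (f x))" by simp
  have int_p: "integrable M (\<lambda>x. norm (f x) powr p)"
    by (rule integrable_const_bound[of _ "B powr p"]) (use B p in \<open>auto intro!: powr_mono2 AE_I2\<close>)
  define m where "m = (\<integral>x. norm (f x) \<partial>M)"
  have m0: "m \<ge> 0" unfolding m_def by simp
  have "m powr p \<le> (\<integral>x. norm (f x) powr p \<partial>M)"
  proof (cases "m = 0")
    case False
    with m0 have m: "m > 0" by simp
    have "m powr p = (\<integral>x. m powr p * (1 + p * (norm (f x) / m - 1)) \<partial>M)"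
      using int_n m prob_space by (simp add: m_def[symmetric] algebra_simps)
    also have "\<dots> \<le> (\<integral>x. norm (f x) powr p \<partial>M)"
    proof (rule integral_mono)
      show "integrable M (\<lambda>x. m powr p * (1 + p * (norm (f x) / m - 1)))"
        using int_n by auto
      fix x
      have "m powr p * (1 + p * (norm (f x) / m - 1)) \<le> m powr p * (norm (f x) / m) powr p"
        using m p by (intro mult_left_mono powr_tangent_le) auto
      also have "\<dots> = norm (f x) powr p" using m by (simp flip: powr_mult)
      finally show "m powr p * (1 + p * (norm (f x) / m - 1)) \<le> norm (f x) powr p" .
    qed (rule int_p)
    finally show ?thesis .
  qed (use p in simp)
  moreover have "norm (\<integral>x. f x \<partial>M) powr p \<le> m powr p"
    unfolding m_def using p by (intro powr_mono2 integral_norm_bound) auto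
  ultimately have "ennreal (norm (\<integral>x. f x \<partial>M) powr p) \<le> ennreal (\<integral>x. norm (f x) powr p \<partial>M)"
    by (intro ennreal_leI) linarith
  also have "\<dots> = (\<integral>\<^sup>+x. ennreal (norm (f x) powr p) \<partial>M)"
    by (rule nn_integral_eq_integral[symmetric, OF int_p]) auto
  finally show ?thesis .
qed

text \<open>The \<open>p\<close>-th power of an \<open>L\<^sup>p\<close> norm, with values in the extended reals, so that Tonelli's theorem
applies without integrability conditions.\<close>

definition Lp_mass :: "real \<Rightarrow> 'a::euclidean_space set \<Rightarrow> ('a \<Rightarrow> complex) \<Rightarrow> ennreal" where
  "Lp_mass p A f = (\<integral>\<^sup>+x\<in>A. ennreal (norm (f x) powr p) \<partial>lborel)"

text \<open>Minkowski's integral inequality in the form needed here: an average of functions which all have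
\<open>p\<close>-th power integral at most \<open>K\<close> has the same property.\<close>

lemma Lp_mass_average_le:
  fixes g :: "'a \<Rightarrow> 'b::euclidean_space \<Rightarrow> complex"
  assumes M: "prob_space M"
    and g [measurable]: "(\<lambda>(w, x). g w x) \<in> borel_measurable (M \<Otimes>\<^sub>M lborel)"
    and B: "\<And>w x. w \<in> space M \<Longrightarrow> norm (g w x) \<le> B x"
    and p: "1 \<le> p" and A [measurable]: "A \<in> sets borel"
    and K: "\<And>w. w \<in> space M \<Longrightarrow> Lp_mass p A (g w) \<le> K"
  shows "Lp_mass p A (\<lambda>x. \<integral>w. g w x \<partial>M) \<le> K"
proof -
  interpret prob_space M by (rule M)
  interpret pair_sigma_finite M "lborel :: 'b measure" ..
  have gm [measurable]: "(\<lambda>w. g w x) \<in> borel_measurable M" for x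
    using measurable_compose[OF measurable_Pair2' g, of x] by simp
  have "Lp_mass p A (\<lambda>x. \<integral>w. g w x \<partial>M)
      \<le> (\<integral>\<^sup>+x. (\<integral>\<^sup>+w. ennreal (norm (g w x) powr p) * indicator A x \<partial>M) \<partial>lborel)"
    unfolding Lp_mass_def
    by (intro nn_integral_mono) (use B p M in \<open>auto simp: indicator_def intro!: norm_average_powr_le\<close>)
  also have "\<dots> = (\<integral>\<^sup>+w. (\<integral>\<^sup>+x. ennreal (norm (g w x) powr p) * indicator A x \<partial>lborel) \<partial>M)"
    by (rule Fubini') measurable
  also have "\<dots> \<le> (\<integral>\<^sup>+w. K \<partial>M)"
    using K by (intro nn_integral_mono) (auto simp: Lp_mass_def)
  also have "\<dots> = K" using emeasure_space_1 by simp
  finally show ?thesis .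
qed

lemma Lp_mass_add_le:
  fixes f g :: "'a::euclidean_space \<Rightarrow> complex"
  assumes [measurable]: "f \<in> borel_measurable borel" "g \<in> borel_measurable borel" "A \<in> sets borel"
    and p: "0 \<le> p" "p \<le> 4"
  shows "Lp_mass p A (\<lambda>x. f x + g x) \<le> 16 * (Lp_mass p A f + Lp_mass p A g)"
proof -
  have "Lp_mass p A (\<lambda>x. f x + g x)
     \<le> (\<integral>\<^sup>+x. 16 * (ennreal (norm (f x) powr p) * indicator A x + ennreal (norm (g x) powr p) * indicator A x) \<partial>lborel)"
    unfolding Lp_mass_def
  proof (intro nn_integral_mono)
    fix x
    have "norm (f x + g x) powr p \<le> 16 * (norm (f x) powr p + norm (g x) powr p)"
      using powr_mono2[OF p(1) _ norm_triangle_ineq[of "f x" "g x"]]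
        powr_add_le[of "norm (f x)" "norm (g x)" p] p by simp
    then have "ennreal (norm (f x + g x) powr p) \<le> ennreal (16 * (norm (f x) powr p + norm (g x) powr p))"
      by (rule ennreal_leI)
    also have "\<dots> = 16 * (ennreal (norm (f x) powr p) + ennreal (norm (g x) powr p))"
      by (simp add: ennreal_mult)
    finally show "ennreal (norm (f x + g x) powr p) * indicator A x
      \<le> 16 * (ennreal (norm (f x) powr p) * indicator A x + ennreal (norm (g x) powr p) * indicator A x)"
      by (auto simp: indicator_def)
  qed
  also have "\<dots> = 16 * (Lp_mass p A f + Lp_mass p A g)"
    by (simp add: nn_integral_cmult nn_integral_add Lp_mass_def)
  finally show ?thesis .
qed

text \<open>The frequencies are one point of each square, at the relative position \<open>\<zeta> q\<close>.\<close>

definition expsum :: "nat \<Rightarrow> (nat \<times> nat \<Rightarrow> complex) \<Rightarrow> (nat \<times> nat \<Rightarrow> real ^ 2) \<Rightarrow> real ^ 3 \<Rightarrow> complex" where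
  "expsum N a \<zeta> x = (\<Sum>q\<in>grid N. a q * char_e (lift_paraboloid (grid_point N q (\<zeta> q)) \<bullet> x))"

text \<open>The quantity into which errors are absorbed. The positions \<open>\<zeta>\<close> vary with the square because moving
the frequencies along segments leads to sums of this general kind.\<close>

definition worst_expsum :: "real \<Rightarrow> nat \<Rightarrow> (real ^ 3) set \<Rightarrow> ennreal" where
  "worst_expsum p N A = (SUP (a, \<zeta>)\<in>{(a, \<zeta>). (\<forall>q\<in>grid N. norm (a q) \<le> 1) \<and> (\<forall>q\<in>grid N. \<zeta> q \<in> unit_square)}.
     Lp_mass p A (expsum N a \<zeta>))"

lemma Lp_mass_expsum_le_worst:
  assumes "\<And>q. q \<in> grid N \<Longrightarrow> norm (a q) \<le> 1" "\<And>q. q \<in> grid N \<Longrightarrow> \<zeta> q \<in> unit_square"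
  shows "Lp_mass p A (expsum N a \<zeta>) \<le> worst_expsum p N A"
  unfolding worst_expsum_def by (rule SUP_upper2[of "(a, \<zeta>)"]) (use assms in auto)

lemma norm_expsum_le:
  assumes "\<And>q. q \<in> grid N \<Longrightarrow> norm (a q) \<le> 1"
  shows "norm (expsum N a \<zeta> x) \<le> (real N)\<^sup>2"
proof -
  have "norm (expsum N a \<zeta> x) \<le> (\<Sum>q\<in>grid N. 1)"
    unfolding expsum_def by (intro sum_norm_le) (use assms in \<open>auto simp: norm_mult\<close>)
  then show ?thesis by (simp add: card_grid)
qed

lemma measurable_expsum [measurable]: "expsum N a \<zeta> \<in> borel_measurable borel"
  unfolding expsum_def by measurable

lemma worst_expsum_finite:
  assumes A: "A \<in> sets borel" "emeasure lborel A < \<infinity>" and p: "0 \<le> p"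
  shows "worst_expsum p N A < \<infinity>"
proof -
  have "Lp_mass p A (expsum N a \<zeta>) \<le> ennreal ((real N)\<^sup>2 powr p) * emeasure lborel A"
    if "\<forall>q\<in>grid N. norm (a q) \<le> 1" for a \<zeta>
  proof -
    have "Lp_mass p A (expsum N a \<zeta>) \<le> (\<integral>\<^sup>+x. ennreal ((real N)\<^sup>2 powr p) * indicator A x \<partial>lborel)"
      unfolding Lp_mass_def
      by (intro nn_integral_mono mult_right_mono ennreal_leI powr_mono2 norm_expsum_le) (use that p in auto)
    then show ?thesis using A by (simp add: nn_integral_cmult_indicator)
  qed
  then have "worst_expsum p N A \<le> ennreal ((real N)\<^sup>2 powr p) * emeasure lborel A"
    unfolding worst_expsum_def by (intro SUP_least) auto
  also have "\<dots> < \<infinity>" using A by (simp add: ennreal_mult_less_top)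
  finally show ?thesis .
qed

text \<open>This is \<open>R\<close> times the extension of the indicator function of the square \<open>q\<close>.\<close>

definition cell_packet :: "nat \<Rightarrow> nat \<times> nat \<Rightarrow> real ^ 3 \<Rightarrow> complex" where
  "cell_packet N q x = (\<integral>u. char_e (lift_paraboloid (grid_point N q u) \<bullet> x) \<partial>unit_measure)"

definition packet_sum :: "nat \<Rightarrow> (nat \<times> nat \<Rightarrow> complex) \<Rightarrow> real ^ 3 \<Rightarrow> complex" where
  "packet_sum N a x = (\<Sum>q\<in>grid N. a q * cell_packet N q x)"

lemma measurable_unit_id:
  "(\<lambda>u::'a::euclidean_space. u) \<in> borel_measurable unit_measure"
  by (intro measurable_restrict_space1) simp

lemma measurable_on_unit_measure:
  "f \<in> borel_measurable borel \<Longrightarrow> f \<in> borel_measurable unit_measure"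
  by (intro measurable_restrict_space1) simp

lemma char_e_lift_unit_measurable [measurable]:
  "(\<lambda>u. char_e (lift_paraboloid (grid_point N q u) \<bullet> x)) \<in> borel_measurable unit_measure"
  by (intro measurable_on_unit_measure) measurable

lemma integrable_unit_measure_bounded:
  fixes f :: "'a::euclidean_space \<Rightarrow> 'b::{banach, second_countable_topology}"
  assumes "f \<in> borel_measurable unit_measure" "\<And>u. norm (f u) \<le> B"
  shows "integrable unit_measure f"
proof -
  interpret prob_space "unit_measure :: 'a measure" by (rule prob_space_unit_measure)
  show ?thesis by (rule integrable_const_bound[of _ B]) (use assms in auto)
qed

lemma average_expsum:
  "(\<integral>u. expsum N a (\<lambda>_. u) x \<partial>unit_measure) = packet_sum N a x"
  unfolding expsum_def packet_sum_def cell_packet_def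
  by (subst Bochner_Integration.integral_sum)
     (auto intro!: integrable_mult_right integrable_unit_measure_bounded[where B=1])

lemma measurable_fst_unit [measurable]:
  "fst \<in> borel_measurable ((unit_measure :: 'a::euclidean_space measure) \<Otimes>\<^sub>M M)"
proof -
  have "(\<lambda>w. id (fst w)) \<in> borel_measurable ((unit_measure :: 'a measure) \<Otimes>\<^sub>M M)"
    by (rule measurable_compose[OF measurable_fst]) (simp add: id_def measurable_unit_id)
  then show ?thesis by simp
qed

lemma measurable_snd_unit [measurable]:
  "snd \<in> borel_measurable (M \<Otimes>\<^sub>M (unit_measure :: 'a::euclidean_space measure))"
proof -
  have "(\<lambda>w. id (snd w)) \<in> borel_measurable (M \<Otimes>\<^sub>M (unit_measure :: 'a measure))"
    by (rule measurable_compose[OF measurable_snd]) (simp add: id_def measurable_unit_id)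
  then show ?thesis by simp
qed

lemma measurable_packet_sum: "packet_sum N a \<in> borel_measurable borel"
  and measurable_cell_packet [measurable]: "cell_packet N q \<in> borel_measurable borel"
proof -
  interpret U: prob_space "unit_measure :: (real ^ 2) measure" by (rule prob_space_unit_measure)
  have c: "cell_packet N q \<in> borel_measurable borel" for q
  proof -
    have "(\<lambda>x. \<integral>u. char_e (lift_paraboloid (grid_point N q u) \<bullet> x) \<partial>(unit_measure :: (real^2) measure)) \<in> borel_measurable lborel"
      by (rule U.borel_measurable_lebesgue_integral) (unfold case_prod_unfold, measurable)
    then show ?thesis by (simp add: cell_packet_def[abs_def])
  qed
  then show "cell_packet N q \<in> borel_measurable borel" .
  note c[measurable]
  show "packet_sum N a \<in> borel_measurable borel"
    unfolding packet_sum_def by measurable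
qed

text \<open>Points of the unit square are pairs of a square and a relative position; integrating over the
squares first turns the extension into an average of exponential sums in which all frequencies have
the same relative position.\<close>

lemma extension_eq_average:
  assumes N: "N > 0" and F [measurable]: "F \<in> borel_measurable borel" and B: "\<And>\<xi>. norm (F \<xi>) \<le> B"
  shows "extension unit_square F x
    = (\<integral>u. expsum N (\<lambda>q. F (grid_point N q u) / (real N)\<^sup>2) (\<lambda>_. u) x \<partial>unit_measure)"
proof -
  let ?f = "\<lambda>\<xi>. F \<xi> * char_e (lift_paraboloid \<xi> \<bullet> x)"
  have "extension unit_square F x
    = (\<Sum>q\<in>grid N. (\<integral>u. ?f (grid_point N q u) \<partial>unit_measure)) / (real N)\<^sup>2"
    unfolding extension_def unit_square_eq_Union_cell[OF N]
    by (rule integral_Union_cells[OF N, where B=B]) (auto simp: norm_mult B)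
  also have "\<dots> = (\<integral>u. (\<Sum>q\<in>grid N. ?f (grid_point N q u)) \<partial>unit_measure) / (real N)\<^sup>2"
    by (subst Bochner_Integration.integral_sum)
       (auto intro!: integrable_unit_measure_bounded[where B=B] measurable_on_unit_measure simp: norm_mult B)
  also have "\<dots> = (\<integral>u. (\<Sum>q\<in>grid N. ?f (grid_point N q u)) / (real N)\<^sup>2 \<partial>unit_measure)"
    by simp
  finally show ?thesis by (simp add: expsum_def sum_divide_distrib)
qed

lemma Lp_mass_extension_le_worst:
  assumes N: "N > 0" and F [measurable]: "F \<in> borel_measurable borel"
    and B: "\<And>\<xi>. norm (F \<xi>) \<le> (real N)\<^sup>2"
    and p: "1 \<le> p" and A: "A \<in> sets borel"
  shows "Lp_mass p A (extension unit_square F) \<le> worst_expsum p N A"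
proof -
  have nrm: "norm (F (grid_point N q u) / (real N)\<^sup>2) \<le> 1" for q u
    using B[of "grid_point N q u"] N by (simp add: norm_divide norm_power)
  have eq: "extension unit_square F
    = (\<lambda>x. \<integral>u. expsum N (\<lambda>q. F (grid_point N q u) / (real N)\<^sup>2) (\<lambda>_. u) x \<partial>unit_measure)"
    using extension_eq_average[OF N F B] by auto
  show ?thesis unfolding eq
  proof (rule Lp_mass_average_le[OF prob_space_unit_measure _ _ p A])
    show "(\<lambda>(u, x). expsum N (\<lambda>q. F (grid_point N q u) / (real N)\<^sup>2) (\<lambda>_. u) x)
        \<in> borel_measurable (unit_measure \<Otimes>\<^sub>M lborel)"
      unfolding expsum_def case_prod_unfold by measurable
    show "norm (expsum N (\<lambda>q. F (grid_point N q u) / (real N)\<^sup>2) (\<lambda>_. u) x) \<le> (real N)\<^sup>2" for u x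
      by (rule norm_expsum_le[OF nrm])
    show "Lp_mass p A (expsum N (\<lambda>q. F (grid_point N q u) / (real N)\<^sup>2) (\<lambda>_. u)) \<le> worst_expsum p N A"
      if "u \<in> space unit_measure" for u
      by (rule Lp_mass_expsum_le_worst) (use nrm that in \<open>auto simp: unit_square_eq\<close>)
  qed
qed

section \<open>Moving the frequencies within their squares\<close>

text \<open>A crude form of convexity, for the three coordinate directions.\<close>

lemma powr_sum3_le:
  fixes b :: "3 \<Rightarrow> real"
  assumes "\<And>k. 0 \<le> b k" "0 \<le> p"
  shows "(\<Sum>k\<in>UNIV. b k) powr p \<le> 3 powr p * (\<Sum>k\<in>UNIV. b k powr p)"
proof -
  define m where "m = Max (range b)"
  have m: "b k \<le> m" for k unfolding m_def by (intro Max_ge) auto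
  have "m \<in> range b" unfolding m_def by (intro Max_in) auto
  then obtain k0 where k0: "m = b k0" by auto
  have "(\<Sum>k\<in>UNIV. b k) \<le> of_nat (card (UNIV :: 3 set)) * m"
    by (intro sum_bounded_above m)
  then have "(\<Sum>k\<in>UNIV. b k) powr p \<le> (3 * m) powr p"
    using assms by (intro powr_mono2 sum_nonneg) auto
  also have "\<dots> = 3 powr p * b k0 powr p" using assms k0 by (simp add: powr_mult)
  also have "\<dots> \<le> 3 powr p * (\<Sum>k\<in>UNIV. b k powr p)"
    by (intro mult_left_mono member_le_sum) auto
  finally show ?thesis .
qed

lemma char_e_has_vector_derivative:
  assumes "(\<phi> has_real_derivative d) (at s within S)"
  shows "((\<lambda>s. char_e (\<phi> s)) has_vector_derivative (2 * of_real pi * \<i> * of_real d * char_e (\<phi> s))) (at s within S)"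
proof -
  have "((\<lambda>s. complex_of_real (\<phi> s)) has_vector_derivative of_real d) (at s within S)"
    using has_vector_derivative_of_real[OF assms] .
  then have 1: "((\<lambda>s. 2 * of_real pi * \<i> * complex_of_real (\<phi> s)) has_vector_derivative (2 * of_real pi * \<i> * of_real d)) (at s within S)"
    by (rule has_vector_derivative_mult_right)
  have 2: "(exp has_field_derivative exp (2 * of_real pi * \<i> * complex_of_real (\<phi> s)))
      (at (2 * of_real pi * \<i> * complex_of_real (\<phi> s)) within (\<lambda>s. 2 * of_real pi * \<i> * complex_of_real (\<phi> s)) ` S)"
    by (intro DERIV_exp has_field_derivative_at_within)
  show ?thesis
    using field_vector_diff_chain_within[OF 1 2] unfolding char_e_def o_def by simp
qed

text \<open>The frequencies are moved along straight segments, and the difference is the integral of the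
derivative. Differentiating the phase produces a factor \<open>x $ k / N\<close> for each coordinate, times a
coefficient that depends on the square; divided by \<open>4 / N\<close> this coefficient is at most 1 in modulus.
So the derivative consists of three exponential sums of the same kind, with small prefactors.\<close>

lemma expsum_difference_eq_integral:
  fixes N :: nat and a \<zeta> u x
  assumes N: "N > 0"
  defines "\<zeta>' \<equiv> \<lambda>s q. u + s *\<^sub>R (\<zeta> q - u)"
    and "b \<equiv> \<lambda>k::3. \<lambda>s q. a q * complex_of_real (if k = 1 then (\<zeta> q - u) $ 1 / 4 else if k = 2 then (\<zeta> q - u) $ 2 / 4
       else (grid_point N q (u + s *\<^sub>R (\<zeta> q - u)) $ 1 * (\<zeta> q - u) $ 1
           + grid_point N q (u + s *\<^sub>R (\<zeta> q - u)) $ 2 * (\<zeta> q - u) $ 2) / 2)"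
  shows "expsum N a \<zeta> x - expsum N a (\<lambda>_. u) x
    = (\<integral>s. (\<Sum>k\<in>UNIV. (8 * of_real pi * \<i> * complex_of_real (x $ k / N)) * expsum N (b k s) (\<zeta>' s) x) \<partial>unit_measure)"
proof -
  define g where "g s = (\<Sum>k\<in>UNIV. (8 * of_real pi * \<i> * complex_of_real (x $ k / N)) * expsum N (b k s) (\<zeta>' s) x)" for s
  have cont: "continuous_on {0..1} g"
    unfolding g_def expsum_def b_def \<zeta>'_def lift_inner grid_point_nth sum_3
    by (simp, intro continuous_intros) (use N in auto)
  have der: "((\<lambda>s. expsum N a (\<zeta>' s) x) has_vector_derivative g s) (at s within {0..1})" for s
  proof -
    define \<phi> where "\<phi> q s = lift_paraboloid (grid_point N q (\<zeta>' s q)) \<bullet> x" for q s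
    define d where "d q s = ((\<zeta> q - u) $ 1 * x $ 1 + (\<zeta> q - u) $ 2 * x $ 2
       + 2 * (grid_point N q (\<zeta>' s q) $ 1 * (\<zeta> q - u) $ 1
           + grid_point N q (\<zeta>' s q) $ 2 * (\<zeta> q - u) $ 2) * x $ 3) / N" for q s
    have p: "((\<lambda>s. grid_point N q (\<zeta>' s q) $ i) has_real_derivative (\<zeta> q - u) $ i / N) (at s within {0..1})" for q i
      unfolding grid_point_def \<zeta>'_def using N by (auto intro!: derivative_eq_intros)
    have "(\<phi> q has_real_derivative d q s) (at s within {0..1})" for q
      unfolding \<phi>_def d_def lift_inner
      by (rule derivative_eq_intros p refl)+ (simp del: grid_point_nth add: divide_inverse algebra_simps)
    then have "((\<lambda>s. expsum N a (\<zeta>' s) x) has_vector_derivative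
       (\<Sum>q\<in>grid N. a q * (2 * of_real pi * \<i> * of_real (d q s) * char_e (\<phi> q s)))) (at s within {0..1})"
      unfolding expsum_def \<phi>_def
      by (intro has_vector_derivative_sum has_vector_derivative_mult_right char_e_has_vector_derivative)
    also have "(\<Sum>q\<in>grid N. a q * (2 * of_real pi * \<i> * of_real (d q s) * char_e (\<phi> q s))) = g s"
    proof -
      define c where "c k q = (if k = (1::3) then (\<zeta> q - u) $ 1 / 4 else if k = 2 then (\<zeta> q - u) $ 2 / 4
        else (grid_point N q (\<zeta>' s q) $ 1 * (\<zeta> q - u) $ 1
           + grid_point N q (\<zeta>' s q) $ 2 * (\<zeta> q - u) $ 2) / 2)" for k q
      have "d q s = (\<Sum>k\<in>UNIV. 4 * (x $ k / N) * c k q)" for q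
        by (simp del: grid_point_nth vector_minus_component add: sum_3 d_def c_def add_divide_distrib algebra_simps)
      then have d: "complex_of_real (d q s) = (\<Sum>k\<in>UNIV. 4 * of_real (x $ k / N) * of_real (c k q))" for q
        by simp
      have bc: "b k s q = a q * of_real (c k q)" for k q
        unfolding b_def c_def \<zeta>'_def ..
      show ?thesis
        unfolding g_def expsum_def sum_distrib_left d sum_distrib_right bc \<phi>_def
        by (subst sum.swap, intro sum.cong refl) (simp add: mult_ac)
    qed
    finally show ?thesis .
  qed
  have "(\<integral>s. g s \<partial>unit_measure) = (\<integral>s. indicator {0..1} s *\<^sub>R g s \<partial>lborel)"
    by (subst integral_restrict_space) auto
  also have "\<dots> = expsum N a (\<zeta>' 1) x - expsum N a (\<zeta>' 0) x"
    by (rule integral_FTC_Icc[OF _ der cont]) simp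
  also have "\<dots> = expsum N a \<zeta> x - expsum N a (\<lambda>_. u) x"
    by (simp add: \<zeta>'_def)
  finally show ?thesis by (simp add: g_def)
qed

text \<open>The prefactors are at most \<open>8 pi / 1000\<close> where the coordinates are at most \<open>N / 1000\<close>. Three of them
give the factor \<open>3 (24 pi / 1000) powr p\<close>, which is below \<open>1 / 32\<close> already for \<open>p = 2\<close>.\<close>

lemma Lp_mass_expsum_difference_le:
  fixes N :: nat
  assumes N: "N > 0" and a: "\<And>q. q \<in> grid N \<Longrightarrow> norm (a q) \<le> 1"
    and \<zeta>: "\<And>q. q \<in> grid N \<Longrightarrow> \<zeta> q \<in> unit_square" and u: "u \<in> unit_square"
    and p: "2 \<le> p" and A: "A \<in> sets borel"
    and small: "\<And>x k. x \<in> A \<Longrightarrow> \<bar>x $ k\<bar> \<le> real N / 1000"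
  shows "Lp_mass p A (\<lambda>x. expsum N a \<zeta> x - expsum N a (\<lambda>_. u) x) \<le> ennreal (1 / 32) * worst_expsum p N A"
proof -
  define \<zeta>' where "\<zeta>' s q = u + s *\<^sub>R (\<zeta> q - u)" for s q
  define b where "b k s q = a q * complex_of_real (if k = (1::3) then (\<zeta> q - u) $ 1 / 4 else if k = 2 then (\<zeta> q - u) $ 2 / 4
       else (grid_point N q (u + s *\<^sub>R (\<zeta> q - u)) $ 1 * (\<zeta> q - u) $ 1
           + grid_point N q (u + s *\<^sub>R (\<zeta> q - u)) $ 2 * (\<zeta> q - u) $ 2) / 2)" for k s q
  have \<zeta>': "\<zeta>' s q \<in> unit_square" if "q \<in> grid N" "s \<in> {0..1}" for s q
  proof -
    have "\<zeta>' s q = (1 - s) *\<^sub>R u + s *\<^sub>R \<zeta> q" by (simp add: \<zeta>'_def algebra_simps)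
    then show ?thesis
      using convexD[OF convex_box(1), of u 0 1 "\<zeta> q" "1 - s" s] u \<zeta>[OF that(1)] that(2)
      unfolding unit_square_def by auto
  qed
  have b: "norm (b k s q) \<le> 1" if q: "q \<in> grid N" and s: "s \<in> {0..1}" for k s q
  proof -
    have \<Delta>: "\<bar>(\<zeta> q - u) $ i\<bar> \<le> 1" for i
    proof -
      have "0 \<le> u $ i \<and> u $ i \<le> 1" "0 \<le> \<zeta> q $ i \<and> \<zeta> q $ i \<le> 1"
        using u \<zeta>[OF q] by (auto simp: unit_square_def mem_box_cart)
      then show ?thesis by auto
    qed
    have G: "\<bar>grid_point N q (u + s *\<^sub>R (\<zeta> q - u)) $ i\<bar> \<le> 1" for i
    proof -
      have "grid_point N q (\<zeta>' s q) \<in> unit_square"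
        by (rule grid_point_in_unit_square[OF q \<zeta>'[OF q s]])
      then have "0 \<le> grid_point N q (\<zeta>' s q) $ i \<and> grid_point N q (\<zeta>' s q) $ i \<le> 1"
        by (auto simp: unit_square_def mem_box_cart)
      then show ?thesis unfolding \<zeta>'_def by linarith
    qed
    have avg: "\<bar>(v + w) / 2\<bar> \<le> 1" if "\<bar>v\<bar> \<le> 1" "\<bar>w\<bar> \<le> 1" for v w :: real
      using that by (auto simp: abs_le_iff)
    have GD: "\<bar>grid_point N q (u + s *\<^sub>R (\<zeta> q - u)) $ i * (\<zeta> q - u) $ i\<bar> \<le> 1" for i
      unfolding abs_mult using mult_mono[OF G \<Delta>] by fastforce
    have "\<bar>(\<zeta> q - u) $ i / 4\<bar> \<le> 1" for i using \<Delta>[of i] by linarith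
    moreover have "\<bar>(grid_point N q (u + s *\<^sub>R (\<zeta> q - u)) $ 1 * (\<zeta> q - u) $ 1
           + grid_point N q (u + s *\<^sub>R (\<zeta> q - u)) $ 2 * (\<zeta> q - u) $ 2) / 2\<bar> \<le> 1"
      using avg[OF GD GD] .
    ultimately have "\<bar>if k = 1 then (\<zeta> q - u) $ 1 / 4 else if k = 2 then (\<zeta> q - u) $ 2 / 4
       else (grid_point N q (u + s *\<^sub>R (\<zeta> q - u)) $ 1 * (\<zeta> q - u) $ 1
           + grid_point N q (u + s *\<^sub>R (\<zeta> q - u)) $ 2 * (\<zeta> q - u) $ 2) / 2\<bar> \<le> 1"
      by presburger
    then show ?thesis unfolding b_def norm_mult norm_of_real
      using mult_mono[OF a[OF q]] by fastforce
  qed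
  define g where "g s x = (\<Sum>k\<in>UNIV. (8 * of_real pi * \<i> * complex_of_real (x $ k / N)) * expsum N (b k s) (\<zeta>' s) x)"
    for s and x :: "real ^ 3"
  have eq: "(\<lambda>x. expsum N a \<zeta> x - expsum N a (\<lambda>_. u) x) = (\<lambda>x. \<integral>s. g s x \<partial>unit_measure)"
    unfolding g_def b_def \<zeta>'_def using expsum_difference_eq_integral[OF N] by blast
  show ?thesis unfolding eq
  proof (rule Lp_mass_average_le[OF prob_space_unit_measure _ _ _ A])
    show "(\<lambda>(s, x). g s x) \<in> borel_measurable (unit_measure \<Otimes>\<^sub>M lborel)"
      unfolding g_def expsum_def b_def \<zeta>'_def case_prod_unfold grid_point_def by measurable
    show "norm (g s x) \<le> (\<Sum>k\<in>UNIV. (8 * pi * \<bar>x $ k / N\<bar>) * (real N)\<^sup>2)"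
      if "s \<in> space unit_measure" for s x
      unfolding g_def using that b
      by (intro sum_norm_le) (auto simp: norm_mult norm_divide intro!: mult_left_mono norm_expsum_le divide_right_mono)
    show "Lp_mass p A (g s) \<le> ennreal (1 / 32) * worst_expsum p N A" if "s \<in> space unit_measure" for s
    proof -
      have s: "s \<in> {0..1}" using that by simp
      have "Lp_mass p A (g s) \<le> (\<integral>\<^sup>+x. (\<Sum>k\<in>UNIV. ennreal ((24 * pi / 1000) powr p) *
          (ennreal (norm (expsum N (b k s) (\<zeta>' s) x) powr p) * indicator A x)) \<partial>lborel)"
        unfolding Lp_mass_def
      proof (intro nn_integral_mono)
        fix x :: "real ^ 3"
        show "ennreal (norm (g s x) powr p) * indicator A x \<le> (\<Sum>k\<in>UNIV. ennreal ((24 * pi / 1000) powr p) *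
          (ennreal (norm (expsum N (b k s) (\<zeta>' s) x) powr p) * indicator A x))"
        proof (cases "x \<in> A")
          case True
          have "norm (g s x) \<le> (\<Sum>k\<in>UNIV. (8 * pi / 1000) * norm (expsum N (b k s) (\<zeta>' s) x))"
            unfolding g_def
          proof (intro sum_norm_le)
            fix k :: 3
            have "\<bar>x $ k / N\<bar> \<le> 1 / 1000" using small[OF True, of k] N by (simp add: abs_divide field_simps)
            then have "8 * pi * \<bar>x $ k / N\<bar> \<le> 8 * pi * (1 / 1000)" by (intro mult_left_mono) auto
            then show "norm (8 * of_real pi * \<i> * complex_of_real (x $ k / N) * expsum N (b k s) (\<zeta>' s) x)
               \<le> (8 * pi / 1000) * norm (expsum N (b k s) (\<zeta>' s) x)"
              unfolding norm_mult norm_of_real by (intro mult_right_mono) auto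
          qed
          then have "norm (g s x) powr p \<le> (\<Sum>k\<in>UNIV. (8 * pi / 1000) * norm (expsum N (b k s) (\<zeta>' s) x)) powr p"
            using p by (intro powr_mono2) auto
          also have "\<dots> \<le> 3 powr p * (\<Sum>k\<in>UNIV. ((8 * pi / 1000) * norm (expsum N (b k s) (\<zeta>' s) x)) powr p)"
            using p by (intro powr_sum3_le) auto
          also have "\<dots> = (\<Sum>k\<in>UNIV. (24 * pi / 1000) powr p * norm (expsum N (b k s) (\<zeta>' s) x) powr p)"
            unfolding sum_distrib_left
          proof (intro sum.cong refl)
            fix k :: 3
            have "(24 * pi / 1000) powr p = 3 powr p * (8 * pi / 1000) powr p"
              by (simp flip: powr_mult)
            moreover have "(8 * pi / 1000 * norm (expsum N (b k s) (\<zeta>' s) x)) powr p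
               = (8 * pi / 1000) powr p * norm (expsum N (b k s) (\<zeta>' s) x) powr p"
              by (rule powr_mult)
            ultimately show "3 powr p * (8 * pi / 1000 * norm (expsum N (b k s) (\<zeta>' s) x)) powr p =
              (24 * pi / 1000) powr p * norm (expsum N (b k s) (\<zeta>' s) x) powr p"
              by simp
          qed
          finally have "ennreal (norm (g s x) powr p)
              \<le> ennreal (\<Sum>k\<in>UNIV. (24 * pi / 1000) powr p * norm (expsum N (b k s) (\<zeta>' s) x) powr p)"
            by (rule ennreal_leI)
          also have "\<dots> = (\<Sum>k\<in>UNIV. ennreal ((24 * pi / 1000) powr p) * ennreal (norm (expsum N (b k s) (\<zeta>' s) x) powr p))"
            by (subst sum_ennreal[symmetric]) (simp_all add: ennreal_mult)
          finally show ?thesis using True by simp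
        qed simp
      qed
      also have "\<dots> = (\<Sum>k\<in>UNIV. ennreal ((24 * pi / 1000) powr p) * Lp_mass p A (expsum N (b k s) (\<zeta>' s)))"
        unfolding Lp_mass_def using A by (subst nn_integral_sum) (auto simp: nn_integral_cmult)
      also have "\<dots> \<le> (\<Sum>k\<in>(UNIV :: 3 set). ennreal ((24 * pi / 1000) powr p) * worst_expsum p N A)"
        using b[OF _ s] \<zeta>'[OF _ s] by (intro sum_mono mult_left_mono Lp_mass_expsum_le_worst) auto
      also have "\<dots> = ennreal (3 * (24 * pi / 1000) powr p) * worst_expsum p N A"
        by (simp add: ennreal_mult mult.assoc)
      also have "\<dots> \<le> ennreal (1 / 32) * worst_expsum p N A"
      proof (intro mult_right_mono ennreal_leI)
        \<comment> \<open>The radius \<open>N / 1000\<close> is chosen so that this quantity is small.\<close>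
        have pi: "24 * pi / 1000 \<le> 1 / 10" using pi_less_4 by simp
        have "(24 * pi / 1000) powr p \<le> (1 / 10) powr p"
          using p pi by (intro powr_mono2) auto
        also have "\<dots> \<le> (1 / 10) powr 2" using p by (intro powr_mono') auto
        finally show "3 * (24 * pi / 1000) powr p \<le> 1 / 32" by (simp add: power2_eq_square)
      qed auto
      finally show ?thesis .
    qed
  qed (use p in auto)
qed

text \<open>An exponential sum differs from the average of its analogues with a common relative position, which
is a sum of wave packets, by at most \<open>1 / 32\<close> of the worst case. With the constant 16 from the power
of a sum, half of the worst case remains on the right side. It is finite and can be subtracted.\<close>

lemma worst_expsum_le_packet_sum:
  fixes N :: nat
  assumes N: "N > 0" and p: "2 \<le> p" "p \<le> 4" and A: "A \<in> sets borel" "emeasure lborel A < \<infinity>"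
    and small: "\<And>x k. x \<in> A \<Longrightarrow> \<bar>x $ k\<bar> \<le> real N / 1000"
    and T: "\<And>a. (\<And>q. q \<in> grid N \<Longrightarrow> norm (a q) \<le> 1) \<Longrightarrow> Lp_mass p A (packet_sum N a) \<le> T"
  shows "worst_expsum p N A \<le> 32 * T"
proof -
  define K where "K = worst_expsum p N A"
  have K_fin: "K < \<infinity>" unfolding K_def using worst_expsum_finite[OF A] p by simp
  have "Lp_mass p A (expsum N a \<zeta>) \<le> 16 * (ennreal (1 / 32) * K + T)"
    if a: "\<And>q. q \<in> grid N \<Longrightarrow> norm (a q) \<le> 1" and \<zeta>: "\<And>q. q \<in> grid N \<Longrightarrow> \<zeta> q \<in> unit_square" for a \<zeta>
  proof -
    have int: "integrable unit_measure (\<lambda>u. expsum N a (\<lambda>_. u) x)" for x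
      by (rule integrable_unit_measure_bounded[OF _ norm_expsum_le[OF a]])
         (simp_all add: expsum_def measurable_on_unit_measure)
    interpret U: prob_space "unit_measure :: (real ^ 2) measure" by (rule prob_space_unit_measure)
    have diff: "(\<lambda>x. expsum N a \<zeta> x - packet_sum N a x)
       = (\<lambda>x. \<integral>u. (expsum N a \<zeta> x - expsum N a (\<lambda>_. u) x) \<partial>unit_measure)"
      using int U.prob_space by (simp add: average_expsum fun_eq_iff)
    have "Lp_mass p A (\<lambda>x. expsum N a \<zeta> x - packet_sum N a x) \<le> ennreal (1 / 32) * K"
      unfolding diff
    proof (rule Lp_mass_average_le[OF prob_space_unit_measure _ _ _ A(1)])
      show "(\<lambda>(u, x). expsum N a \<zeta> x - expsum N a (\<lambda>_. u) x) \<in> borel_measurable (unit_measure \<Otimes>\<^sub>M lborel)"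
        unfolding expsum_def case_prod_unfold by measurable
      show "norm (expsum N a \<zeta> x - expsum N a (\<lambda>_. u) x) \<le> (real N)\<^sup>2 + (real N)\<^sup>2" for u x
        using norm_triangle_ineq4[of "expsum N a \<zeta> x" "expsum N a (\<lambda>_. u) x"]
          norm_expsum_le[of N a \<zeta> x] norm_expsum_le[of N a "\<lambda>_. u" x] a by (meson add_mono order_trans)
      show "Lp_mass p A (\<lambda>x. expsum N a \<zeta> x - expsum N a (\<lambda>_. u) x) \<le> ennreal (1 / 32) * K"
        if "u \<in> space unit_measure" for u
        unfolding K_def by (rule Lp_mass_expsum_difference_le[OF N a \<zeta> _ p(1) A(1) small])
           (use that in \<open>auto simp: unit_square_eq\<close>)
    qed (use p in auto)
    moreover have "Lp_mass p A (\<lambda>x. (expsum N a \<zeta> x - packet_sum N a x) + packet_sum N a x)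
      \<le> 16 * (Lp_mass p A (\<lambda>x. expsum N a \<zeta> x - packet_sum N a x) + Lp_mass p A (packet_sum N a))"
      using measurable_packet_sum p A by (intro Lp_mass_add_le) auto
    ultimately have "Lp_mass p A (\<lambda>x. (expsum N a \<zeta> x - packet_sum N a x) + packet_sum N a x)
      \<le> 16 * (ennreal (1 / 32) * K + T)"
      using T[of a, OF a] by (meson add_mono mult_left_mono order_trans zero_le)
    then show ?thesis by simp
  qed
  then have "K \<le> 16 * (ennreal (1 / 32) * K + T)"
    unfolding K_def worst_expsum_def by (intro SUP_least) auto
  then have "K \<le> ennreal (1 / 2) * K + 16 * T"
    by (simp add: distrib_left mult.assoc[symmetric] ennreal_mult''[symmetric] flip: ennreal_numeral)
  then have "K \<le> 32 * T"
  proof (cases "T = \<infinity>")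
    case False
    obtain k where k: "K = ennreal k" "k \<ge> 0" using K_fin by (cases K) auto
    obtain t where t: "T = ennreal t" "t \<ge> 0" using False by (cases T) auto
    have "ennreal (1 / 2 * k + 16 * t) = ennreal (1 / 2) * ennreal k + ennreal 16 * ennreal t"
      using k t by (subst ennreal_plus, simp, simp, subst ennreal_mult, simp, simp, subst ennreal_mult, simp, simp, intro refl)
    then have "ennreal k \<le> ennreal (1 / 2 * k + 16 * t)"
      using \<open>K \<le> ennreal (1 / 2) * K + 16 * T\<close> unfolding k t ennreal_numeral by simp
    then have "k \<le> 32 * t" using k t by (subst (asm) ennreal_le_iff) auto
    then have "ennreal k \<le> ennreal (32 * t)" by (rule ennreal_leI)
    then show ?thesis using t k by (simp add: ennreal_mult)
  qed (simp add: ennreal_mult_top)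
  then show ?thesis by (simp add: K_def)
qed

section \<open>Decay of one wave packet\<close>

lemma Basis_cart: "(Basis :: (real ^ 'n) set) = range (\<lambda>i. axis i 1)"
  by (auto simp: Basis_vec_def)

lemma prod_Basis_cart:
  "(\<Prod>b\<in>Basis. (x :: real ^ 'n) \<bullet> b) = (\<Prod>i\<in>UNIV. x $ i)"
  unfolding Basis_cart
  by (subst prod.reindex) (auto simp: inj_on_def axis_eq_axis inner_axis)

lemma measurable_vector2:
  "(\<lambda>(a, b). vector [a, b] :: real ^ 2) \<in> borel_measurable (lborel \<Otimes>\<^sub>M lborel)"
proof -
  have "(\<lambda>(a, b). vector [a, b] :: real ^ 2) = (\<lambda>w. fst w *\<^sub>R axis 1 1 + snd w *\<^sub>R axis 2 1)"
    by (auto simp: vec_eq_iff forall_2 axis_def)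
  then show ?thesis by simp
qed

text \<open>The coordinates identify Lebesgue measure with a product measure, so that Fubini's theorem applies.\<close>

lemma lborel_vector2:
  "lborel = distr (lborel \<Otimes>\<^sub>M lborel) borel (\<lambda>(a, b). vector [a, b] :: real ^ 2)"
proof (rule lborel_eqI)
  fix l u :: "real ^ 2"
  assume le: "\<And>b. b \<in> Basis \<Longrightarrow> l \<bullet> b \<le> u \<bullet> b"
  have le': "l $ i \<le> u $ i" for i using le[of "axis i 1"] by (simp add: inner_axis)
  have "(\<lambda>(a, b). vector [a, b] :: real ^ 2) -` box l u \<inter> space (lborel \<Otimes>\<^sub>M lborel)
      = {l $ 1 <..< u $ 1} \<times> {l $ 2 <..< u $ 2}"
    by (auto simp: mem_box_cart forall_2 space_pair_measure)
  then have "emeasure (distr (lborel \<Otimes>\<^sub>M lborel) borel (\<lambda>(a, b). vector [a, b] :: real ^ 2)) (box l u)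
     = emeasure (lborel \<Otimes>\<^sub>M lborel) ({l $ 1 <..< u $ 1} \<times> {l $ 2 <..< u $ 2})"
    by (subst emeasure_distr[OF measurable_vector2]) auto
  also have "\<dots> = ennreal ((u $ 1 - l $ 1) * (u $ 2 - l $ 2))"
    using le' by (subst lborel.emeasure_pair_measure_Times) (auto simp: ennreal_mult)
  also have "(u $ 1 - l $ 1) * (u $ 2 - l $ 2) = (\<Prod>b\<in>Basis. (u - l) \<bullet> b)"
    unfolding prod_Basis_cart UNIV_2 by simp
  finally show "emeasure (distr (lborel \<Otimes>\<^sub>M lborel) borel (\<lambda>(a, b). vector [a, b] :: real ^ 2)) (box l u)
     = ennreal (\<Prod>b\<in>Basis. (u - l) \<bullet> b)" .
qed simp

lemma measurable_vector3:
  "(\<lambda>(c, a, b). vector [a, b, c] :: real ^ 3) \<in> borel_measurable (lborel \<Otimes>\<^sub>M (lborel \<Otimes>\<^sub>M lborel))"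
proof -
  have "(\<lambda>(c, a, b). vector [a, b, c] :: real ^ 3)
     = (\<lambda>w. fst (snd w) *\<^sub>R axis 1 1 + snd (snd w) *\<^sub>R axis 2 1 + fst w *\<^sub>R axis 3 1)"
    by (auto simp: vec_eq_iff forall_3 axis_def)
  then show ?thesis by simp
qed

lemma lborel_vector3:
  "lborel = distr (lborel \<Otimes>\<^sub>M (lborel \<Otimes>\<^sub>M lborel)) borel (\<lambda>(c, a, b). vector [a, b, c] :: real ^ 3)"
proof (rule lborel_eqI)
  have P: "sigma_finite_measure (lborel \<Otimes>\<^sub>M lborel :: (real \<times> real) measure)"
    unfolding lborel_prod by (rule sigma_finite_lborel)
  fix l u :: "real ^ 3"
  assume le: "\<And>b. b \<in> Basis \<Longrightarrow> l \<bullet> b \<le> u \<bullet> b"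
  have le': "l $ i \<le> u $ i" for i using le[of "axis i 1"] by (simp add: inner_axis)
  have "(\<lambda>(c, a, b). vector [a, b, c] :: real ^ 3) -` box l u \<inter> space (lborel \<Otimes>\<^sub>M (lborel \<Otimes>\<^sub>M lborel))
      = {l $ 3 <..< u $ 3} \<times> ({l $ 1 <..< u $ 1} \<times> {l $ 2 <..< u $ 2})"
    by (auto simp: mem_box_cart forall_3 space_pair_measure)
  then have "emeasure (distr (lborel \<Otimes>\<^sub>M (lborel \<Otimes>\<^sub>M lborel)) borel (\<lambda>(c, a, b). vector [a, b, c] :: real ^ 3)) (box l u)
     = emeasure (lborel \<Otimes>\<^sub>M (lborel \<Otimes>\<^sub>M lborel)) ({l $ 3 <..< u $ 3} \<times> ({l $ 1 <..< u $ 1} \<times> {l $ 2 <..< u $ 2}))"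
    by (subst emeasure_distr[OF measurable_vector3]) auto
  also have "\<dots> = ennreal ((u $ 3 - l $ 3) * ((u $ 1 - l $ 1) * (u $ 2 - l $ 2)))"
    using le' by (subst sigma_finite_measure.emeasure_pair_measure_Times[OF P], simp, simp, subst lborel.emeasure_pair_measure_Times)
      (auto simp: ennreal_mult)
  also have "(u $ 3 - l $ 3) * ((u $ 1 - l $ 1) * (u $ 2 - l $ 2)) = (\<Prod>b\<in>Basis. (u - l) \<bullet> b)"
  proof -
    have "(\<Prod>i\<in>UNIV. (u - l) $ i) = (u $ 1 - l $ 1) * ((u $ 2 - l $ 2) * (u $ 3 - l $ 3))"
      unfolding UNIV_3 by (simp add: mult.assoc)
    then show ?thesis unfolding prod_Basis_cart by (simp only: mult_ac)
  qed
  finally show "emeasure (distr (lborel \<Otimes>\<^sub>M (lborel \<Otimes>\<^sub>M lborel)) borel (\<lambda>(c, a, b). vector [a, b, c] :: real ^ 3)) (box l u)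
     = ennreal (\<Prod>b\<in>Basis. (u - l) \<bullet> b)" .
qed simp

text \<open>The third coordinate, along which the tubes are long, is the outermost variable.\<close>

lemma nn_integral_real3:
  fixes f :: "real ^ 3 \<Rightarrow> ennreal"
  assumes [measurable]: "f \<in> borel_measurable borel"
  shows "(\<integral>\<^sup>+x. f x \<partial>lborel) = (\<integral>\<^sup>+c. (\<integral>\<^sup>+a. (\<integral>\<^sup>+b. f (vector [a, b, c]) \<partial>lborel) \<partial>lborel) \<partial>lborel)"
proof -
  have P: "sigma_finite_measure (lborel \<Otimes>\<^sub>M lborel :: (real \<times> real) measure)"
    unfolding lborel_prod by (rule sigma_finite_lborel)
  note measurable_vector3[measurable]
  have [measurable]: "(\<lambda>w. f (vector [fst (snd w), snd (snd w), fst w])) \<in> borel_measurable (lborel \<Otimes>\<^sub>M (lborel \<Otimes>\<^sub>M lborel))"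
    using measurable_compose[OF measurable_vector3 assms] by (simp add: case_prod_unfold)
  have "(\<integral>\<^sup>+x. f x \<partial>lborel) = (\<integral>\<^sup>+w. f (case w of (c, a, b) \<Rightarrow> vector [a, b, c]) \<partial>(lborel \<Otimes>\<^sub>M (lborel \<Otimes>\<^sub>M lborel)))"
    by (subst lborel_vector3, subst nn_integral_distr) (use measurable_vector3 in auto)
  also have "\<dots> = (\<integral>\<^sup>+c. (\<integral>\<^sup>+w. f (vector [fst w, snd w, c]) \<partial>(lborel \<Otimes>\<^sub>M lborel)) \<partial>lborel)"
    by (subst sigma_finite_measure.nn_integral_fst[OF P, symmetric]) (auto simp: case_prod_unfold)
  also have "\<dots> = (\<integral>\<^sup>+c. (\<integral>\<^sup>+a. (\<integral>\<^sup>+b. f (vector [a, b, c]) \<partial>lborel) \<partial>lborel) \<partial>lborel)"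
  proof (intro nn_integral_cong)
    fix c
    have m: "(\<lambda>w. f (vector [fst w, snd w, c])) \<in> borel_measurable (lborel \<Otimes>\<^sub>M lborel)"
      using measurable_compose[OF measurable_Pair1'[of c lborel "lborel \<Otimes>\<^sub>M lborel"]
         \<open>(\<lambda>w. f (vector [fst (snd w), snd (snd w), fst w])) \<in> _\<close>] by simp
    show "(\<integral>\<^sup>+w. f (vector [fst w, snd w, c]) \<partial>(lborel \<Otimes>\<^sub>M lborel)) = (\<integral>\<^sup>+a. (\<integral>\<^sup>+b. f (vector [a, b, c]) \<partial>lborel) \<partial>lborel)"
      by (subst lborel.nn_integral_fst[symmetric, OF m]) simp
  qed
  finally show ?thesis .
qed

lemma integral_unit_square_product:
  fixes f g :: "real \<Rightarrow> complex"
  assumes [measurable]: "f \<in> borel_measurable borel" "g \<in> borel_measurable borel"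
    and B: "\<And>s. norm (f s) \<le> 1" "\<And>s. norm (g s) \<le> 1"
  shows "(\<integral>u. f (u $ 1) * g (u $ 2) \<partial>(unit_measure :: (real ^ 2) measure))
    = (\<integral>s. f s \<partial>unit_measure) * (\<integral>s. g s \<partial>unit_measure)"
proof -
  define f' where "f' s = indicator {0..1} s *\<^sub>R f s" for s
  define g' where "g' s = indicator {0..1} s *\<^sub>R g s" for s
  have [measurable]: "f' \<in> borel_measurable borel" "g' \<in> borel_measurable borel"
    unfolding f'_def g'_def by measurable
  have ind: "indicator (cbox 0 One) u = (indicator {0..1} (u $ 1) * indicator {0..1} (u $ 2) :: real)" for u :: "real ^ 2"
    using mem_unit_square[of u] unfolding unit_square_eq by (auto simp: indicator_def)
  have int: "integrable lborel f'" "integrable lborel g'"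
    unfolding f'_def g'_def
    by (rule integrableI_bounded_set_indicator[where B=1]; use B in auto)+
  have "(\<integral>u. f (u $ 1) * g (u $ 2) \<partial>(unit_measure :: (real ^ 2) measure))
      = (\<integral>u. f' (u $ 1) * g' (u $ 2) \<partial>(lborel :: (real ^ 2) measure))"
    by (subst integral_restrict_space) (auto simp: ind f'_def g'_def mult_ac intro!: Bochner_Integration.integral_cong)
  also have "\<dots> = (\<integral>w. f' (fst w) * g' (snd w) \<partial>(lborel \<Otimes>\<^sub>M lborel))"
    by (subst lborel_vector2, subst integral_distr) (use measurable_vector2 in \<open>auto simp: case_prod_unfold\<close>)
  also have "\<dots> = (\<integral>s. f' s \<partial>lborel) * (\<integral>s. g' s \<partial>lborel)"
  proof -
    have "integrable (lborel \<Otimes>\<^sub>M lborel) (\<lambda>w. f' (fst w) * g' (snd w))"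
    proof (rule lborel_pair.Fubini_integrable)
      show "integrable lborel (\<lambda>x. \<integral>y. norm (f' (fst (x, y)) * g' (snd (x, y))) \<partial>lborel)"
        using int by (simp add: norm_mult)
      show "AE x in lborel. integrable lborel (\<lambda>y. f' (fst (x, y)) * g' (snd (x, y)))"
        using int by (auto intro!: AE_I2)
    qed measurable
    from lborel_pair.integral_fst'[OF this] show ?thesis by simp
  qed
  also have "(\<integral>s. f' s \<partial>lborel) = (\<integral>s. f s \<partial>unit_measure)"
    unfolding f'_def[abs_def] by (subst integral_restrict_space) auto
  also have "(\<integral>s. g' s \<partial>lborel) = (\<integral>s. g s \<partial>unit_measure)"
    unfolding g'_def[abs_def] by (subst integral_restrict_space) auto
  finally show ?thesis .
qed

text \<open>The one-dimensional factor of a wave packet. Here \<open>y\<close> is the distance from the axis of the tube in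
units of \<open>N\<close>, and \<open>t\<close> is the height in units of \<open>R\<close>.\<close>

definition quadratic_phase_integral :: "real \<Rightarrow> real \<Rightarrow> complex" where
  "quadratic_phase_integral y t = (\<integral>s. char_e (s * y + s\<^sup>2 * t) \<partial>(unit_measure :: real measure))"

definition decay :: "real \<Rightarrow> real \<Rightarrow> real" where
  "decay t y = min 1 (5 * (1 + \<bar>t\<bar>)\<^sup>2 / (1 + y\<^sup>2))"

lemma norm_integral_unit_measure_le:
  fixes f :: "'a::euclidean_space \<Rightarrow> complex"
  assumes "f \<in> borel_measurable borel" "\<And>u. u \<in> cbox 0 One \<Longrightarrow> norm (f u) \<le> B"
  shows "norm (\<integral>u. f u \<partial>unit_measure) \<le> B"
proof -
  interpret prob_space "unit_measure :: 'a measure" by (rule prob_space_unit_measure)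
  have i: "integrable unit_measure f"
    by (rule integrable_const_bound[of _ B]) (use assms in \<open>auto intro!: measurable_on_unit_measure AE_I2\<close>)
  have "norm (\<integral>u. f u \<partial>unit_measure) \<le> (\<integral>u. norm (f u) \<partial>unit_measure)" by (rule integral_norm_bound)
  also have "\<dots> \<le> B" using i assms by (intro integral_le_const) (auto intro!: AE_I2)
  finally show ?thesis .
qed

text \<open>One integration by parts gains a factor \<open>1 / \<bar>y\<bar>\<close> at the cost of \<open>1 + 2 \<bar>t\<bar>\<close>. This slow decay suffices
for the bush, and it is all that a step function with its jumps can have.\<close>

lemma norm_quadratic_phase_integral_le:
  "(norm (quadratic_phase_integral y t))\<^sup>2 \<le> decay t y"
proof -
  define \<Psi> where "\<Psi> = quadratic_phase_integral y t"
  define f where "f s = char_e (s * y + s\<^sup>2 * t)" for s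
  have mf [measurable]: "f \<in> borel_measurable borel" unfolding f_def by measurable
  have nf: "norm (f s) \<le> 1" for s by (simp add: f_def)
  have int1: "integrable unit_measure f"
    by (rule integrable_unit_measure_bounded[OF measurable_on_unit_measure[OF mf] nf])
  interpret prob_space "unit_measure :: real measure" by (rule prob_space_unit_measure)
  have int2: "integrable unit_measure (\<lambda>s. complex_of_real s * f s)"
  proof (rule integrable_const_bound[of _ 1])
    show "(\<lambda>s. complex_of_real s * f s) \<in> borel_measurable unit_measure"
      by (intro measurable_on_unit_measure) measurable
  qed (auto simp: norm_mult f_def intro!: AE_I2)
  have le1: "norm \<Psi> \<le> 1"
    unfolding \<Psi>_def quadratic_phase_integral_def by (rule norm_integral_unit_measure_le) auto
  have \<Psi>': "\<Psi> = (\<integral>s. f s \<partial>unit_measure)"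
    by (simp add: \<Psi>_def quadratic_phase_integral_def f_def)
  define g where "g s = 2 * of_real pi * \<i> * of_real (y + 2 * s * t) * f s" for s
  \<comment> \<open>The integral of the derivative \<open>2 pi i (y + 2 s t) f s\<close> is solved for the part with \<open>y\<close>.\<close>
  have "f 1 - f 0 = (\<integral>s. indicator {0..1} s *\<^sub>R g s \<partial>lborel)"
  proof (rule integral_FTC_Icc[symmetric])
    show "(f has_vector_derivative g s) (at s within {0..1})" for s
      unfolding f_def g_def
      by (rule char_e_has_vector_derivative) (auto intro!: derivative_eq_intros)
    show "continuous_on {0..1} g" unfolding g_def f_def by (intro continuous_intros)
  qed simp
  also have "\<dots> = (\<integral>s. g s \<partial>unit_measure)"
    by (subst integral_restrict_space) auto
  also have "\<dots> = (\<integral>s. (2 * of_real pi * \<i> * of_real y) * f s + (4 * of_real pi * \<i> * of_real t) * (of_real s * f s) \<partial>unit_measure)"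
    by (simp add: g_def algebra_simps)
  also have "\<dots> = (2 * of_real pi * \<i> * of_real y) * \<Psi> + (4 * of_real pi * \<i> * of_real t) * (\<integral>s. of_real s * f s \<partial>unit_measure)"
    unfolding \<Psi>' using int1 int2 by (subst Bochner_Integration.integral_add) auto
  finally have "(2 * of_real pi * \<i> * of_real y) * \<Psi>
     = f 1 - f 0 - (4 * of_real pi * \<i> * of_real t) * (\<integral>s. of_real s * f s \<partial>unit_measure)"
    by (simp add: algebra_simps)
  then have e: "norm ((2 * of_real pi * \<i> * of_real y) * \<Psi>)
     \<le> norm (f 1 - f 0) + norm ((4 * of_real pi * \<i> * of_real t) * (\<integral>s. of_real s * f s \<partial>unit_measure))"
    by (simp only: norm_triangle_ineq4)
  have "norm (\<integral>s. of_real s * f s \<partial>unit_measure) \<le> 1"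
    by (rule norm_integral_unit_measure_le) (auto simp: norm_mult f_def)
  then have "4 * pi * \<bar>t\<bar> * norm (\<integral>s. of_real s * f s \<partial>unit_measure) \<le> 4 * pi * \<bar>t\<bar> * 1"
    by (intro mult_left_mono) auto
  then have "norm ((4 * of_real pi * \<i> * of_real t) * (\<integral>s. of_real s * f s \<partial>unit_measure)) \<le> 4 * pi * \<bar>t\<bar>"
    by (simp only: norm_mult norm_of_real norm_ii norm_numeral) simp
  moreover have "norm (f 1 - f 0) \<le> 2"
    using norm_triangle_ineq4[of "f 1" "f 0"] nf[of 1] nf[of 0] by linarith
  ultimately have "norm ((2 * of_real pi * \<i> * of_real y) * \<Psi>) \<le> 2 + 4 * pi * \<bar>t\<bar>"
    using e by linarith
  then have "2 * pi * (\<bar>y\<bar> * norm \<Psi>) \<le> 2 * pi * (1 + 2 * \<bar>t\<bar>)"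
    using pi_gt3 by (simp add: norm_mult algebra_simps)
  then have "\<bar>y\<bar> * norm \<Psi> \<le> 1 + 2 * \<bar>t\<bar>" by simp
  then have "(\<bar>y\<bar> * norm \<Psi>)\<^sup>2 \<le> (1 + 2 * \<bar>t\<bar>)\<^sup>2" by (intro power_mono) auto
  moreover have sq1: "(norm \<Psi>)\<^sup>2 \<le> 1" using le1 by (simp add: power_le_one)
  ultimately have "(norm \<Psi>)\<^sup>2 * (1 + y\<^sup>2) \<le> 1 + (1 + 2 * \<bar>t\<bar>)\<^sup>2"
    by (simp add: power_mult_distrib algebra_simps)
  also have "\<dots> \<le> 5 * (1 + \<bar>t\<bar>)\<^sup>2"
  proof -
    have "1 + (1 + 2 * v)\<^sup>2 \<le> 5 * (1 + v)\<^sup>2" if "v \<ge> 0" for v :: real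
      using that by (simp add: power2_eq_square algebra_simps)
    then show ?thesis by simp
  qed
  finally have "(norm \<Psi>)\<^sup>2 \<le> 5 * (1 + \<bar>t\<bar>)\<^sup>2 / (1 + y\<^sup>2)"
    by (subst pos_le_divide_eq) (auto intro: add_pos_nonneg)
  then show ?thesis using sq1 by (simp add: decay_def \<Psi>_def)
qed

text \<open>Relative to a corner of the square the phase is a constant plus a quadratic polynomial without mixed
terms, so the integral over the unit square factors.\<close>

lemma norm_cell_packet_le_decay:
  fixes N :: nat
  assumes N: "N > 0"
  shows "(norm (cell_packet N q x))\<^sup>2
    \<le> decay (x $ 3 / (real N)\<^sup>2) ((x $ 1 + 2 * (real (fst q) / N) * x $ 3) / N)
      * decay (x $ 3 / (real N)\<^sup>2) ((x $ 2 + 2 * (real (snd q) / N) * x $ 3) / N)"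
proof -
  define t where "t = x $ 3 / (real N)\<^sup>2"
  define y1 where "y1 = (x $ 1 + 2 * (real (fst q) / N) * x $ 3) / N"
  define y2 where "y2 = (x $ 2 + 2 * (real (snd q) / N) * x $ 3) / N"
  define c where "c = lift_paraboloid (grid_point N q 0) \<bullet> x"
  have phase: "lift_paraboloid (grid_point N q u) \<bullet> x
      = c + ((u $ 1 * y1 + (u $ 1)\<^sup>2 * t) + (u $ 2 * y2 + (u $ 2)\<^sup>2 * t))" for u
    unfolding c_def lift_inner grid_point_nth y1_def y2_def t_def
    using N by (simp add: field_simps power2_eq_square)
  have "cell_packet N q x
     = (\<integral>u. char_e c * (char_e (u $ 1 * y1 + (u $ 1)\<^sup>2 * t) * char_e (u $ 2 * y2 + (u $ 2)\<^sup>2 * t)) \<partial>(unit_measure :: (real ^ 2) measure))"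
    unfolding cell_packet_def phase char_e_add by simp
  also have "\<dots> = char_e c * (quadratic_phase_integral y1 t * quadratic_phase_integral y2 t)"
  proof -
    have "(\<integral>u. char_e (u $ 1 * y1 + (u $ 1)\<^sup>2 * t) * char_e (u $ 2 * y2 + (u $ 2)\<^sup>2 * t) \<partial>(unit_measure :: (real ^ 2) measure))
      = quadratic_phase_integral y1 t * quadratic_phase_integral y2 t"
      unfolding quadratic_phase_integral_def
      by (rule integral_unit_square_product[of "\<lambda>s. char_e (s * y1 + s\<^sup>2 * t)" "\<lambda>s. char_e (s * y2 + s\<^sup>2 * t)"]) auto
    then show ?thesis by simp
  qed
  finally have "(norm (cell_packet N q x))\<^sup>2
      = (norm (quadratic_phase_integral y1 t))\<^sup>2 * (norm (quadratic_phase_integral y2 t))\<^sup>2"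
    by (simp add: norm_mult power_mult_distrib)
  also have "\<dots> \<le> decay t y1 * decay t y2"
    using norm_quadratic_phase_integral_le[of y1 t] by (intro mult_mono norm_quadratic_phase_integral_le order_trans[OF _ norm_quadratic_phase_integral_le[of y1 t]]) auto
  finally show ?thesis unfolding t_def y1_def y2_def .
qed

lemma norm_cell_packet_le_1: "norm (cell_packet N q x) \<le> 1"
  unfolding cell_packet_def by (rule norm_integral_unit_measure_le) auto

section \<open>The bush of tubes through the origin\<close>

lemma measurable_decay [measurable (raw)]:
  assumes [measurable]: "f \<in> borel_measurable M" "g \<in> borel_measurable M"
  shows "(\<lambda>w. decay (f w) (g w)) \<in> borel_measurable M"
  unfolding decay_def by measurable

lemma decay_nonneg: "0 \<le> decay t y" and decay_le_1: "decay t y \<le> 1"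
  and decay_le: "decay t y \<le> 5 * (1 + \<bar>t\<bar>)\<^sup>2 / (1 + y\<^sup>2)"
  by (auto simp: decay_def min_def)

text \<open>The squares form a product grid and the bound for each packet is a product, so the square function
is at most a product of two such one-dimensional sums.\<close>

definition strip_sum :: "nat \<Rightarrow> real \<Rightarrow> real \<Rightarrow> real" where
  "strip_sum N h v = (\<Sum>j<N. decay (h / (real N)\<^sup>2) ((v + 2 * (real j / N) * h) / N))"

lemma measurable_strip_sum [measurable (raw)]:
  assumes [measurable]: "f \<in> borel_measurable M" "g \<in> borel_measurable M"
  shows "(\<lambda>w. strip_sum N (f w) (g w)) \<in> borel_measurable M"
  unfolding strip_sum_def by measurable

lemma strip_sum_nonneg: "0 \<le> strip_sum N h v"
  unfolding strip_sum_def by (intro sum_nonneg decay_nonneg)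

lemma strip_sum_le_N: "strip_sum N h v \<le> N"
proof -
  have "strip_sum N h v \<le> (\<Sum>j<N. 1)"
    unfolding strip_sum_def by (intro sum_mono decay_le_1)
  then show ?thesis by simp
qed

lemma sum_cell_packet_le:
  assumes N: "N > 0"
  shows "(\<Sum>q\<in>grid N. (norm (cell_packet N q x))\<^sup>2) \<le> strip_sum N (x $ 3) (x $ 1) * strip_sum N (x $ 3) (x $ 2)"
proof -
  have "(\<Sum>q\<in>grid N. (norm (cell_packet N q x))\<^sup>2)
    \<le> (\<Sum>q\<in>grid N. decay (x $ 3 / (real N)\<^sup>2) ((x $ 1 + 2 * (real (fst q) / N) * x $ 3) / N)
      * decay (x $ 3 / (real N)\<^sup>2) ((x $ 2 + 2 * (real (snd q) / N) * x $ 3) / N))"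
    by (intro sum_mono norm_cell_packet_le_decay N)
  also have "\<dots> = strip_sum N (x $ 3) (x $ 1) * strip_sum N (x $ 3) (x $ 2)"
    unfolding strip_sum_def grid_def sum_product by (simp add: sum.cartesian_product case_prod_unfold)
  finally show ?thesis .
qed

text \<open>The summand \<open>1 / (1 + a\<^sup>2)\<close> is compared with the integral of the same function over a step of length
\<open>\<tau>\<close>. The factor \<open>2 + 2 \<tau>\<^sup>2\<close> makes the comparison valid for long steps too.\<close>

lemma arctan_step:
  fixes a \<tau> :: real
  assumes "\<tau> > 0"
  shows "\<tau> / (1 + a\<^sup>2) \<le> (2 + 2 * \<tau>\<^sup>2) * (arctan (a + \<tau>) - arctan a)"
proof -
  obtain z where z: "a < z" "z < a + \<tau>" "arctan (a + \<tau>) - arctan a = (a + \<tau> - a) * inverse (1 + z\<^sup>2)"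
    using MVT2[of a "a + \<tau>" arctan "\<lambda>z. inverse (1 + z\<^sup>2)"] assms DERIV_arctan by auto
  have "z\<^sup>2 \<le> 2 * a\<^sup>2 + 2 * \<tau>\<^sup>2"
  proof -
    have "(z - a)\<^sup>2 \<le> \<tau>\<^sup>2" using z assms by (intro power_mono) auto
    moreover have "z\<^sup>2 \<le> 2 * a\<^sup>2 + 2 * (z - a)\<^sup>2"
      using zero_le_power2[of "z - 2 * a"] by (simp add: power2_eq_square algebra_simps)
    ultimately show ?thesis by linarith
  qed
  then have "1 + z\<^sup>2 \<le> (2 + 2 * \<tau>\<^sup>2) * (1 + a\<^sup>2)"
  proof -
    have "(2 + 2 * \<tau>\<^sup>2) * (1 + a\<^sup>2) = 2 + 2 * \<tau>\<^sup>2 + 2 * a\<^sup>2 + 2 * (\<tau>\<^sup>2 * a\<^sup>2)"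
      by (simp add: algebra_simps)
    moreover have "0 \<le> \<tau>\<^sup>2 * a\<^sup>2" by simp
    ultimately show ?thesis using \<open>z\<^sup>2 \<le> 2 * a\<^sup>2 + 2 * \<tau>\<^sup>2\<close> by linarith
  qed
  moreover have pos: "1 + z\<^sup>2 > 0" "1 + a\<^sup>2 > 0" by (auto intro: add_pos_nonneg)
  ultimately have "1 / (1 + a\<^sup>2) \<le> (2 + 2 * \<tau>\<^sup>2) / (1 + z\<^sup>2)"
    by (simp add: field_simps)
  then have "\<tau> * (1 / (1 + a\<^sup>2)) \<le> \<tau> * ((2 + 2 * \<tau>\<^sup>2) / (1 + z\<^sup>2))"
    using assms by (intro mult_left_mono) auto
  also have "\<dots> = (2 + 2 * \<tau>\<^sup>2) * (arctan (a + \<tau>) - arctan a)"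
    unfolding z(3) by (simp add: divide_inverse algebra_simps)
  finally show ?thesis by simp
qed

text \<open>Telescoping: the increments of the arctangent add up to at most \<open>pi\<close>.\<close>

lemma progression_sum_le_pos:
  fixes a \<tau> :: real
  assumes "\<tau> > 0"
  shows "\<tau> * (\<Sum>j<N. 1 / (1 + (a + real j * \<tau>)\<^sup>2)) \<le> (2 + 2 * \<tau>\<^sup>2) * pi"
proof -
  have "\<tau> * (\<Sum>j<N. 1 / (1 + (a + real j * \<tau>)\<^sup>2))
      \<le> (\<Sum>j<N. (2 + 2 * \<tau>\<^sup>2) * (arctan (a + real (Suc j) * \<tau>) - arctan (a + real j * \<tau>)))"
    unfolding sum_distrib_left
  proof (intro sum_mono)
    fix j
    have "a + real (Suc j) * \<tau> = (a + real j * \<tau>) + \<tau>" by (simp add: algebra_simps)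
    then show "\<tau> * (1 / (1 + (a + real j * \<tau>)\<^sup>2))
       \<le> (2 + 2 * \<tau>\<^sup>2) * (arctan (a + real (Suc j) * \<tau>) - arctan (a + real j * \<tau>))"
      using arctan_step[OF assms, of "a + real j * \<tau>"] by (simp only: times_divide_eq_right mult_1_right)
  qed
  also have "\<dots> = (2 + 2 * \<tau>\<^sup>2) * (arctan (a + real N * \<tau>) - arctan a)"
    unfolding sum_distrib_left[symmetric]
    using sum_lessThan_telescope[of "\<lambda>j. arctan (a + real j * \<tau>)" N] by simp
  also have "\<dots> \<le> (2 + 2 * \<tau>\<^sup>2) * pi"
    using arctan_ubound[of "a + real N * \<tau>"] arctan_lbound[of a]
    by (intro mult_left_mono) auto
  finally show ?thesis .
qed

lemma progression_sum_le:
  fixes a \<tau> :: real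
  shows "\<bar>\<tau>\<bar> * (\<Sum>j<N. 1 / (1 + (a + real j * \<tau>)\<^sup>2)) \<le> (2 + 2 * \<tau>\<^sup>2) * pi"
proof -
  consider "\<tau> > 0" | "\<tau> = 0" | "\<tau> < 0" by linarith
  then show ?thesis
  proof cases
    case 3
    have "(a + real j * \<tau>)\<^sup>2 = (- a + real j * (- \<tau>))\<^sup>2" for j
      by (simp add: power2_eq_square algebra_simps)
    then show ?thesis using progression_sum_le_pos[of "- \<tau>" "- a" N] 3 by simp
  qed (use progression_sum_le_pos[of \<tau> a N] in auto)
qed

text \<open>At height \<open>h\<close> the centres of the tubes are spaced by \<open>2 t\<close> in units of their width, so about \<open>1 / t\<close> of
them overlap; there are only \<open>N\<close> in all. Both bounds are merged in one smooth expression.\<close>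

lemma strip_sum_sup_le:
  fixes h :: real
  assumes N: "N > 0"
  defines "t \<equiv> \<bar>h\<bar> / (real N)\<^sup>2"
  shows "strip_sum N h v * (t + 1 / (2 * real N)) \<le> 100 * (1 + t) ^ 4"
proof -
  define \<tau> where "\<tau> = 2 * h / (real N)\<^sup>2"
  have t0: "t \<ge> 0" by (simp add: t_def)
  have \<tau>: "\<bar>\<tau>\<bar> = 2 * t" by (simp add: \<tau>_def t_def abs_mult)
  have abst: "\<bar>h / (real N)\<^sup>2\<bar> = t" by (simp add: t_def)
  have "strip_sum N h v \<le> (\<Sum>j<N. 5 * (1 + t)\<^sup>2 * (1 / (1 + (v / N + real j * \<tau>)\<^sup>2)))"
    unfolding strip_sum_def
  proof (intro sum_mono)
    fix j
    have "(v + 2 * (real j / N) * h) / N = v / N + real j * \<tau>"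
      using N by (simp add: \<tau>_def field_simps power2_eq_square)
    then show "decay (h / (real N)\<^sup>2) ((v + 2 * (real j / N) * h) / N) \<le> 5 * (1 + t)\<^sup>2 * (1 / (1 + (v / N + real j * \<tau>)\<^sup>2))"
      using decay_le[of "h / (real N)\<^sup>2" "v / N + real j * \<tau>"] unfolding abst by simp
  qed
  also have "\<dots> = 5 * (1 + t)\<^sup>2 * (\<Sum>j<N. 1 / (1 + (v / N + real j * \<tau>)\<^sup>2))"
    by (simp only: sum_distrib_left)
  finally have "strip_sum N h v * \<bar>\<tau>\<bar> \<le> 5 * (1 + t)\<^sup>2 * (\<bar>\<tau>\<bar> * (\<Sum>j<N. 1 / (1 + (v / N + real j * \<tau>)\<^sup>2)))"
    by (metis (no_types, lifting) abs_ge_zero mult.assoc mult.commute mult_left_mono)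
  also have "\<dots> \<le> 5 * (1 + t)\<^sup>2 * ((2 + 2 * \<tau>\<^sup>2) * pi)"
    by (intro mult_left_mono progression_sum_le) auto
  also have "\<tau>\<^sup>2 = 4 * t\<^sup>2" using \<tau> by (metis power2_abs power_mult_distrib numeral_power_eq_of_nat_cancel_iff four_x_squared mult.commute power2_eq_square)
  finally have "strip_sum N h v * t \<le> 5 * (1 + t)\<^sup>2 * ((1 + 4 * t\<^sup>2) * pi)"
    unfolding \<tau> by (simp add: algebra_simps)
  also have "\<dots> \<le> 5 * (1 + t)\<^sup>2 * ((4 * (1 + t)\<^sup>2) * 4)"
    using t0 pi_less_4 by (intro mult_left_mono mult_mono) (auto simp: power2_eq_square algebra_simps)
  also have "\<dots> = 80 * (1 + t) ^ 4" by (simp add: power4_eq_xxxx power2_eq_square)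
  finally have 1: "strip_sum N h v * t \<le> 80 * (1 + t) ^ 4" .
  have "strip_sum N h v * (1 / (2 * real N)) \<le> N * (1 / (2 * real N))"
    by (intro mult_right_mono strip_sum_le_N) auto
  also have "\<dots> \<le> 1 * 1" using N by simp
  also have "\<dots> \<le> (1 + t) ^ 4" using t0 by (simp add: one_le_power)
  finally have "strip_sum N h v * (1 / (2 * real N)) \<le> (1 + t) ^ 4" .
  with 1 have "strip_sum N h v * t + strip_sum N h v * (1 / (2 * real N)) \<le> 80 * (1 + t) ^ 4 + (1 + t) ^ 4" by linarith
  also have "\<dots> \<le> 100 * (1 + t) ^ 4" using t0 by simp
  finally show ?thesis by (simp only: distrib_left)
qed

lemma nn_integral_even_le:
  fixes f :: "real \<Rightarrow> ennreal"
  assumes [measurable]: "f \<in> borel_measurable borel" and even: "\<And>x. f (- x) = f x"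
  shows "(\<integral>\<^sup>+x. f x \<partial>lborel) \<le> 2 * (\<integral>\<^sup>+x. f x * indicator {0..} x \<partial>lborel)"
proof -
  have "(\<integral>\<^sup>+x. f x \<partial>lborel) \<le> (\<integral>\<^sup>+x. f x * indicator {0..} x + f x * indicator {..0} x \<partial>lborel)"
    by (intro nn_integral_mono) (auto simp: indicator_def)
  also have "\<dots> = (\<integral>\<^sup>+x. f x * indicator {0..} x \<partial>lborel) + (\<integral>\<^sup>+x. f x * indicator {..0} x \<partial>lborel)"
    by (rule nn_integral_add) auto
  also have "(\<integral>\<^sup>+x. f x * indicator {..0} x \<partial>lborel) = (\<integral>\<^sup>+x. f x * indicator {0..} x \<partial>lborel)"
    by (subst nn_integral_real_affine[where c="-1" and t=0]) (auto simp: even indicator_def intro!: nn_integral_cong)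
  finally show ?thesis by (simp add: mult_2)
qed

lemma nn_integral_cauchy_density_le:
  "(\<integral>\<^sup>+y. ennreal (1 / (1 + y\<^sup>2)) \<partial>lborel) \<le> ennreal pi"
proof -
  have "(\<integral>\<^sup>+y. ennreal (1 / (1 + y\<^sup>2)) * indicator {0..} y \<partial>lborel) = ennreal (pi / 2 - arctan 0)"
  proof (rule nn_integral_FTC_atLeast)
    show "(arctan has_real_derivative 1 / (1 + x\<^sup>2)) (at x)" for x
      using DERIV_arctan[of x] by (simp add: divide_inverse)
    show "(arctan \<longlongrightarrow> pi / 2) at_top" by (rule tendsto_arctan_at_top)
  qed auto
  then have "2 * (\<integral>\<^sup>+y. ennreal (1 / (1 + y\<^sup>2)) * indicator {0..} y \<partial>lborel) = ennreal 2 * ennreal (pi / 2)"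
    by simp
  also have "\<dots> = ennreal pi" by (subst ennreal_mult[symmetric]) auto
  finally show ?thesis
    using nn_integral_even_le[of "\<lambda>y. ennreal (1 / (1 + y\<^sup>2))"] by simp
qed

lemma nn_integral_strip_sum_le:
  fixes h :: real
  assumes N: "N > 0"
  defines "t \<equiv> \<bar>h\<bar> / (real N)\<^sup>2"
  shows "(\<integral>\<^sup>+v. ennreal (strip_sum N h v) \<partial>lborel) \<le> ennreal (5 * (1 + t)\<^sup>2 * (real N)\<^sup>2 * pi)"
proof -
  have abst: "\<bar>h / (real N)\<^sup>2\<bar> = t" by (simp add: t_def)
  have one: "(\<integral>\<^sup>+v. ennreal (decay (h / (real N)\<^sup>2) ((v + 2 * (real j / N) * h) / N)) \<partial>lborel)
      \<le> ennreal (5 * (1 + t)\<^sup>2 * N * pi)" for j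
  proof -
    have "(\<integral>\<^sup>+v. ennreal (decay (h / (real N)\<^sup>2) ((v + 2 * (real j / N) * h) / N)) \<partial>lborel)
      = ennreal N * (\<integral>\<^sup>+y. ennreal (decay (h / (real N)\<^sup>2) y) \<partial>lborel)"
      using N by (subst nn_integral_real_affine[where c=N and t="- (2 * (real j / N) * h)"]) auto
    also have "\<dots> \<le> ennreal N * (\<integral>\<^sup>+y. ennreal (5 * (1 + t)\<^sup>2) * ennreal (1 / (1 + y\<^sup>2)) \<partial>lborel)"
      using decay_le[of "h / (real N)\<^sup>2"] unfolding abst
      by (intro mult_left_mono nn_integral_mono) (auto simp: ennreal_mult[symmetric] intro!: ennreal_leI)
    also have "\<dots> \<le> ennreal N * (ennreal (5 * (1 + t)\<^sup>2) * ennreal pi)"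
      by (subst nn_integral_cmult) (auto intro!: mult_left_mono nn_integral_cauchy_density_le)
    also have "\<dots> = ennreal (5 * (1 + t)\<^sup>2 * N * pi)"
      by (simp add: ennreal_mult[symmetric] mult_ac)
    finally show ?thesis .
  qed
  have "(\<integral>\<^sup>+v. ennreal (strip_sum N h v) \<partial>lborel)
      = (\<Sum>j<N. (\<integral>\<^sup>+v. ennreal (decay (h / (real N)\<^sup>2) ((v + 2 * (real j / N) * h) / N)) \<partial>lborel))"
    unfolding strip_sum_def by (subst nn_integral_sum[symmetric]) (auto simp: decay_nonneg sum_ennreal)
  also have "\<dots> \<le> (\<Sum>j<N. ennreal (5 * (1 + t)\<^sup>2 * N * pi))"
    by (intro sum_mono one)
  also have "\<dots> = ennreal (5 * (1 + t)\<^sup>2 * (real N)\<^sup>2 * pi)"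
  proof -
    have "(\<Sum>j<N. ennreal (5 * (1 + t)\<^sup>2 * N * pi)) = ennreal (\<Sum>j<N. 5 * (1 + t)\<^sup>2 * N * pi)"
      by (rule sum_ennreal) auto
    also have "(\<Sum>j<N. 5 * (1 + t)\<^sup>2 * N * pi) = 5 * (1 + t)\<^sup>2 * (real N)\<^sup>2 * pi"
      by (simp add: power2_eq_square)
    finally show ?thesis .
  qed
  finally show ?thesis .
qed

text \<open>This integral over the heights is the source of the logarithm; partial fractions give a primitive.\<close>

lemma nn_integral_log_kernel_le:
  assumes N: "N > 0"
  defines "\<delta> \<equiv> 1 / (2 * real N)"
  shows "(\<integral>\<^sup>+s. ennreal (1 / ((\<bar>s\<bar> + \<delta>) * (1 + \<bar>s\<bar>))) \<partial>lborel) \<le> ennreal (4 * ln (2 * real N))"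
proof -
  have \<delta>: "0 < \<delta>" "\<delta> \<le> 1 / 2" using N by (auto simp: \<delta>_def field_simps)
  have ln\<delta>: "ln \<delta> = - ln (2 * real N)" unfolding \<delta>_def using N by (simp add: ln_div)
  define f where "f s = 1 / ((s + \<delta>) * (1 + s))" for s
  \<comment> \<open>With \<open>\<delta> = 1 / (2 N)\<close> instead of \<open>1 / N\<close> the denominator \<open>1 - \<delta>\<close> is at least \<open>1 / 2\<close> even if \<open>N = 1\<close>.\<close>
  define F where "F s = ln ((s + \<delta>) / (s + 1)) / (1 - \<delta>)" for s
  have "(\<integral>\<^sup>+s. ennreal (f s) * indicator {0..} s \<partial>lborel) = ennreal (0 - F 0)"
  proof (rule nn_integral_FTC_atLeast)
    show "f \<in> borel_measurable borel" unfolding f_def by measurable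
    fix s :: real assume s: "0 \<le> s"
    show "(F has_real_derivative f s) (at s)"
    proof -
      have "((\<lambda>s. (ln (s + \<delta>) - ln (s + 1)) / (1 - \<delta>)) has_real_derivative ((1 / (s + \<delta>) - 1 / (s + 1)) / (1 - \<delta>))) (at s)"
        using s \<delta> by (auto intro!: derivative_eq_intros)
      moreover have "(1 / (s + \<delta>) - 1 / (s + 1)) / (1 - \<delta>) = f s"
        using s \<delta> by (simp add: f_def divide_simps)
      moreover have "\<forall>\<^sub>F x in nhds s. (ln (x + \<delta>) - ln (x + 1)) / (1 - \<delta>) = F x"
        using eventually_nhds_in_open[of "{- \<delta><..}" s] s \<delta>
        by (auto elim!: eventually_mono simp: F_def ln_div)
      ultimately show ?thesis by (simp add: DERIV_cong_ev[OF refl _ refl])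
    qed
    show "0 \<le> f s" using s \<delta> by (simp add: f_def)
  next
    have "((\<lambda>s. (s + \<delta>) / (s + 1)) \<longlongrightarrow> 1) at_top"
      by real_asymp
    then have "((\<lambda>s. ln ((s + \<delta>) / (s + 1)) / (1 - \<delta>)) \<longlongrightarrow> ln 1 / (1 - \<delta>)) at_top"
      using \<delta> by (intro tendsto_intros) auto
    then show "(F \<longlongrightarrow> 0) at_top" by (simp add: F_def[abs_def])
  qed
  also have "\<dots> \<le> ennreal (2 * ln (2 * real N))"
  proof (rule ennreal_leI)
    have "0 - F 0 = ln (2 * real N) / (1 - \<delta>)" by (simp add: F_def ln\<delta>)
    also have "\<dots> \<le> ln (2 * real N) / (1 / 2)" using \<delta> N by (intro divide_left_mono) auto
    finally show "0 - F 0 \<le> 2 * ln (2 * real N)" by simp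
  qed
  finally have le: "(\<integral>\<^sup>+s. ennreal (f s) * indicator {0..} s \<partial>lborel) \<le> ennreal (2 * ln (2 * real N))" .
  have "(\<integral>\<^sup>+s. ennreal (f \<bar>s\<bar>) \<partial>lborel) \<le> 2 * (\<integral>\<^sup>+s. ennreal (f \<bar>s\<bar>) * indicator {0..} s \<partial>lborel)"
    by (rule nn_integral_even_le) (auto simp: f_def)
  also have "(\<integral>\<^sup>+s. ennreal (f \<bar>s\<bar>) * indicator {0..} s \<partial>lborel) = (\<integral>\<^sup>+s. ennreal (f s) * indicator {0..} s \<partial>lborel)"
    by (intro nn_integral_cong) (auto simp: indicator_def)
  also have "2 * \<dots> \<le> ennreal 2 * ennreal (2 * ln (2 * real N))"
    using mult_left_mono[OF le, of 2] by simp
  also have "\<dots> = ennreal (4 * ln (2 * real N))"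
    using N by (subst ennreal_mult[symmetric]) auto
  finally show ?thesis by (simp add: f_def)
qed

text \<open>The exponent is small compared to the 100 of \<open>ball_weight\<close>, so that averaging ball weights against
this weight reproduces it, and large enough for \<open>bush_estimate\<close>.\<close>

definition spread_weight :: "real \<Rightarrow> real ^ 3 \<Rightarrow> real" where
  "spread_weight R x = (1 + norm x / R) powr (-20)"

lemma measurable_spread_weight [measurable]: "spread_weight R \<in> borel_measurable borel"
  unfolding spread_weight_def by measurable

text \<open>One factor of the strip sum is integrated, the remaining power is estimated by the supremum. After
squaring, the supremum has an exponent between 0 and 1, and since its bound is at least 1 this
exponent may be replaced by 1.\<close>

lemma nn_integral_strip_sum_powr_le:
  fixes h :: real
  assumes N: "N > 0" and \<beta>: "1 \<le> \<beta>" "\<beta> \<le> 3 / 2"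
  defines "t \<equiv> \<bar>h\<bar> / (real N)\<^sup>2"
  shows "(\<integral>\<^sup>+v. ennreal (strip_sum N h v powr \<beta>) \<partial>lborel)\<^sup>2
    \<le> ennreal (40000 * (real N) ^ 4 * (1 + t) ^ 8 / (t + 1 / (2 * real N)))"
proof -
  \<comment> \<open>The bound for the supremum of the strip sum; it is at least 1 for every height.\<close>
  define Q where "Q = 100 * (1 + t) ^ 4 / (t + 1 / (2 * real N))"
  have t0: "t \<ge> 0" by (simp add: t_def)
  have d0: "t + 1 / (2 * real N) > 0" using t0 N by (auto intro: add_nonneg_pos)
  have Q1: "1 \<le> Q"
  proof -
    have "t + 1 / (2 * real N) \<le> (1 + t) ^ 1" using N t0 by (simp add: field_simps)
    also have "\<dots> \<le> (1 + t) ^ 4" using t0 by (intro power_increasing) auto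
    also have "\<dots> \<le> 100 * (1 + t) ^ 4" using t0 by simp
    finally show ?thesis using d0 by (simp add: Q_def)
  qed
  have sup: "strip_sum N h v \<le> Q" for v
    using strip_sum_sup_le[OF N, of h v] d0 unfolding Q_def t_def[symmetric] by (simp add: pos_le_divide_eq)
  have "(\<integral>\<^sup>+v. ennreal (strip_sum N h v powr \<beta>) \<partial>lborel)
      \<le> (\<integral>\<^sup>+v. ennreal (Q powr (\<beta> - 1)) * ennreal (strip_sum N h v) \<partial>lborel)"
  proof (intro nn_integral_mono)
    fix v
    have "strip_sum N h v powr \<beta> = strip_sum N h v powr (\<beta> - 1) * strip_sum N h v"
      using strip_sum_nonneg[of N h v] \<beta> by (cases "strip_sum N h v = 0") (auto simp: powr_diff)
    also have "\<dots> \<le> Q powr (\<beta> - 1) * strip_sum N h v"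
      using \<beta> by (intro mult_right_mono powr_mono2 sup strip_sum_nonneg) auto
    finally show "ennreal (strip_sum N h v powr \<beta>) \<le> ennreal (Q powr (\<beta> - 1)) * ennreal (strip_sum N h v)"
      by (simp add: ennreal_mult[symmetric] strip_sum_nonneg ennreal_leI)
  qed
  also have "\<dots> \<le> ennreal (Q powr (\<beta> - 1)) * ennreal (5 * (1 + t)\<^sup>2 * (real N)\<^sup>2 * pi)"
    using nn_integral_strip_sum_le[OF N, of h]
    by (subst nn_integral_cmult) (auto simp: t_def intro!: mult_left_mono)
  finally have "(\<integral>\<^sup>+v. ennreal (strip_sum N h v powr \<beta>) \<partial>lborel)
     \<le> ennreal (Q powr (\<beta> - 1) * (5 * (1 + t)\<^sup>2 * (real N)\<^sup>2 * pi))"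
    by (simp add: ennreal_mult)
  then have "(\<integral>\<^sup>+v. ennreal (strip_sum N h v powr \<beta>) \<partial>lborel)\<^sup>2
     \<le> (ennreal (Q powr (\<beta> - 1) * (5 * (1 + t)\<^sup>2 * (real N)\<^sup>2 * pi)))\<^sup>2"
    by (intro power_mono) auto
  also have "\<dots> = ennreal ((Q powr (\<beta> - 1) * (5 * (1 + t)\<^sup>2 * (real N)\<^sup>2 * pi))\<^sup>2)"
    by (simp add: ennreal_power)
  also have "\<dots> \<le> ennreal (40000 * (real N) ^ 4 * (1 + t) ^ 8 / (t + 1 / (2 * real N)))"
  proof (rule ennreal_leI)
    have "(Q powr (\<beta> - 1))\<^sup>2 = Q powr (2 * \<beta> - 2)"
      using Q1 by (simp add: powr_power algebra_simps)
    also have "\<dots> \<le> Q powr 1" using Q1 \<beta> by (intro powr_mono) auto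
    finally have Qp: "(Q powr (\<beta> - 1))\<^sup>2 \<le> Q" using Q1 by simp
    have "pi\<^sup>2 \<le> 4\<^sup>2" using pi_less_4 by (intro power_mono) auto
    then have P: "(5 * (1 + t)\<^sup>2 * (real N)\<^sup>2 * pi)\<^sup>2 \<le> 25 * (1 + t) ^ 4 * (real N) ^ 4 * 16"
      using mult_left_mono[of "pi\<^sup>2" 16 "25 * ((1 + t) ^ 4 * (real N) ^ 4)"]
      by (simp add: power_mult_distrib mult_ac flip: power_mult)
    have "(Q powr (\<beta> - 1) * (5 * (1 + t)\<^sup>2 * (real N)\<^sup>2 * pi))\<^sup>2
       = (Q powr (\<beta> - 1))\<^sup>2 * (5 * (1 + t)\<^sup>2 * (real N)\<^sup>2 * pi)\<^sup>2"
      by (simp only: power_mult_distrib)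
    also have "\<dots> \<le> Q * (25 * (1 + t) ^ 4 * (real N) ^ 4 * 16)"
      using Q1 by (intro mult_mono Qp P) auto
    also have "\<dots> = 40000 * (real N) ^ 4 * ((1 + t) ^ 4 * (1 + t) ^ 4) / (t + 1 / (2 * real N))"
      by (simp add: Q_def)
    also have "(1 + t) ^ 4 * (1 + t) ^ 4 = (1 + t) ^ 8"
      by (simp flip: power_add)
    finally show "(Q powr (\<beta> - 1) * (5 * (1 + t)\<^sup>2 * (real N)\<^sup>2 * pi))\<^sup>2
       \<le> 40000 * (real N) ^ 4 * (1 + t) ^ 8 / (t + 1 / (2 * real N))" .
  qed
  finally show ?thesis .
qed

text \<open>At fixed height the integrand is a product of functions of the two horizontal coordinates. The
exponent 20 of the weight pays for the polynomial losses in the height and leaves the integrable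
kernel \<open>1 / ((t + \<delta>) (1 + t))\<close>.\<close>

lemma bush_estimate:
  assumes N: "N > 0" and \<beta>: "1 \<le> \<beta>" "\<beta> \<le> 3 / 2"
  shows "(\<integral>\<^sup>+x. ennreal ((\<Sum>q\<in>grid N. (norm (cell_packet N q x))\<^sup>2) powr \<beta> * spread_weight ((real N)\<^sup>2) x) \<partial>lborel)
    \<le> ennreal (160000 * (real N) ^ 6 * ln (2 * real N))"
proof -
  define w where "w h = (1 + \<bar>h\<bar> / (real N)\<^sup>2) powr (-20)" for h
  have [measurable]: "w \<in> borel_measurable borel" unfolding w_def by measurable
  have w: "spread_weight ((real N)\<^sup>2) x \<le> w (x $ 3)" for x
  proof -
    have "1 + \<bar>x $ 3\<bar> / (real N)\<^sup>2 \<le> 1 + norm x / (real N)\<^sup>2"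
      by (intro add_left_mono divide_right_mono component_le_norm_cart) auto
    then show ?thesis unfolding spread_weight_def w_def
      by (intro powr_mono2') (auto intro: add_pos_nonneg)
  qed
  have "(\<integral>\<^sup>+x. ennreal ((\<Sum>q\<in>grid N. (norm (cell_packet N q x))\<^sup>2) powr \<beta> * spread_weight ((real N)\<^sup>2) x) \<partial>lborel)
    \<le> (\<integral>\<^sup>+x. ennreal (strip_sum N (x $ 3) (x $ 1) powr \<beta>) * (ennreal (strip_sum N (x $ 3) (x $ 2) powr \<beta>) * ennreal (w (x $ 3))) \<partial>(lborel :: (real ^ 3) measure))"
  proof (intro nn_integral_mono)
    fix x :: "real ^ 3"
    have "(\<Sum>q\<in>grid N. (norm (cell_packet N q x))\<^sup>2) powr \<beta>
       \<le> (strip_sum N (x $ 3) (x $ 1) * strip_sum N (x $ 3) (x $ 2)) powr \<beta>"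
      using \<beta> by (intro powr_mono2 sum_cell_packet_le N sum_nonneg) auto
    also have "\<dots> = strip_sum N (x $ 3) (x $ 1) powr \<beta> * strip_sum N (x $ 3) (x $ 2) powr \<beta>"
      by (rule powr_mult)
    finally have "(\<Sum>q\<in>grid N. (norm (cell_packet N q x))\<^sup>2) powr \<beta> * spread_weight ((real N)\<^sup>2) x
       \<le> (strip_sum N (x $ 3) (x $ 1) powr \<beta> * strip_sum N (x $ 3) (x $ 2) powr \<beta>) * w (x $ 3)"
      by (intro mult_mono w) (auto simp: spread_weight_def)
    then show "ennreal ((\<Sum>q\<in>grid N. (norm (cell_packet N q x))\<^sup>2) powr \<beta> * spread_weight ((real N)\<^sup>2) x)
       \<le> ennreal (strip_sum N (x $ 3) (x $ 1) powr \<beta>) * (ennreal (strip_sum N (x $ 3) (x $ 2) powr \<beta>) * ennreal (w (x $ 3)))"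
      by (simp add: ennreal_mult[symmetric] w_def ennreal_leI mult.assoc)
  qed
  also have "\<dots> = (\<integral>\<^sup>+h. (\<integral>\<^sup>+a. (\<integral>\<^sup>+b. ennreal (strip_sum N h a powr \<beta>) * (ennreal (strip_sum N h b powr \<beta>) * ennreal (w h)) \<partial>lborel) \<partial>lborel) \<partial>lborel)"
    by (subst nn_integral_real3) auto
  also have "\<dots> = (\<integral>\<^sup>+h. ennreal (w h) * (\<integral>\<^sup>+v. ennreal (strip_sum N h v powr \<beta>) \<partial>lborel)\<^sup>2 \<partial>lborel)"
    by (simp add: nn_integral_cmult nn_integral_multc power2_eq_square mult_ac)
  also have "\<dots> \<le> (\<integral>\<^sup>+h. ennreal (40000 * (real N) ^ 4) *
      ennreal (1 / ((\<bar>h\<bar> / (real N)\<^sup>2 + 1 / (2 * real N)) * (1 + \<bar>h\<bar> / (real N)\<^sup>2))) \<partial>lborel)"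
  proof (intro nn_integral_mono)
    fix h :: real
    define t where "t = \<bar>h\<bar> / (real N)\<^sup>2"
    have t0: "t \<ge> 0" by (simp add: t_def)
    have d0: "t + 1 / (2 * real N) > 0" using t0 N by (auto intro: add_nonneg_pos)
    have "ennreal (w h) * (\<integral>\<^sup>+v. ennreal (strip_sum N h v powr \<beta>) \<partial>lborel)\<^sup>2
       \<le> ennreal (w h) * ennreal (40000 * (real N) ^ 4 * (1 + t) ^ 8 / (t + 1 / (2 * real N)))"
      unfolding t_def using nn_integral_strip_sum_powr_le[OF N \<beta>, of h] by (intro mult_left_mono) auto
    also have "\<dots> = ennreal (40000 * (real N) ^ 4 * (w h * (1 + t) ^ 8) / (t + 1 / (2 * real N)))"
      using d0 t0 by (subst ennreal_mult[symmetric]) (auto simp: w_def mult_ac)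
    also have "\<dots> \<le> ennreal (40000 * (real N) ^ 4 * (1 / (1 + t)) / (t + 1 / (2 * real N)))"
    proof (intro ennreal_leI divide_right_mono mult_left_mono)
      have "w h * (1 + t) ^ 8 = (1 + t) powr (-20) * (1 + t) powr 8"
        using t0 by (simp add: w_def t_def powr_realpow[symmetric])
      also have "\<dots> = (1 + t) powr (-12)" by (simp flip: powr_add)
      also have "\<dots> \<le> (1 + t) powr (-1)" using t0 by (intro powr_mono) auto
      finally show "w h * (1 + t) ^ 8 \<le> 1 / (1 + t)" using t0 by (simp add: powr_minus_divide)
    qed (use d0 in auto)
    also have "\<dots> = ennreal (40000 * (real N) ^ 4) * ennreal (1 / ((t + 1 / (2 * real N)) * (1 + t)))"
      using t0 d0 by (subst ennreal_mult[symmetric]) (auto simp: mult_ac)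
    finally show "ennreal (w h) * (\<integral>\<^sup>+v. ennreal (strip_sum N h v powr \<beta>) \<partial>lborel)\<^sup>2
       \<le> ennreal (40000 * (real N) ^ 4) * ennreal (1 / ((\<bar>h\<bar> / (real N)\<^sup>2 + 1 / (2 * real N)) * (1 + \<bar>h\<bar> / (real N)\<^sup>2)))"
      unfolding t_def .
  qed
  also have "\<dots> = ennreal (40000 * (real N) ^ 4) * (ennreal ((real N)\<^sup>2) *
      (\<integral>\<^sup>+s. ennreal (1 / ((\<bar>s\<bar> + 1 / (2 * real N)) * (1 + \<bar>s\<bar>))) \<partial>lborel))"
    using N by (subst nn_integral_cmult, simp, subst nn_integral_real_affine[where c="(real N)\<^sup>2" and t=0])
      (auto simp: abs_mult)
  also have "\<dots> \<le> ennreal (40000 * (real N) ^ 4) * (ennreal ((real N)\<^sup>2) * ennreal (4 * ln (2 * real N)))"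
    by (intro mult_left_mono nn_integral_log_kernel_le N) auto
  also have "\<dots> = ennreal (160000 * (real N) ^ 6 * ln (2 * real N))"
  proof -
    have "40000 * real N ^ 4 * ((real N)\<^sup>2 * (4 * ln (2 * real N))) = 160000 * (real N) ^ 6 * ln (2 * real N)"
    proof -
      have "(real N) ^ 6 = (real N) ^ 4 * (real N)\<^sup>2" by (simp flip: power_add)
      then show ?thesis by simp
    qed
    then show ?thesis using N by (simp add: ennreal_mult[symmetric])
  qed
  finally show ?thesis .
qed

section \<open>Random partitions\<close>

lemma inj_on_shift_mod:
  fixes c L :: nat
  assumes "\<And>j j'. j \<in> A \<Longrightarrow> j' \<in> A \<Longrightarrow> j < j' \<Longrightarrow> j' - j < L"
  shows "inj_on (\<lambda>j. (j + c) mod L) A"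
proof (rule linorder_inj_onI)
  fix j j' assume A: "j < j'" "j \<in> A" "j' \<in> A"
  show "(j + c) mod L \<noteq> (j' + c) mod L"
  proof
    assume "(j + c) mod L = (j' + c) mod L"
    then have "L dvd (j' + c) - (j + c)"
      using A mod_eq_dvd_iff_nat[of "j + c" "j' + c" L] by auto
    then have "L dvd j' - j" by simp
    then have "L \<le> j' - j" using A by (intro dvd_imp_le) auto
    with assms[OF A(2,3,1)] show False by simp
  qed
qed auto

lemma bij_betw_shift_mod:
  fixes c L :: nat
  assumes L: "L > 0" and A: "A = {1..L} \<or> A = {..<L}"
  shows "bij_betw (\<lambda>j. (j + c) mod L) A {..<L}"
proof -
  have inj: "inj_on (\<lambda>j. (j + c) mod L) A"
    using A by (intro inj_on_shift_mod) auto
  moreover have "(\<lambda>j. (j + c) mod L) ` A = {..<L}"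
    using L A by (intro card_subset_eq) (auto simp: card_image[OF inj])
  ultimately show ?thesis by (simp add: bij_betw_def)
qed

text \<open>The squares are arranged by \<open>e\<close> in \<open>M\<close> rows of \<open>L\<close> entries. The part number \<open>j\<close> takes one entry from each row,
at position \<open>j\<close> shifted cyclically by \<open>s m\<close> in row \<open>m\<close>. For every \<open>s\<close> this is a partition into parts with
\<open>M\<close> elements, and for uniform random \<open>s\<close> each part consists of independent uniform choices.\<close>

definition selection :: "(nat \<times> nat \<Rightarrow> 'a) \<Rightarrow> nat \<Rightarrow> nat \<Rightarrow> (nat \<Rightarrow> nat) \<Rightarrow> nat \<Rightarrow> 'a set" where
  "selection e M L s j = (\<lambda>m. e (m, (j + s m) mod L)) ` {..<M}"

lemma inj_on_selection:
  fixes L :: nat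
  assumes e: "bij_betw e ({..<M} \<times> {..<L}) G" and L: "L > 0"
  shows "inj_on (\<lambda>m. e (m, (j + s m) mod L)) {..<M}"
proof (rule inj_onI)
  fix m m' assume "m \<in> {..<M}" "m' \<in> {..<M}" "e (m, (j + s m) mod L) = e (m', (j + s m') mod L)"
  then have "(m, (j + s m) mod L) = (m', (j + s m') mod L)"
    using L by (intro inj_onD[OF bij_betw_imp_inj_on[OF e]]) auto
  then show "m = m'" by simp
qed

lemma selection_subset:
  assumes e: "bij_betw e ({..<M} \<times> {..<L}) G" and L: "L > 0"
  shows "selection e M L s j \<subseteq> G"
  using bij_betw_imp_surj_on[OF e] L by (auto simp: selection_def)

lemma M_set_partition_selection:
  assumes N: "N > 0" and M: "M > 0" "M dvd N\<^sup>2" and e: "bij_betw e ({..<M} \<times> {..<N\<^sup>2 div M}) (grid N)"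
  shows "M_set_partition (N\<^sup>2) M (\<lambda>j. cell N ` selection e M (N\<^sup>2 div M) s j)"
proof -
  define L where "L = N\<^sup>2 div M"
  have L: "L > 0" unfolding L_def using N M by (auto simp: div_greater_zero_iff dvd_imp_le)
  have e: "bij_betw e ({..<M} \<times> {..<L}) (grid N)" using e by (simp add: L_def)
  note inj_e = bij_betw_imp_inj_on[OF e]
  have sq: "squares (N\<^sup>2) = cell N ` grid N"
    by (rule squares_eq_cells[OF N]) simp
  have inj_c: "inj_on (cell N) A" for A using inj_cell[OF N] by (rule inj_on_subset) auto
  have sub: "selection e M L s j \<subseteq> grid N" for j by (rule selection_subset[OF e L])
  have "M_set (N\<^sup>2) M (cell N ` selection e M L s j)" for j
    unfolding M_set_def sq using sub[of j] inj_on_selection[OF e L, of j s]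
    by (auto simp: card_image[OF inj_c] selection_def card_image)
  moreover have "disjoint_family_on (\<lambda>j. cell N ` selection e M L s j) {1..L}"
  proof (unfold disjoint_family_on_def, intro ballI impI)
    fix i j assume ij: "i \<in> {1..L}" "j \<in> {1..L}" "i \<noteq> j"
    have "selection e M L s i \<inter> selection e M L s j = {}"
    proof (rule ccontr)
      assume "selection e M L s i \<inter> selection e M L s j \<noteq> {}"
      then obtain q where q: "q \<in> selection e M L s i" "q \<in> selection e M L s j" by blast
      obtain m where m: "m < M" "q = e (m, (i + s m) mod L)"
        using q(1) unfolding selection_def by blast
      obtain m' where m': "m' < M" "q = e (m', (j + s m') mod L)"
        using q(2) unfolding selection_def by blast
      have eq: "e (m, (i + s m) mod L) = e (m', (j + s m') mod L)"
        using m(2) m'(2) by metis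
      have "(m, (i + s m) mod L) \<in> {..<M} \<times> {..<L}" "(m', (j + s m') mod L) \<in> {..<M} \<times> {..<L}"
        using m(1) m'(1) L by auto
      then have "(m, (i + s m) mod L) = (m', (j + s m') mod L)"
        by (rule inj_onD[OF inj_e eq])
      then have "(i + s m) mod L = (j + s m) mod L" by (metis prod.inject)
      then have "i = j"
        using inj_onD[OF bij_betw_imp_inj_on[OF bij_betw_shift_mod[OF L, of "{1..L}" "s m"]], of i j] ij by blast
      then show False using ij by blast
    qed
    then show "cell N ` selection e M L s i \<inter> cell N ` selection e M L s j = {}"
      using inj_cell[OF N] by (simp add: image_Int[symmetric])
  qed
  moreover have "(\<Union>j\<in>{1..L}. cell N ` selection e M L s j) = squares (N\<^sup>2)"
  proof -
    have "grid N \<subseteq> (\<Union>j\<in>{1..L}. selection e M L s j)"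
    proof
      fix q assume "q \<in> grid N"
      then have "q \<in> e ` ({..<M} \<times> {..<L})" by (simp only: bij_betw_imp_surj_on[OF e])
      then obtain m l where ml: "m < M" "l < L" "q = e (m, l)" by blast
      then have "l \<in> (\<lambda>j. (j + s m) mod L) ` {1..L}"
        using bij_betw_imp_surj_on[OF bij_betw_shift_mod[OF L, of "{1..L}" "s m"]] by simp
      then obtain j where "j \<in> {1..L}" "(j + s m) mod L = l" by blast
      then show "q \<in> (\<Union>j\<in>{1..L}. selection e M L s j)"
        using ml by (auto simp: selection_def)
    qed
    then have "(\<Union>j\<in>{1..L}. selection e M L s j) = grid N" using sub by blast
    then show ?thesis unfolding sq by (metis image_UN)
  qed
  ultimately show ?thesis by (simp add: M_set_partition_def L_def)
qed

text \<open>Subadditivity of \<open>t powr e\<close> for exponents between 0 and 1.\<close>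

lemma powr_one_plus_le:
  fixes t e :: real
  assumes "0 \<le> t" "0 \<le> e" "e \<le> 1"
  shows "t * (1 + t) powr e \<le> t + t powr (1 + e)"
proof (cases "t = 0")
  case False
  with assms have t: "t > 0" by simp
  have "(1 + t) powr e = (1 + t) * (1 + t) powr (e - 1)"
    using t by (simp add: powr_diff)
  also have "\<dots> = (1 + t) powr (e - 1) + t * (1 + t) powr (e - 1)" by (simp add: algebra_simps)
  also have "\<dots> \<le> 1 + t * t powr (e - 1)"
  proof (intro add_mono mult_left_mono)
    show "(1 + t) powr (e - 1) \<le> 1" using t assms using powr_mono2'[of "e - 1" 1 "1 + t"] by simp
    show "(1 + t) powr (e - 1) \<le> t powr (e - 1)" using t assms by (intro powr_mono2') auto
  qed (use t in auto)
  also have "t * t powr (e - 1) = t powr e" using t by (simp add: powr_diff)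
  finally have "t * (1 + t) powr e \<le> t * (1 + t powr e)" using t by (intro mult_left_mono) auto
  also have "\<dots> = t + t powr (1 + e)" using t by (simp add: algebra_simps powr_add)
  finally show ?thesis .
qed (use assms in auto)

text \<open>For fixed \<open>j\<close> a cyclic shift does not change the distribution of the choices, so every part is
estimated by \<open>random_choice_moment\<close> with mean \<open>(\<Sum>q\<in>G. b q) / L\<close> and variance \<open>S / L\<close>.\<close>

lemma average_over_selections:
  fixes b :: "'q \<Rightarrow> complex" and p :: real
  assumes e: "bij_betw e ({..<M} \<times> {..<L}) G" and L: "L > 0" and p: "2 \<le> p" "p \<le> 4"
    and b: "\<And>q. q \<in> G \<Longrightarrow> norm (b q) \<le> 1"
  defines "S \<equiv> \<Sum>q\<in>G. (norm (b q))\<^sup>2"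
  shows "(\<Sum>s\<in>PiE {..<M} (\<lambda>_. {..<L}). \<Sum>j=1..L. norm (\<Sum>q\<in>selection e M L s j. b q) powr p)
    \<le> real L ^ M * (80 * (real L powr (1 - p) * norm (\<Sum>q\<in>G. b q) powr p + S + real L powr (1 - p / 2) * S powr (p / 2)))"
proof -
  note inj_e = bij_betw_imp_inj_on[OF e]
  have S0: "S \<ge> 0" unfolding S_def by (intro sum_nonneg) auto
  have reindex: "(\<Sum>m<M. \<Sum>l<L. f (e (m, (j + l) mod L))) = (\<Sum>q\<in>G. f q)" for j and f :: "'q \<Rightarrow> 'b::comm_monoid_add"
  proof -
    have "(\<Sum>l<L. f (e (m, (j + l) mod L))) = (\<Sum>l<L. f (e (m, l)))" for m
      using sum.reindex_bij_betw[OF bij_betw_shift_mod[OF L, of "{..<L}" j], of "\<lambda>l. f (e (m, l))"]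
      by (simp add: add.commute)
    then have "(\<Sum>m<M. \<Sum>l<L. f (e (m, (j + l) mod L))) = (\<Sum>w\<in>{..<M} \<times> {..<L}. f (e w))"
      by (simp add: sum.cartesian_product case_prod_unfold)
    also have "\<dots> = (\<Sum>q\<in>G. f q)" by (rule sum.reindex_bij_betw[OF e])
    finally show ?thesis .
  qed
  define B where "B = 16 * (norm ((\<Sum>q\<in>G. b q) /\<^sub>R L) powr p + 5 * (S / L * (1 + S / L) powr (p / 2 - 1)))"
  have one: "(\<Sum>s\<in>PiE {..<M} (\<lambda>_. {..<L}). norm (\<Sum>q\<in>selection e M L s j. b q) powr p) \<le> real L ^ M * B" for j
  proof -
    have sel: "(\<Sum>q\<in>selection e M L s j. b q) = (\<Sum>m<M. b (e (m, (j + s m) mod L)))" for s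
      unfolding selection_def by (subst sum.reindex[OF inj_on_selection[OF e L]]) auto
    have "e (m, (j + l) mod L) \<in> G" if "m < M" for m l
      using bij_betw_apply[OF e, of "(m, (j + l) mod L)"] that L by auto
    then have "(\<Sum>s\<in>PiE {..<M} (\<lambda>_. {..<L}). norm (\<Sum>m<M. (\<lambda>m l. b (e (m, (j + l) mod L))) m (s m)) powr p)
      \<le> real L ^ M * (16 * (norm ((\<Sum>m<M. \<Sum>l<L. b (e (m, (j + l) mod L))) /\<^sub>R L) powr p
         + 5 * ((\<Sum>m<M. \<Sum>l<L. (norm (b (e (m, (j + l) mod L))))\<^sup>2) / L
            * (1 + (\<Sum>m<M. \<Sum>l<L. (norm (b (e (m, (j + l) mod L))))\<^sup>2) / L) powr (p / 2 - 1))))"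
      by (intro random_choice_moment[OF L p]) (auto intro: b)
    then show ?thesis unfolding sel B_def S_def by (simp only: reindex reindex[of "\<lambda>q. (norm (b q))\<^sup>2"])
  qed
  have "(\<Sum>s\<in>PiE {..<M} (\<lambda>_. {..<L}). \<Sum>j=1..L. norm (\<Sum>q\<in>selection e M L s j. b q) powr p)
     = (\<Sum>j=1..L. \<Sum>s\<in>PiE {..<M} (\<lambda>_. {..<L}). norm (\<Sum>q\<in>selection e M L s j. b q) powr p)"
    by (rule sum.swap)
  also have "\<dots> \<le> (\<Sum>j=1..L. real L ^ M * B)" by (intro sum_mono one)
  also have "\<dots> = real L ^ M * (L * B)" by simp
  also have "\<dots> \<le> real L ^ M * (80 * (real L powr (1 - p) * norm (\<Sum>q\<in>G. b q) powr p + S + real L powr (1 - p / 2) * S powr (p / 2)))"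
  proof (intro mult_left_mono)
    have Lpow: "real L powr (1 + r) = real L * real L powr r" for r
      using L by (simp add: powr_add)
    have "norm ((\<Sum>q\<in>G. b q) /\<^sub>R L) = norm (\<Sum>q\<in>G. b q) / L"
      by (simp add: divide_inverse mult.commute)
    then have 1: "L * norm ((\<Sum>q\<in>G. b q) /\<^sub>R L) powr p = real L powr (1 - p) * norm (\<Sum>q\<in>G. b q) powr p"
      using Lpow[of "- p"] by (simp add: powr_divide powr_minus_divide)
    have "S / L * (1 + S / L) powr (p / 2 - 1) \<le> S / L + (S / L) powr (1 + (p / 2 - 1))"
      using p S0 by (intro powr_one_plus_le) auto
    also have "(S / L) powr (1 + (p / 2 - 1)) = S powr (p / 2) * real L powr (- (p / 2))"
      using L S0 by (simp add: powr_divide powr_minus_divide)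
    finally have "L * (S / L * (1 + S / L) powr (p / 2 - 1)) \<le> L * (S / L + S powr (p / 2) * real L powr (- (p / 2)))"
      by (intro mult_left_mono) auto
    also have "\<dots> = S + real L powr (1 - p / 2) * S powr (p / 2)"
      using L Lpow[of "- (p / 2)"] by (simp add: distrib_left)
    finally have 2: "L * (S / L * (1 + S / L) powr (p / 2 - 1)) \<le> S + real L powr (1 - p / 2) * S powr (p / 2)" .
    have "L * B = 16 * (L * norm ((\<Sum>q\<in>G. b q) /\<^sub>R L) powr p) + 80 * (L * (S / L * (1 + S / L) powr (p / 2 - 1)))"
      unfolding B_def by (simp only: distrib_left mult.assoc mult.left_commute[of "real L"])
    also have "\<dots> \<le> 80 * (real L powr (1 - p) * norm (\<Sum>q\<in>G. b q) powr p)
       + 80 * (S + real L powr (1 - p / 2) * S powr (p / 2))"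
      unfolding 1 using 2 by (intro add_mono mult_right_mono mult_left_mono) auto
    finally show "L * B \<le> 80 * (real L powr (1 - p) * norm (\<Sum>q\<in>G. b q) powr p + S + real L powr (1 - p / 2) * S powr (p / 2))"
      by (simp add: algebra_simps)
  qed auto
  finally show ?thesis .
qed

section \<open>Extensions of step functions\<close>

definition open_cell :: "nat \<Rightarrow> nat \<times> nat \<Rightarrow> (real ^ 2) set" where
  "open_cell N q = box (vector [real (fst q) / real N, real (snd q) / real N])
                       (vector [(real (fst q) + 1) / real N, (real (snd q) + 1) / real N])"

text \<open>Open squares are used since they are disjoint; their boundaries form a null set.\<close>

definition step_function :: "nat \<Rightarrow> (nat \<times> nat \<Rightarrow> complex) \<Rightarrow> real ^ 2 \<Rightarrow> complex" where
  "step_function N a \<xi> = (\<Sum>q\<in>grid N. indicator (open_cell N q) \<xi> *\<^sub>R ((real N)\<^sup>2 *\<^sub>R a q))"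

lemma measurable_step_function [measurable]: "step_function N a \<in> borel_measurable borel"
  unfolding step_function_def open_cell_def by measurable

lemma grid_point_in_open_cell:
  assumes N: "N > 0" and u: "u \<in> box 0 One"
  shows "grid_point N q u \<in> open_cell N r \<longleftrightarrow> q = r"
proof -
  have u': "0 < u $ 1" "u $ 1 < 1" "0 < u $ 2" "u $ 2 < 1"
    using u unfolding One_real2 by (auto simp: mem_box_cart forall_2)
  have "grid_point N q u \<in> open_cell N r \<longleftrightarrow>
     real (fst r) < real (fst q) + u $ 1 \<and> real (fst q) + u $ 1 < real (fst r) + 1 \<and>
     real (snd r) < real (snd q) + u $ 2 \<and> real (snd q) + u $ 2 < real (snd r) + 1"
    using N by (auto simp: open_cell_def mem_box_cart forall_2 divide_strict_right_mono divide_less_cancel)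
  also have "\<dots> \<longleftrightarrow> fst q = fst r \<and> snd q = snd r"
    using u' by linarith
  finally show ?thesis by (simp add: prod_eq_iff)
qed

lemma step_function_grid_point:
  assumes N: "N > 0" and u: "u \<in> box 0 One" and q: "q \<in> grid N"
  shows "step_function N a (grid_point N q u) = (real N)\<^sup>2 *\<^sub>R a q"
proof -
  have "step_function N a (grid_point N q u) = (\<Sum>r\<in>grid N. if r = q then (real N)\<^sup>2 *\<^sub>R a q else 0)"
    unfolding step_function_def
    by (intro sum.cong refl) (auto simp: indicator_def grid_point_in_open_cell[OF N u])
  then show ?thesis using q by simp
qed

lemma norm_step_function_le:
  assumes "\<And>q. q \<in> grid N \<Longrightarrow> norm (a q) \<le> 1"
  shows "norm (step_function N a \<xi>) \<le> (real N) ^ 4"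
proof -
  have "norm (step_function N a \<xi>) \<le> (\<Sum>q\<in>grid N. (real N)\<^sup>2 * 1)"
    unfolding step_function_def
    by (intro sum_norm_le) (use assms in \<open>auto simp: indicator_def intro!: mult_left_le\<close>)
  also have "\<dots> = (real N) ^ 4" by (simp add: card_grid flip: power_add)
  finally show ?thesis .
qed

lemma AE_unit_measure_interior: "AE u in (unit_measure :: (real^2) measure). u \<in> box 0 One"
proof -
  have "cbox 0 One - box 0 (One :: real^2) \<in> null_sets lebesgue"
    using negligible_frontier_interval[of 0 "One :: real^2"] by (simp add: negligible_iff_null_sets)
  then have "AE u in lebesgue. u \<notin> cbox 0 One - box 0 (One :: real^2)" by (rule AE_not_in)
  then have "AE u in lborel. u \<notin> cbox 0 One - box 0 (One :: real^2)" by (simp add: AE_completion_iff)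
  then show ?thesis by (subst AE_restrict_space_iff) auto
qed

lemma extension_step_function:
  assumes N: "N > 0" and J: "J \<subseteq> grid N" and a: "\<And>q. q \<in> grid N \<Longrightarrow> norm (a q) \<le> 1"
  shows "extension (\<Union>(cell N ` J)) (step_function N a) x = (\<Sum>q\<in>J. a q * cell_packet N q x)"
proof -
  define f where "f \<xi> = step_function N a \<xi> * char_e (lift_paraboloid \<xi> \<bullet> x)" for \<xi>
  have [measurable]: "f \<in> borel_measurable borel" unfolding f_def by measurable
  have "extension (\<Union>(cell N ` J)) (step_function N a) x
    = (\<Sum>q\<in>J. (\<integral>u. f (grid_point N q u) \<partial>unit_measure)) / (real N)\<^sup>2"
    unfolding extension_def f_def[symmetric]
    by (rule integral_Union_cells[OF N J, where B="(real N) ^ 4"])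
       (use norm_step_function_le[OF a] in \<open>auto simp: f_def norm_mult\<close>)
  also have "(\<Sum>q\<in>J. (\<integral>u. f (grid_point N q u) \<partial>unit_measure))
     = (\<Sum>q\<in>J. ((real N)\<^sup>2 *\<^sub>R a q) * cell_packet N q x)"
  proof (intro sum.cong refl)
    fix q assume "q \<in> J"
    then have q: "q \<in> grid N" using J by auto
    have "(\<integral>u. f (grid_point N q u) \<partial>unit_measure)
       = (\<integral>u. ((real N)\<^sup>2 *\<^sub>R a q) * char_e (lift_paraboloid (grid_point N q u) \<bullet> x) \<partial>unit_measure)"
      using AE_unit_measure_interior
      by (intro integral_cong_AE measurable_on_unit_measure)
         (auto simp: f_def step_function_grid_point[OF N _ q])
    then show "(\<integral>u. f (grid_point N q u) \<partial>unit_measure) = ((real N)\<^sup>2 *\<^sub>R a q) * cell_packet N q x"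
      unfolding cell_packet_def by simp
  qed
  also have "\<dots> / (real N)\<^sup>2 = (\<Sum>q\<in>J. a q * cell_packet N q x)"
    unfolding sum_divide_distrib using N by (intro sum.cong refl) (simp add: scaleR_conv_of_real)
  finally show ?thesis .
qed

lemma ennreal_integral_le_nn_integral:
  fixes f :: "'a \<Rightarrow> real"
  assumes "\<And>x. 0 \<le> f x"
  shows "ennreal (\<integral>x. f x \<partial>M) \<le> (\<integral>\<^sup>+x. ennreal (f x) \<partial>M)"
  by (cases "integrable M f") (auto simp: nn_integral_eq_integral assms not_integrable_integral_eq)

lemma Lp_norm_powr:
  assumes "p > 0" shows "Lp_norm p M f powr p = (\<integral>x. norm (f x) powr p \<partial>M)"
  using assms by (simp add: Lp_norm_def powr_powr)

lemma Lp_norm_ball_powr: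
  fixes f :: "real ^ 3 \<Rightarrow> complex"
  assumes p: "p > 0" and f [measurable]: "f \<in> borel_measurable borel" and B: "\<And>x. norm (f x) \<le> B"
  shows "ennreal (Lp_norm p (lebesgue_on (ball c r)) f powr p) = Lp_mass p (ball c r) f"
proof -
  have [measurable]: "(\<lambda>x. norm (f x) powr p) \<in> borel_measurable borel" by measurable
  have int: "integrable lborel (\<lambda>x. indicator (ball c r) x *\<^sub>R norm (f x) powr p)"
  proof (rule integrableI_bounded_set_indicator[where B="B powr p"])
    show "AE x in lborel. x \<in> ball c r \<longrightarrow> norm (norm (f x) powr p) \<le> B powr p"
      using B p by (auto intro!: powr_mono2)
  qed (use emeasure_lborel_ball_finite[of c r] in auto)
  have "Lp_norm p (lebesgue_on (ball c r)) f powr p = (\<integral>x. indicator (ball c r) x *\<^sub>R norm (f x) powr p \<partial>lebesgue)"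
    unfolding Lp_norm_powr[OF p] by (subst integral_restrict_space) auto
  also have "\<dots> = (\<integral>x. indicator (ball c r) x *\<^sub>R norm (f x) powr p \<partial>lborel)"
  proof (rule integral_completion)
    have "(\<lambda>x. indicat_real (ball c r) x *\<^sub>R norm (f x) powr p) \<in> borel_measurable borel"
      by (intro borel_measurable_scaleR borel_measurable_indicator) auto
    then show "(\<lambda>x. indicat_real (ball c r) x *\<^sub>R norm (f x) powr p) \<in> borel_measurable lborel" by simp
  qed
  also have "ennreal \<dots> = (\<integral>\<^sup>+x. ennreal (indicator (ball c r) x *\<^sub>R norm (f x) powr p) \<partial>lborel)"
    by (rule nn_integral_eq_integral[symmetric, OF int]) auto
  also have "\<dots> = Lp_mass p (ball c r) f"
    unfolding Lp_mass_def by (intro nn_integral_cong) (auto simp: indicator_def)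
  finally show ?thesis .
qed

lemma measurable_ball_weight [measurable (raw)]:
  assumes [measurable]: "f \<in> borel_measurable M" "g \<in> borel_measurable M"
  shows "(\<lambda>w. ball_weight (f w) R (g w)) \<in> borel_measurable M"
  unfolding ball_weight_def by measurable

lemma Lp_norm_weighted_ball_powr_le:
  fixes f :: "real ^ 3 \<Rightarrow> complex"
  assumes p: "p > 0" and f [measurable]: "f \<in> borel_measurable borel"
  shows "ennreal (Lp_norm p (weighted_ball c r) f powr p)
    \<le> (\<integral>\<^sup>+x. ennreal (ball_weight c r x * norm (f x) powr p) \<partial>lborel)"
proof -
  have [measurable]: "(\<lambda>x. ennreal (ball_weight c r x)) \<in> borel_measurable lebesgue"
    "(\<lambda>x. ennreal (norm (f x) powr p)) \<in> borel_measurable lebesgue"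
    by (auto intro!: measurable_completion)
  have "ennreal (Lp_norm p (weighted_ball c r) f powr p) \<le> (\<integral>\<^sup>+x. ennreal (norm (f x) powr p) \<partial>weighted_ball c r)"
    unfolding Lp_norm_powr[OF p] by (rule ennreal_integral_le_nn_integral) auto
  also have "\<dots> = (\<integral>\<^sup>+x. ennreal (ball_weight c r x) * ennreal (norm (f x) powr p) \<partial>lebesgue)"
    by (rule nn_integral_density) fact+
  also have "\<dots> = (\<integral>\<^sup>+x. ennreal (ball_weight c r x) * ennreal (norm (f x) powr p) \<partial>lborel)"
    by (rule nn_integral_completion)
  finally show ?thesis by (simp add: ennreal_mult ball_weight_def)
qed

section \<open>From local estimates to weighted estimates\<close>

lemma nn_integral_affine_cart3:
  fixes f :: "real ^ 3 \<Rightarrow> ennreal"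
  assumes [measurable]: "f \<in> borel_measurable borel" and R: "R > 0"
  shows "(\<integral>\<^sup>+x. f x \<partial>lborel) = ennreal (R ^ 3) * (\<integral>\<^sup>+z. f (c + R *\<^sub>R z) \<partial>lborel)"
proof -
  have "(\<integral>\<^sup>+x. f x \<partial>lborel)
     = (\<integral>\<^sup>+x. f x \<partial>density (distr lborel borel (\<lambda>x. c + R *\<^sub>R x)) (\<lambda>_. ennreal (\<bar>R\<bar> ^ DIM(real^3))))"
    using R by (subst lborel_affine[of R c]) auto
  also have "\<dots> = (\<integral>\<^sup>+z. ennreal (R ^ 3) * f (c + R *\<^sub>R z) \<partial>lborel)"
    using R by (simp add: nn_integral_density nn_integral_distr)
  also have "\<dots> = ennreal (R ^ 3) * (\<integral>\<^sup>+z. f (c + R *\<^sub>R z) \<partial>lborel)"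
    by (rule nn_integral_cmult) measurable
  finally show ?thesis .
qed

lemma nn_integral_decay_cart3_le:
  assumes R: "R > 0" and r: "r \<le> - 6"
  shows "(\<integral>\<^sup>+x. ennreal ((1 + norm (x - c) / R) powr r) \<partial>(lborel :: (real ^ 3) measure)) \<le> ennreal (64 * R ^ 3)"
proof -
  have le: "(1 + norm z) powr r \<le> 1 / (1 + (z $ 1)\<^sup>2) * (1 / (1 + (z $ 2)\<^sup>2)) * (1 / (1 + (z $ 3)\<^sup>2))" for z :: "real ^ 3"
  proof -
    have i: "1 + (z $ i)\<^sup>2 \<le> (1 + norm z)\<^sup>2" for i
    proof -
      have "(z $ i)\<^sup>2 \<le> (norm z)\<^sup>2"
        using component_le_norm_cart[of z i] by (simp add: abs_le_square_iff[symmetric])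
      moreover have "(1 + norm z)\<^sup>2 = 1 + (norm z)\<^sup>2 + 2 * norm z" by (simp add: power2_sum)
      ultimately show ?thesis using norm_ge_zero[of z] by linarith
    qed
    have "(1 + norm z) powr r \<le> (1 + norm z) powr (- 6)" using r by (intro powr_mono) auto
    also have "\<dots> = 1 / (1 + norm z)\<^sup>2 * (1 / (1 + norm z)\<^sup>2) * (1 / (1 + norm z)\<^sup>2)"
      by (simp add: powr_minus_divide power_numeral_reduce powr_numeral add_pos_nonneg)
    also have "\<dots> \<le> 1 / (1 + (z $ 1)\<^sup>2) * (1 / (1 + (z $ 2)\<^sup>2)) * (1 / (1 + (z $ 3)\<^sup>2))"
    proof -
      have "0 < (1 + norm z)\<^sup>2" by (intro zero_less_power add_pos_nonneg) auto
      then have "1 / (1 + norm z)\<^sup>2 \<le> 1 / (1 + (z $ k)\<^sup>2)" for k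
        by (intro divide_left_mono i mult_pos_pos) (auto intro!: add_pos_nonneg)
      then show ?thesis by (intro mult_mono mult_nonneg_nonneg) auto
    qed
    finally show ?thesis .
  qed
  have "(\<integral>\<^sup>+z. ennreal ((1 + norm z) powr r) \<partial>(lborel :: (real ^ 3) measure))
     \<le> (\<integral>\<^sup>+z. ennreal (1 / (1 + (z $ 1)\<^sup>2)) * ennreal (1 / (1 + (z $ 2)\<^sup>2)) * ennreal (1 / (1 + (z $ 3)\<^sup>2)) \<partial>(lborel :: (real ^ 3) measure))"
    using le by (intro nn_integral_mono) (auto simp: ennreal_mult[symmetric] intro!: ennreal_leI)
  also have "\<dots> = (\<integral>\<^sup>+y. ennreal (1 / (1 + y\<^sup>2)) \<partial>lborel) * (\<integral>\<^sup>+y. ennreal (1 / (1 + y\<^sup>2)) \<partial>lborel) * (\<integral>\<^sup>+y. ennreal (1 / (1 + y\<^sup>2)) \<partial>lborel)"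
    by (subst nn_integral_real3) (auto simp: nn_integral_cmult nn_integral_multc)
  also have "\<dots> \<le> ennreal pi * ennreal pi * ennreal pi"
    by (intro mult_mono nn_integral_cauchy_density_le) auto
  also have "\<dots> \<le> ennreal 64"
  proof -
    have "pi * pi * pi \<le> 4 * 4 * 4" using pi_less_4 by (intro mult_mono) auto
    then show ?thesis by (simp add: ennreal_mult[symmetric] ennreal_leI del: ennreal_numeral)
  qed
  finally have base: "(\<integral>\<^sup>+z. ennreal ((1 + norm z) powr r) \<partial>(lborel :: (real ^ 3) measure)) \<le> ennreal 64" .
  have "(\<integral>\<^sup>+x. ennreal ((1 + norm (x - c) / R) powr r) \<partial>(lborel :: (real ^ 3) measure))
     = ennreal (R ^ 3) * (\<integral>\<^sup>+z. ennreal ((1 + norm z) powr r) \<partial>(lborel :: (real ^ 3) measure))"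
    using R by (subst nn_integral_affine_cart3[OF _ R, of _ c]) auto
  also have "\<dots> \<le> ennreal (R ^ 3) * ennreal 64" by (intro mult_left_mono base) auto
  also have "\<dots> = ennreal (64 * R ^ 3)" using R by (subst ennreal_mult[symmetric]) (auto simp: mult.commute)
  finally show ?thesis .
qed

lemma spread_weight_pos: "R > 0 \<Longrightarrow> 0 < spread_weight R x"
  unfolding spread_weight_def by (auto intro!: add_pos_nonneg simp: powr_gt_zero) (metis add_pos_nonneg divide_nonneg_pos less_irrefl norm_ge_zero zero_less_one)

text \<open>Peetre's inequality, from \<open>1 + \<bar>x\<bar> / R \<le> (1 + \<bar>c\<bar> / R) (1 + \<bar>x - c\<bar> / R)\<close>.\<close>

lemma spread_weight_submult:
  assumes R: "R > 0"
  shows "spread_weight R c \<le> spread_weight R x * (1 + norm (x - c) / R) powr 20"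
proof -
  define A where "A = 1 + norm c / R"
  define B where "B = 1 + norm (x - c) / R"
  have AB: "A > 0" "B > 0" using R by (auto simp: A_def B_def intro!: add_pos_nonneg)
  have "1 + norm x / R \<le> 1 + (norm c + norm (x - c)) / R"
    using R norm_triangle_ineq[of c "x - c"] by (intro add_left_mono divide_right_mono) auto
  also have "\<dots> \<le> A * B"
    using R by (simp add: A_def B_def algebra_simps add_divide_distrib)
  finally have "1 + norm x / R \<le> A * B" .
  then have "(A * B) powr (-20) \<le> (1 + norm x / R) powr (-20)"
    using R by (intro powr_mono2') (auto intro!: add_pos_nonneg)
  then have "(A * B) powr (-20) * B powr 20 \<le> (1 + norm x / R) powr (-20) * B powr 20"
    by (intro mult_right_mono) auto
  moreover have "(A * B) powr (-20) * B powr 20 = A powr (-20)"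
  proof -
    have "B powr (-20) * B powr 20 = 1"
      unfolding powr_add[symmetric] using AB by simp
    then show ?thesis by (simp only: powr_mult mult.assoc mult_1_right)
  qed
  ultimately show ?thesis by (simp add: spread_weight_def A_def B_def)
qed

lemma spread_weight_lower:
  assumes R: "R > 0" and "norm (x - c) < R"
  shows "spread_weight R x \<le> 2 ^ 20 * spread_weight R c"
proof -
  have "spread_weight R x \<le> spread_weight R c * (1 + norm (c - x) / R) powr 20"
    by (rule spread_weight_submult[OF R])
  also have "\<dots> \<le> spread_weight R c * 2 powr 20"
    using assms spread_weight_pos[OF R, of c]
    by (intro mult_left_mono powr_mono2) (auto simp: norm_minus_commute)
  finally show ?thesis by simp
qed

lemma nn_integral_spread_weight_ball_weight_le:
  assumes R: "R > 0"
  shows "(\<integral>\<^sup>+c. ennreal (spread_weight R c * ball_weight c R x) \<partial>lborel) \<le> ennreal (64 * R ^ 3) * ennreal (spread_weight R x)"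
proof -
  have "spread_weight R c * ball_weight c R x \<le> spread_weight R x * (1 + norm (c - x) / R) powr (-80)" for c
  proof -
    have "spread_weight R c * ball_weight c R x \<le> (spread_weight R x * (1 + norm (x - c) / R) powr 20) * ball_weight c R x"
      by (intro mult_right_mono spread_weight_submult R) (auto simp: ball_weight_def)
    also have "\<dots> = spread_weight R x * (1 + norm (c - x) / R) powr (-80)"
      by (simp add: ball_weight_def mult.assoc powr_add[symmetric] norm_minus_commute)
    finally show ?thesis .
  qed
  then have "(\<integral>\<^sup>+c. ennreal (spread_weight R c * ball_weight c R x) \<partial>lborel)
     \<le> (\<integral>\<^sup>+c. ennreal (spread_weight R x) * ennreal ((1 + norm (c - x) / R) powr (-80)) \<partial>lborel)"
    using spread_weight_pos[OF R, of x]
    by (intro nn_integral_mono) (auto simp: ennreal_mult[symmetric] intro!: ennreal_leI)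
  also have "\<dots> = ennreal (spread_weight R x) * (\<integral>\<^sup>+c. ennreal ((1 + norm (c - x) / R) powr (-80)) \<partial>lborel)"
    by (rule nn_integral_cmult) measurable
  also have "\<dots> \<le> ennreal (spread_weight R x) * ennreal (64 * R ^ 3)"
    by (intro mult_left_mono nn_integral_decay_cart3_le R) auto
  finally show ?thesis by (simp add: mult.commute)
qed

lemma nn_integral_spread_weight_ball_ge:
  assumes R: "R > 0"
  shows "ennreal (R ^ 3) * ennreal (spread_weight R x) \<le> 2 ^ 20 * (\<integral>\<^sup>+c. ennreal (spread_weight R c) * indicator (ball c R) x \<partial>lborel)"
proof -
  have "R ^ 3 \<le> unit_ball_vol 3 * R ^ 3"
    using R pi_gt3 by (simp add: unit_ball_vol_3)
  then have "ennreal (R ^ 3) \<le> emeasure lborel (ball x R)"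
    using R by (simp add: emeasure_ball ennreal_leI)
  then have "ennreal (R ^ 3) * ennreal (spread_weight R x) \<le> emeasure lborel (ball x R) * ennreal (spread_weight R x)"
    by (intro mult_right_mono) auto
  also have "\<dots> = (\<integral>\<^sup>+c. ennreal (spread_weight R x) * indicator (ball x R) c \<partial>lborel)"
    by (simp add: nn_integral_cmult_indicator mult.commute)
  also have "\<dots> \<le> (\<integral>\<^sup>+c. 2 ^ 20 * (ennreal (spread_weight R c) * indicator (ball c R) x) \<partial>lborel)"
  proof (intro nn_integral_mono)
    fix c :: "real ^ 3"
    show "ennreal (spread_weight R x) * indicator (ball x R) c \<le> 2 ^ 20 * (ennreal (spread_weight R c) * indicator (ball c R) x)"
    proof (cases "c \<in> ball x R")
      case True
      then have d: "norm (x - c) < R" "x \<in> ball c R" by (auto simp: dist_norm norm_minus_commute)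
      have "ennreal (spread_weight R x) \<le> ennreal (2 ^ 20 * spread_weight R c)"
        by (intro ennreal_leI spread_weight_lower[OF R d(1)])
      also have "\<dots> = 2 ^ 20 * ennreal (spread_weight R c)"
        by (simp add: ennreal_mult' ennreal_power flip: ennreal_numeral)
      finally show ?thesis using True d by simp
    qed simp
  qed
  also have "\<dots> = 2 ^ 20 * (\<integral>\<^sup>+c. ennreal (spread_weight R c) * indicator (ball c R) x \<partial>lborel)"
  proof (rule nn_integral_cmult)
    have "(\<lambda>c. indicator (ball c R) x :: ennreal) = indicator (ball x R)"
      by (auto simp: indicator_def dist_commute fun_eq_iff)
    moreover have "ball x R \<in> sets borel" by simp
    ultimately have [measurable]: "(\<lambda>c. indicator (ball c R) x :: ennreal) \<in> borel_measurable lborel"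
      by (simp only: borel_measurable_indicator sets_lborel)
    show "(\<lambda>c. ennreal (spread_weight R c) * indicator (ball c R) x) \<in> borel_measurable lborel"
      by measurable
  qed
  finally show ?thesis .
qed

lemma measurable_pred_ball [measurable (raw)]:
  fixes f g :: "'a \<Rightarrow> 'b::euclidean_space"
  assumes [measurable]: "f \<in> borel_measurable M" "g \<in> borel_measurable M"
  shows "Measurable.pred M (\<lambda>w. f w \<in> ball (g w) r)"
  unfolding mem_ball by measurable

text \<open>A local estimate with balls on the left and ball weights on the right is integrated over all
centres \<open>c\<close> against \<open>spread_weight\<close>. Both sides then carry this weight, up to constants: on the left
it is nearly constant on balls of radius \<open>R\<close>, on the right it is reproduced by averaging.\<close>

lemma local_to_weighted:
  fixes f D :: "real ^ 3 \<Rightarrow> real"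
  assumes R: "R > 0" and f [measurable]: "f \<in> borel_measurable borel" and D [measurable]: "D \<in> borel_measurable borel"
    and nn: "\<And>x. 0 \<le> f x" "\<And>x. 0 \<le> D x"
    and loc: "\<And>c. (\<integral>\<^sup>+x\<in>ball c R. ennreal (f x) \<partial>lborel) \<le> (\<integral>\<^sup>+x. ennreal (ball_weight c R x * D x) \<partial>lborel)"
  shows "(\<integral>\<^sup>+x. ennreal (f x * spread_weight R x) \<partial>lborel) \<le> 2 ^ 26 * (\<integral>\<^sup>+x. ennreal (D x * spread_weight R x) \<partial>lborel)"
proof -
  have Rp: "ennreal (R ^ 3) \<noteq> 0" "ennreal (R ^ 3) \<noteq> \<infinity>" using R by auto
  have sw0: "0 \<le> spread_weight R x" for x using spread_weight_pos[OF R, of x] by simp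
  have bw0: "0 \<le> ball_weight c R x" for c x by (simp add: ball_weight_def)
  have "ennreal (R ^ 3) * (\<integral>\<^sup>+x. ennreal (f x * spread_weight R x) \<partial>lborel)
      = (\<integral>\<^sup>+x. ennreal (f x) * (ennreal (R ^ 3) * ennreal (spread_weight R x)) \<partial>lborel)"
    by (subst nn_integral_cmult[symmetric]) (auto simp: ennreal_mult nn sw0 mult_ac)
  also have "\<dots> \<le> (\<integral>\<^sup>+x. ennreal (f x) * (2 ^ 20 * (\<integral>\<^sup>+c. ennreal (spread_weight R c) * indicator (ball c R) x \<partial>lborel)) \<partial>lborel)"
    by (intro nn_integral_mono mult_left_mono nn_integral_spread_weight_ball_ge R) auto
  also have "\<dots> = (\<integral>\<^sup>+x. 2 ^ 20 * (\<integral>\<^sup>+c. ennreal (spread_weight R c) * (ennreal (f x) * indicator (ball c R) x) \<partial>lborel) \<partial>lborel)"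
  proof (intro nn_integral_cong)
    fix x :: "real ^ 3"
    have "(\<lambda>c. indicator (ball c R) x :: ennreal) = indicator (ball x R)"
      by (auto simp: indicator_def dist_commute fun_eq_iff)
    moreover have "ball x R \<in> sets borel" by simp
    ultimately have [measurable]: "(\<lambda>c. indicator (ball c R) x :: ennreal) \<in> borel_measurable lborel"
      by (simp only: borel_measurable_indicator sets_lborel)
    show "ennreal (f x) * (2 ^ 20 * (\<integral>\<^sup>+c. ennreal (spread_weight R c) * indicator (ball c R) x \<partial>lborel))
      = 2 ^ 20 * (\<integral>\<^sup>+c. ennreal (spread_weight R c) * (ennreal (f x) * indicator (ball c R) x) \<partial>lborel)"
    proof -
      have "(\<integral>\<^sup>+c. ennreal (spread_weight R c) * (ennreal (f x) * indicator (ball c R) x) \<partial>lborel)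
        = (\<integral>\<^sup>+c. ennreal (f x) * (ennreal (spread_weight R c) * indicator (ball c R) x) \<partial>lborel)"
        by (intro nn_integral_cong mult.left_commute)
      also have "\<dots> = ennreal (f x) * (\<integral>\<^sup>+c. ennreal (spread_weight R c) * indicator (ball c R) x \<partial>lborel)"
        by (rule nn_integral_cmult) measurable
      finally show ?thesis by (simp only: mult.left_commute)
    qed
  qed
  also have "\<dots> = 2 ^ 20 * (\<integral>\<^sup>+x. (\<integral>\<^sup>+c. ennreal (spread_weight R c) * (ennreal (f x) * indicator (ball c R) x) \<partial>lborel) \<partial>lborel)"
    by (rule nn_integral_cmult) measurable
  also have "(\<integral>\<^sup>+x. (\<integral>\<^sup>+c. ennreal (spread_weight R c) * (ennreal (f x) * indicator (ball c R) x) \<partial>lborel) \<partial>lborel)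
      = (\<integral>\<^sup>+c. (\<integral>\<^sup>+x. ennreal (spread_weight R c) * (ennreal (f x) * indicator (ball c R) x) \<partial>lborel) \<partial>lborel)"
    by (rule lborel_pair.Fubini') (unfold case_prod_unfold, measurable)
  also have "\<dots> = (\<integral>\<^sup>+c. ennreal (spread_weight R c) * (\<integral>\<^sup>+x\<in>ball c R. ennreal (f x) \<partial>lborel) \<partial>lborel)"
    by (intro nn_integral_cong nn_integral_cmult) measurable
  also have "\<dots> \<le> (\<integral>\<^sup>+c. ennreal (spread_weight R c) * (\<integral>\<^sup>+x. ennreal (ball_weight c R x * D x) \<partial>lborel) \<partial>lborel)"
    by (intro nn_integral_mono mult_left_mono loc) auto
  also have "\<dots> = (\<integral>\<^sup>+c. (\<integral>\<^sup>+x. ennreal (D x) * ennreal (spread_weight R c * ball_weight c R x) \<partial>lborel) \<partial>lborel)"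
    by (intro nn_integral_cong, subst nn_integral_cmult[symmetric])
       (auto simp: ennreal_mult nn sw0 bw0 mult_ac)
  also have "\<dots> = (\<integral>\<^sup>+x. (\<integral>\<^sup>+c. ennreal (D x) * ennreal (spread_weight R c * ball_weight c R x) \<partial>lborel) \<partial>lborel)"
    by (rule lborel_pair.Fubini') (unfold case_prod_unfold, measurable)
  also have "\<dots> = (\<integral>\<^sup>+x. ennreal (D x) * (\<integral>\<^sup>+c. ennreal (spread_weight R c * ball_weight c R x) \<partial>lborel) \<partial>lborel)"
  proof (intro nn_integral_cong nn_integral_cmult)
    show "(\<lambda>c. ennreal (spread_weight R c * ball_weight c R x)) \<in> borel_measurable lborel" for x
      unfolding ball_weight_def by measurable
  qed
  also have "\<dots> \<le> (\<integral>\<^sup>+x. ennreal (D x) * (ennreal (64 * R ^ 3) * ennreal (spread_weight R x)) \<partial>lborel)"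
    by (intro nn_integral_mono mult_left_mono nn_integral_spread_weight_ball_weight_le R) auto
  also have "\<dots> = ennreal (64 * R ^ 3) * (\<integral>\<^sup>+x. ennreal (D x * spread_weight R x) \<partial>lborel)"
    by (subst nn_integral_cmult[symmetric]) (auto simp: ennreal_mult nn sw0 mult_ac)
  also have "ennreal (64 * R ^ 3) = 64 * ennreal (R ^ 3)" using R by (simp add: ennreal_mult)
  finally have "ennreal (R ^ 3) * (\<integral>\<^sup>+x. ennreal (f x * spread_weight R x) \<partial>lborel)
     \<le> 2 ^ 20 * (64 * ennreal (R ^ 3) * (\<integral>\<^sup>+x. ennreal (D x * spread_weight R x) \<partial>lborel))"
    by (simp add: mult_left_mono)
  also have "\<dots> = ennreal (R ^ 3) * ((2 ^ 20 * 64) * (\<integral>\<^sup>+x. ennreal (D x * spread_weight R x) \<partial>lborel))"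
    by (simp only: mult_ac)
  also have "(2 ^ 20 * 64 :: ennreal) = 2 ^ 26" by simp
  finally show ?thesis using Rp by (subst (asm) ennreal_mult_le_mult_iff) auto
qed

section \<open>The estimate for step functions\<close>

lemma integrable_unit_square_bounded:
  fixes F :: "real ^ 2 \<Rightarrow> complex"
  assumes [measurable]: "F \<in> borel_measurable borel" and B: "\<And>\<xi>. norm (F \<xi>) \<le> B"
  shows "integrable (lebesgue_on unit_square) F"
proof -
  have "integrable lborel (\<lambda>\<xi>. indicator unit_square \<xi> *\<^sub>R F \<xi>)"
    by (intro integrableI_bounded_set_indicator[where B=B])
       (auto simp: B unit_square_def emeasure_lborel_cbox_eq)
  then have "integrable lebesgue (\<lambda>\<xi>. indicator unit_square \<xi> *\<^sub>R F \<xi>)"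
    by (subst integrable_completion) (auto simp: unit_square_def)
  then show ?thesis
    by (subst integrable_restrict_space) (auto simp: unit_square_def)
qed

lemma norm_packet_sum_le:
  assumes "\<And>q. q \<in> grid N \<Longrightarrow> norm (a q) \<le> 1"
  shows "norm (packet_sum N a x) \<le> (real N)\<^sup>2"
proof -
  have "norm (a q * cell_packet N q x) \<le> 1" if "q \<in> grid N" for q
    using mult_mono[OF assms[OF that] norm_cell_packet_le_1] by (simp add: norm_mult)
  then have "norm (packet_sum N a x) \<le> (\<Sum>q\<in>grid N. 1)"
    unfolding packet_sum_def by (intro sum_norm_le)
  then show ?thesis by (simp add: card_grid)
qed

text \<open>The left side of the decoupling inequality is the same for all partitions, so the right side may be
averaged over the random ones. Here \<open>C\<close> is the full decoupling constant, and \<open>S\<close> the square function.\<close>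

lemma averaged_decoupling:
  fixes N M :: nat and p C :: real
  assumes N: "N > 0" and M: "M > 0" "M dvd N\<^sup>2" and p: "2 \<le> p" "p \<le> 4" and C: "C \<ge> 0"
    and a: "\<And>q. q \<in> grid N \<Longrightarrow> norm (a q) \<le> 1"
  defines "L \<equiv> N\<^sup>2 div M" and "R \<equiv> (real N)\<^sup>2"
    and "S \<equiv> \<lambda>x. \<Sum>q\<in>grid N. (norm (a q * cell_packet N q x))\<^sup>2"
  assumes decoupling: "\<And>F P. integrable (lebesgue_on unit_square) F \<Longrightarrow> M_set_partition (N\<^sup>2) M P \<Longrightarrow>
      Lp_norm p (lebesgue_on (ball c R)) (extension unit_square F) powr p
        \<le> C * (\<Sum>j = 1..L. Lp_norm p (weighted_ball c R) (extension (\<Union>(P j)) F) powr p)"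
  shows "(\<integral>\<^sup>+x\<in>ball c R. ennreal (norm (packet_sum N a x) powr p) \<partial>lborel)
    \<le> (\<integral>\<^sup>+x. ennreal (ball_weight c R x *
         (C * (80 * (real L powr (1 - p) * norm (packet_sum N a x) powr p + S x + real L powr (1 - p / 2) * S x powr (p / 2))))) \<partial>lborel)"
proof -
  have L: "L > 0" unfolding L_def using N M by (auto simp: div_greater_zero_iff dvd_imp_le)
  have MLN: "M * L = N\<^sup>2" unfolding L_def using M by simp
  obtain e where e: "bij_betw e ({..<M} \<times> {..<L}) (grid N)"
    using finite_same_card_bij[of "{..<M} \<times> {..<L}" "grid N"] by (auto simp: card_grid MLN)
  define E where "E = PiE {..<M} (\<lambda>_::nat. {..<L})"
  have cardE: "card E = L ^ M" unfolding E_def by (simp add: card_PiE)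
  define F where "F = step_function N a"
  define b where "b q x = a q * cell_packet N q x" for q x
  have [measurable]: "b q \<in> borel_measurable borel" for q unfolding b_def by measurable
  note measurable_packet_sum[measurable]
  have bw0: "0 \<le> ball_weight c R x" for x by (simp add: ball_weight_def)
  have b1: "norm (b q x) \<le> 1" if "q \<in> grid N" for q x
    using mult_mono[OF a[OF that] norm_cell_packet_le_1[of N q x]] by (simp add: norm_mult b_def)
  have psum: "packet_sum N a x = (\<Sum>q\<in>grid N. b q x)" for x by (simp add: packet_sum_def b_def)
  have extF: "extension unit_square F = packet_sum N a"
    using extension_step_function[OF N order_refl a] unit_square_eq_Union_cell[OF N]
    by (auto simp: F_def packet_sum_def fun_eq_iff)
  define f where "f s j x = (\<Sum>q\<in>selection e M L s j. b q x)" for s j x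
  have sel_sub: "selection e M L s j \<subseteq> grid N" for s j by (rule selection_subset[OF e L])
  have extP: "extension (\<Union>(cell N ` selection e M L s j)) F = f s j" for s j
    using extension_step_function[OF N sel_sub a] by (auto simp: F_def f_def b_def fun_eq_iff)
  have [measurable]: "f s j \<in> borel_measurable borel" for s j unfolding f_def by measurable
  define X where "X = (\<integral>\<^sup>+x\<in>ball c R. ennreal (norm (packet_sum N a x) powr p) \<partial>lborel)"
  define W where "W s j = (\<integral>\<^sup>+x. ennreal (ball_weight c R x * norm (f s j x) powr p) \<partial>lborel)" for s j
  have step: "X \<le> ennreal C * (\<Sum>j=1..L. W s j)" for s
  proof -
    have "M_set_partition (N\<^sup>2) M (\<lambda>j. cell N ` selection e M L s j)"
      using M_set_partition_selection[OF N M, of e s] e by (simp add: L_def)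
    moreover have "integrable (lebesgue_on unit_square) F"
      unfolding F_def by (rule integrable_unit_square_bounded[OF _ norm_step_function_le[OF a]]) auto
    ultimately have "Lp_norm p (lebesgue_on (ball c R)) (packet_sum N a) powr p
        \<le> C * (\<Sum>j = 1..L. Lp_norm p (weighted_ball c R) (f s j) powr p)"
      using decoupling[of F "\<lambda>j. cell N ` selection e M L s j"] unfolding extF extP by simp
    then have "ennreal (Lp_norm p (lebesgue_on (ball c R)) (packet_sum N a) powr p)
        \<le> ennreal (C * (\<Sum>j = 1..L. Lp_norm p (weighted_ball c R) (f s j) powr p))"
      by (rule ennreal_leI)
    also have "\<dots> = ennreal C * (\<Sum>j=1..L. ennreal (Lp_norm p (weighted_ball c R) (f s j) powr p))"
      using C by (simp add: ennreal_mult sum_nonneg sum_ennreal)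
    also have "\<dots> \<le> ennreal C * (\<Sum>j=1..L. W s j)"
      unfolding W_def using p by (intro mult_left_mono sum_mono Lp_norm_weighted_ball_powr_le) auto
    finally show ?thesis
      using Lp_norm_ball_powr[of p "packet_sum N a" "(real N)\<^sup>2" c R] p norm_packet_sum_le[OF a] measurable_packet_sum
      by (simp add: X_def Lp_mass_def)
  qed
  define D where "D x = 80 * (real L powr (1 - p) * norm (packet_sum N a x) powr p + S x + real L powr (1 - p / 2) * S x powr (p / 2))" for x
  have S0: "0 \<le> S x" for x unfolding S_def by (intro sum_nonneg) auto
  have D0: "0 \<le> D x" for x unfolding D_def using S0 by (intro mult_nonneg_nonneg add_nonneg_nonneg) auto
  have [measurable]: "S \<in> borel_measurable borel" unfolding S_def by measurable
  have [measurable]: "D \<in> borel_measurable borel" unfolding D_def by measurable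
  \<comment> \<open>Summation over all \<open>s\<close>; the factor \<open>L ^ M\<close>, the number of terms, is cancelled in the end.\<close>
  have "ennreal (real L ^ M) * X = (\<Sum>s\<in>E. X)" by (simp add: cardE ennreal_of_nat_eq_real_of_nat)
  also have "\<dots> \<le> (\<Sum>s\<in>E. ennreal C * (\<Sum>j=1..L. W s j))" by (intro sum_mono step)
  also have "\<dots> = ennreal C * (\<Sum>s\<in>E. \<Sum>j=1..L. W s j)" by (simp add: sum_distrib_left)
  also have "(\<Sum>s\<in>E. \<Sum>j=1..L. W s j)
     = (\<integral>\<^sup>+x. (\<Sum>s\<in>E. \<Sum>j=1..L. ennreal (ball_weight c R x * norm (f s j x) powr p)) \<partial>lborel)"
    unfolding W_def by (simp add: nn_integral_sum)
  also have "\<dots> \<le> (\<integral>\<^sup>+x. ennreal (real L ^ M) * ennreal (ball_weight c R x * D x) \<partial>lborel)"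
  proof (intro nn_integral_mono)
    fix x
    have "(\<Sum>s\<in>E. \<Sum>j=1..L. ball_weight c R x * norm (f s j x) powr p)
       = ball_weight c R x * (\<Sum>s\<in>E. \<Sum>j=1..L. norm (f s j x) powr p)"
      by (simp add: sum_distrib_left)
    also have "\<dots> \<le> ball_weight c R x * (real L ^ M * D x)"
      using average_over_selections[where b="\<lambda>q. b q x", OF e L p b1] bw0[of x]
      unfolding E_def D_def f_def psum S_def b_def by (intro mult_left_mono) auto
    finally have "ennreal (\<Sum>s\<in>E. \<Sum>j=1..L. ball_weight c R x * norm (f s j x) powr p)
       \<le> ennreal (real L ^ M * (ball_weight c R x * D x))"
      by (intro ennreal_leI) (simp add: mult_ac)
    also have "\<dots> = ennreal (real L ^ M) * ennreal (ball_weight c R x * D x)"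
      by (rule ennreal_mult) (auto intro!: mult_nonneg_nonneg bw0 D0)
    finally show "(\<Sum>s\<in>E. \<Sum>j=1..L. ennreal (ball_weight c R x * norm (f s j x) powr p))
      \<le> ennreal (real L ^ M) * ennreal (ball_weight c R x * D x)"
      by (simp add: sum_ennreal sum_nonneg bw0)
  qed
  also have "\<dots> = ennreal (real L ^ M) * (\<integral>\<^sup>+x. ennreal (ball_weight c R x * D x) \<partial>lborel)"
    by (rule nn_integral_cmult) measurable
  finally have "ennreal (real L ^ M) * X \<le> ennreal (real L ^ M) * (ennreal C * (\<integral>\<^sup>+x. ennreal (ball_weight c R x * D x) \<partial>lborel))"
    by (simp add: mult_left_mono mult.left_commute)
  then have "X \<le> ennreal C * (\<integral>\<^sup>+x. ennreal (ball_weight c R x * D x) \<partial>lborel)"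
    using L by (subst (asm) ennreal_mult_le_mult_iff) auto
  also have "\<dots> = (\<integral>\<^sup>+x. ennreal C * ennreal (ball_weight c R x * D x) \<partial>lborel)"
    by (rule nn_integral_cmult[symmetric]) measurable
  also have "\<dots> = (\<integral>\<^sup>+x. ennreal (ball_weight c R x * (C * D x)) \<partial>lborel)"
    by (intro nn_integral_cong, subst ennreal_mult[symmetric]) (auto simp: C bw0 D0 mult_ac)
  finally show ?thesis unfolding X_def D_def .
qed

text \<open>This is where \<open>p = 3\<close> separates two regimes: below it the power \<open>p / 2\<close> lies between 1 and \<open>3 / 2\<close>,
above it the surplus power is estimated by the trivial bound \<open>R\<close> for the square function.\<close>

lemma powr_half_le_three_halves:
  fixes T R p :: real
  assumes "0 \<le> T" "T \<le> R" "2 \<le> p" "p \<le> 4"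
  shows "T powr (p / 2) \<le> T + (1 + R powr ((p - 3) / 2)) * T powr (3 / 2)"
proof (cases "p \<le> 3")
  case True
  have "T powr (p / 2) \<le> T + T powr (3 / 2)"
  proof (cases "T \<le> 1")
    case True
    have "T powr (p / 2) \<le> T powr 1" using assms True by (intro powr_mono') auto
    then show ?thesis using assms by (simp add: add_increasing2)
  next
    case False
    have "T powr (p / 2) \<le> T powr (3 / 2)" using \<open>p \<le> 3\<close> False by (intro powr_mono) auto
    then show ?thesis using assms by (simp add: add_increasing)
  qed
  also have "\<dots> \<le> T + (1 + R powr ((p - 3) / 2)) * T powr (3 / 2)"
    by (simp add: distrib_right)
  finally show ?thesis .
next
  case False
  have "T powr (p / 2) = T powr ((p - 3) / 2) * T powr (3 / 2)"
    by (simp add: powr_add[symmetric] add_divide_distrib[symmetric])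
  also have "\<dots> \<le> R powr ((p - 3) / 2) * T powr (3 / 2)"
    using assms False by (intro mult_right_mono powr_mono2) auto
  also have "\<dots> \<le> T + (1 + R powr ((p - 3) / 2)) * T powr (3 / 2)"
    using assms by (simp add: distrib_right add_increasing)
  finally show ?thesis .
qed

text \<open>The averaged decoupling inequality is made global by \<open>local_to_weighted\<close>. Then \<open>f\<close> occurs with the same
weight on both sides, on the right with a coefficient that \<open>small\<close> forces to be at most \<open>1 / 2\<close>, and
\<open>bush_estimate\<close> bounds the rest.\<close>

lemma packet_sum_bound:
  fixes N M :: nat and p C :: real
  assumes N: "N > 0" and M: "M > 0" "M dvd N\<^sup>2" and p: "2 \<le> p" "p \<le> 4" and C: "C \<ge> 0"
    and a: "\<And>q. q \<in> grid N \<Longrightarrow> norm (a q) \<le> 1"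
  defines "L \<equiv> N\<^sup>2 div M" and "R \<equiv> (real N)\<^sup>2"
  assumes decoupling: "\<And>c F P. integrable (lebesgue_on unit_square) F \<Longrightarrow> M_set_partition (N\<^sup>2) M P \<Longrightarrow>
      Lp_norm p (lebesgue_on (ball c R)) (extension unit_square F) powr p
        \<le> C * real L powr (p / 2 - 1) * (\<Sum>j = 1..L. Lp_norm p (weighted_ball c R) (extension (\<Union>(P j)) F) powr p)"
    and small: "2 ^ 33 * C * real L powr (- (p / 2)) \<le> 1 / 2"
  shows "Lp_mass p (ball 0 N) (packet_sum N a)
     \<le> ennreal (2 ^ 74 * C * ln (2 * real N) * (R powr ((3 + p) / 2) + R ^ 3 * real L powr (p / 2 - 1)))"
proof -
  have L: "L > 0" unfolding L_def using N M by (auto simp: div_greater_zero_iff dvd_imp_le)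
  have R: "R > 0" "1 \<le> R" using N by (auto simp: R_def)
  note measurable_packet_sum[measurable]
  define T where "T x = (\<Sum>q\<in>grid N. (norm (cell_packet N q x))\<^sup>2)" for x
  define f where "f x = norm (packet_sum N a x) powr p" for x
  define k1 where "k1 = 80 * C * real L powr (- (p / 2))"
  define k2 where "k2 = 80 * C * (2 * real L powr (p / 2 - 1))"
  define k3 where "k3 = 80 * C * (1 + R powr ((p - 3) / 2))"
  define D where "D x = k1 * f x + k2 * T x powr 1 + k3 * T x powr (3 / 2)" for x
  have k0: "0 \<le> k1" "0 \<le> k2" "0 \<le> k3" using C by (auto simp: k1_def k2_def k3_def)
  have T0: "0 \<le> T x" for x unfolding T_def by (intro sum_nonneg) auto
  have TR: "T x \<le> R" for x
  proof -
    have "T x \<le> (\<Sum>q\<in>grid N. 1)"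
      unfolding T_def by (intro sum_mono) (simp add: power_le_one norm_cell_packet_le_1)
    then show ?thesis by (simp add: card_grid R_def)
  qed
  have f0: "0 \<le> f x" for x by (simp add: f_def)
  have D0: "0 \<le> D x" for x unfolding D_def using k0 f0 by (intro add_nonneg_nonneg mult_nonneg_nonneg) auto
  have [measurable]: "T \<in> borel_measurable borel" unfolding T_def by measurable
  have mf [measurable]: "f \<in> borel_measurable borel" unfolding f_def by measurable
  have mD [measurable]: "D \<in> borel_measurable borel" unfolding D_def by measurable
  have L1: "1 \<le> real L powr (p / 2 - 1)"
    using L p by (intro ge_one_powr_ge_zero) auto
  have loc: "(\<integral>\<^sup>+x\<in>ball c R. ennreal (f x) \<partial>lborel) \<le> (\<integral>\<^sup>+x. ennreal (ball_weight c R x * D x) \<partial>lborel)" for c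
  proof -
    define S where "S x = (\<Sum>q\<in>grid N. (norm (a q * cell_packet N q x))\<^sup>2)" for x
    have ST: "S x \<le> T x" for x
      unfolding S_def T_def
    proof (intro sum_mono power_mono)
      fix q assume "q \<in> grid N"
      then show "norm (a q * cell_packet N q x) \<le> norm (cell_packet N q x)"
        using mult_right_mono[OF a[of q], of "norm (cell_packet N q x)"] by (simp add: norm_mult)
    qed auto
    have S0: "0 \<le> S x" for x unfolding S_def by (intro sum_nonneg) auto
    have "(\<integral>\<^sup>+x\<in>ball c R. ennreal (f x) \<partial>lborel)
      \<le> (\<integral>\<^sup>+x. ennreal (ball_weight c R x * (C * real L powr (p / 2 - 1) *
         (80 * (real L powr (1 - p) * f x + S x + real L powr (1 - p / 2) * S x powr (p / 2))))) \<partial>lborel)"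
      unfolding f_def S_def L_def R_def
      by (rule averaged_decoupling[OF N M p _ a])
         (use C decoupling in \<open>auto simp: L_def R_def\<close>)
    also have "\<dots> \<le> (\<integral>\<^sup>+x. ennreal (ball_weight c R x * D x) \<partial>lborel)"
    proof (intro nn_integral_mono ennreal_leI mult_left_mono)
      fix x
      define A where "A = real L powr (p / 2 - 1)"
      have e1: "A * real L powr (1 - p) = real L powr (- (p / 2))"
        unfolding A_def powr_add[symmetric] by (simp add: field_simps)
      have e2: "A * real L powr (1 - p / 2) = 1"
        unfolding A_def powr_add[symmetric] using L by simp
      have "S x powr (p / 2) \<le> T x powr (p / 2)" using p S0 ST by (intro powr_mono2) auto
      also have "\<dots> \<le> T x + (1 + R powr ((p - 3) / 2)) * T x powr (3 / 2)"
        by (intro powr_half_le_three_halves T0 TR p)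
      finally have s2: "S x powr (p / 2) \<le> T x + (1 + R powr ((p - 3) / 2)) * T x powr (3 / 2)" .
      have s3: "A * S x \<le> A * T x" "T x \<le> A * T x"
        using ST[of x] T0[of x] L1 mult_right_mono[OF L1 T0[of x]] by (auto simp: A_def intro!: mult_left_mono)
      have "C * A * (80 * (real L powr (1 - p) * f x + S x + real L powr (1 - p / 2) * S x powr (p / 2)))
        = 80 * C * ((A * real L powr (1 - p)) * f x + A * S x + (A * real L powr (1 - p / 2)) * S x powr (p / 2))"
        by (simp add: algebra_simps)
      also have "\<dots> \<le> 80 * C * (real L powr (- (p / 2)) * f x + A * T x + (A * T x + (1 + R powr ((p - 3) / 2)) * T x powr (3 / 2)))"
      proof (rule mult_left_mono)
        show "(A * real L powr (1 - p)) * f x + A * S x + (A * real L powr (1 - p / 2)) * S x powr (p / 2)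
          \<le> real L powr (- (p / 2)) * f x + A * T x + (A * T x + (1 + R powr ((p - 3) / 2)) * T x powr (3 / 2))"
          unfolding e1 e2 using s2 s3 by linarith
      qed (use C in simp)
      also have "\<dots> = D x"
        using T0[of x] unfolding D_def k1_def k2_def k3_def A_def[symmetric] by (simp add: algebra_simps)
      finally show "C * real L powr (p / 2 - 1) * (80 * (real L powr (1 - p) * f x + S x + real L powr (1 - p / 2) * S x powr (p / 2))) \<le> D x"
        unfolding A_def .
    qed (simp add: ball_weight_def)
    finally show ?thesis .
  qed
  define \<A> where "\<A> = (\<integral>\<^sup>+x. ennreal (f x * spread_weight R x) \<partial>lborel)"
  define BE where "BE = 160000 * real N ^ 6 * ln (2 * real N)"
  have BE0: "0 \<le> BE" using N by (simp add: BE_def)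
  have sw0: "0 \<le> spread_weight R x" for x using spread_weight_pos[OF R(1), of x] by simp
  have "\<A> \<le> 2 ^ 26 * (\<integral>\<^sup>+x. ennreal (D x * spread_weight R x) \<partial>lborel)"
    unfolding \<A>_def by (rule local_to_weighted[OF R(1) mf mD f0 D0 loc])
  also have "(\<integral>\<^sup>+x. ennreal (D x * spread_weight R x) \<partial>lborel)
     = (\<integral>\<^sup>+x. ennreal k1 * ennreal (f x * spread_weight R x) + ennreal k2 * ennreal (T x powr 1 * spread_weight R x)
          + ennreal k3 * ennreal (T x powr (3 / 2) * spread_weight R x) \<partial>lborel)"
  proof (intro nn_integral_cong)
    fix x
    have "D x * spread_weight R x = k1 * (f x * spread_weight R x) + k2 * (T x powr 1 * spread_weight R x)
          + k3 * (T x powr (3 / 2) * spread_weight R x)"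
      by (simp add: D_def algebra_simps)
    then show "ennreal (D x * spread_weight R x) = ennreal k1 * ennreal (f x * spread_weight R x) + ennreal k2 * ennreal (T x powr 1 * spread_weight R x)
          + ennreal k3 * ennreal (T x powr (3 / 2) * spread_weight R x)"
      using k0 f0[of x] sw0[of x] by (simp add: ennreal_mult ennreal_plus del: powr_one)
  qed
  also have "\<dots> = ennreal k1 * \<A> + ennreal k2 * (\<integral>\<^sup>+x. ennreal (T x powr 1 * spread_weight R x) \<partial>lborel)
       + ennreal k3 * (\<integral>\<^sup>+x. ennreal (T x powr (3 / 2) * spread_weight R x) \<partial>lborel)"
    unfolding \<A>_def by (simp add: nn_integral_add nn_integral_cmult del: powr_one)
  also have "\<dots> \<le> ennreal k1 * \<A> + ennreal k2 * ennreal BE + ennreal k3 * ennreal BE"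
    using bush_estimate[OF N, of 1] bush_estimate[OF N, of "3 / 2"]
    unfolding T_def R_def BE_def by (intro add_mono mult_left_mono order_refl) auto
  finally have ineq: "\<A> \<le> 2 ^ 26 * (ennreal k1 * \<A> + ennreal k2 * ennreal BE + ennreal k3 * ennreal BE)"
    by (simp add: mult_left_mono)
  have "\<A> \<le> (\<integral>\<^sup>+x. ennreal (R powr p) * ennreal ((1 + norm (x - 0) / R) powr (-20)) \<partial>(lborel :: (real ^ 3) measure))"
    unfolding \<A>_def
  proof (intro nn_integral_mono)
    fix x
    have "f x \<le> R powr p"
      unfolding f_def R_def using p norm_packet_sum_le[OF a] by (intro powr_mono2) auto
    then have "f x * spread_weight R x \<le> R powr p * (1 + norm (x - 0) / R) powr (-20)"
      unfolding spread_weight_def by (simp add: mult_right_mono)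
    then show "ennreal (f x * spread_weight R x) \<le> ennreal (R powr p) * ennreal ((1 + norm (x - 0) / R) powr (-20))"
      by (simp add: ennreal_mult[symmetric] ennreal_leI)
  qed
  also have "\<dots> = ennreal (R powr p) * (\<integral>\<^sup>+x. ennreal ((1 + norm (x - 0 :: real ^ 3) / R) powr (-20)) \<partial>lborel)"
    by (rule nn_integral_cmult) measurable
  also have "\<dots> \<le> ennreal (R powr p) * ennreal (64 * R ^ 3)"
    by (intro mult_left_mono nn_integral_decay_cart3_le R) auto
  also have "\<dots> < \<infinity>" by (simp add: ennreal_mult_less_top)
  \<comment> \<open>Finiteness, which makes the absorption legitimate.\<close>
  finally obtain \<alpha> where \<alpha>: "\<A> = ennreal \<alpha>" "0 \<le> \<alpha>" by (cases \<A>) auto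
  have "ennreal \<alpha> \<le> ennreal (2 ^ 26 * (k1 * \<alpha> + k2 * BE + k3 * BE))"
  proof -
    have "ennreal (2 ^ 26 * (k1 * \<alpha> + k2 * BE + k3 * BE)) = ennreal (2 ^ 26) * (ennreal k1 * ennreal \<alpha> + ennreal k2 * ennreal BE + ennreal k3 * ennreal BE)"
      using k0 \<alpha>(2) BE0 by (simp add: ennreal_mult ennreal_plus distrib_left del: ennreal_numeral)
    also have "ennreal (2 ^ 26) = 2 ^ 26" by (simp flip: ennreal_numeral add: ennreal_power)
    finally show ?thesis using ineq unfolding \<alpha>(1) by simp
  qed
  then have "\<alpha> \<le> 2 ^ 26 * (k1 * \<alpha> + k2 * BE + k3 * BE)"
    using k0 \<alpha>(2) BE0 by (subst (asm) ennreal_le_iff) (auto intro!: add_nonneg_nonneg)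
  moreover have "2 ^ 26 * k1 * \<alpha> \<le> 1 / 2 * \<alpha>"
  proof (intro mult_right_mono \<alpha>(2))
    have "2 ^ 26 * k1 \<le> 2 ^ 33 * C * real L powr (- (p / 2))"
      using C by (simp add: k1_def mult_right_mono)
    then show "2 ^ 26 * k1 \<le> 1 / 2" using small by linarith
  qed
  ultimately have "\<alpha> \<le> 2 ^ 27 * ((k2 + k3) * BE)" by (simp add: algebra_simps)
  also have "\<dots> \<le> 2 ^ 54 * C * ln (2 * real N) * (R powr ((3 + p) / 2) + R ^ 3 * real L powr (p / 2 - 1))"
  proof -
    have RN: "real N ^ 6 = R ^ 3" by (simp add: R_def flip: power_mult)
    have RR: "R ^ 3 * R powr ((p - 3) / 2) = R powr ((3 + p) / 2)"
    proof -
      have "R ^ 3 = R powr 3" using R by simp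
      then have "R ^ 3 * R powr ((p - 3) / 2) = R powr (3 + (p - 3) / 2)"
        by (simp add: powr_add)
      also have "3 + (p - 3) / 2 = (3 + p) / 2" by (simp add: field_simps)
      finally show ?thesis .
    qed
    have "k2 + k3 \<le> 80 * C * (3 * (real L powr (p / 2 - 1) + R powr ((p - 3) / 2)))"
    proof -
      have "2 * real L powr (p / 2 - 1) + (1 + R powr ((p - 3) / 2)) \<le> 3 * (real L powr (p / 2 - 1) + R powr ((p - 3) / 2))"
      proof -
        have "2 * u + (1 + v) \<le> 3 * (u + v)" if "1 \<le> u" "0 \<le> v" for u v :: real
          using that by (simp add: algebra_simps)
        then show ?thesis using L1 powr_ge_zero by blast
      qed
      then show ?thesis
        unfolding k2_def k3_def distrib_left[symmetric] using C by (intro mult_left_mono) auto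
    qed
    then have "(k2 + k3) * BE \<le> 80 * C * (3 * (real L powr (p / 2 - 1) + R powr ((p - 3) / 2))) * BE"
      by (intro mult_right_mono BE0)
    also have "\<dots> = 38400000 * C * ln (2 * real N) * (R ^ 3 * R powr ((p - 3) / 2) + R ^ 3 * real L powr (p / 2 - 1))"
      by (simp add: BE_def RN algebra_simps)
    finally have "2 ^ 27 * ((k2 + k3) * BE) \<le> 2 ^ 27 * (38400000 * C * ln (2 * real N) * (R powr ((3 + p) / 2) + R ^ 3 * real L powr (p / 2 - 1)))"
      unfolding RR by (intro mult_left_mono) auto
    also have "\<dots> = (2 ^ 27 * 38400000) * (C * ln (2 * real N) * (R powr ((3 + p) / 2) + R ^ 3 * real L powr (p / 2 - 1)))"
      by simp
    also have "\<dots> \<le> 2 ^ 54 * (C * ln (2 * real N) * (R powr ((3 + p) / 2) + R ^ 3 * real L powr (p / 2 - 1)))"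
      using C N R by (intro mult_right_mono mult_nonneg_nonneg add_nonneg_nonneg) auto
    finally show ?thesis by (simp only: mult.assoc)
  qed
  finally have \<alpha>_le: "\<alpha> \<le> 2 ^ 54 * C * ln (2 * real N) * (R powr ((3 + p) / 2) + R ^ 3 * real L powr (p / 2 - 1))" .
  have "Lp_mass p (ball 0 N) (packet_sum N a) \<le> (\<integral>\<^sup>+x. ennreal (2 ^ 20) * ennreal (f x * spread_weight R x) \<partial>lborel)"
    unfolding Lp_mass_def
  proof (intro nn_integral_mono)
    fix x :: "real ^ 3"
    show "ennreal (norm (packet_sum N a x) powr p) * indicator (ball 0 N) x \<le> ennreal (2 ^ 20) * ennreal (f x * spread_weight R x)"
    proof (cases "x \<in> ball 0 N")
      case True
      have "real N * 1 \<le> real N * real N" using N by (intro mult_left_mono) auto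
      then have "norm (0 - x) < R" using True by (simp add: R_def power2_eq_square)
      then have "spread_weight R 0 \<le> 2 ^ 20 * spread_weight R x" by (rule spread_weight_lower[OF R(1)])
      then have "1 \<le> 2 ^ 20 * spread_weight R x" by (simp add: spread_weight_def)
      then have "f x * 1 \<le> f x * (2 ^ 20 * spread_weight R x)" by (intro mult_left_mono f0)
      then have "ennreal (f x) \<le> ennreal (2 ^ 20 * (f x * spread_weight R x))"
        by (intro ennreal_leI) (simp add: mult_ac)
      also have "\<dots> = ennreal (2 ^ 20) * ennreal (f x * spread_weight R x)"
        by (rule ennreal_mult) (auto intro!: mult_nonneg_nonneg f0 sw0)
      finally show ?thesis using True by (simp add: f_def)
    qed simp
  qed
  also have "\<dots> = ennreal (2 ^ 20) * \<A>"
    unfolding \<A>_def by (rule nn_integral_cmult) measurable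
  also have "\<dots> = ennreal (2 ^ 20 * \<alpha>)" unfolding \<alpha>(1) by (rule ennreal_mult[symmetric]) (use \<alpha>(2) in auto)
  also have "\<dots> \<le> ennreal (2 ^ 74 * C * ln (2 * real N) * (R powr ((3 + p) / 2) + R ^ 3 * real L powr (p / 2 - 1)))"
    using \<alpha>_le by (intro ennreal_leI) simp
  finally show ?thesis .
qed

section \<open>Arbitrary bounded functions\<close>

lemma Lp_mass_mono: "A \<subseteq> B \<Longrightarrow> Lp_mass p A f \<le> Lp_mass p B f"
  unfolding Lp_mass_def by (intro nn_integral_mono) (auto simp: indicator_def)

lemma measurable_extension:
  fixes N :: nat
  assumes N: "N > 0" and F [measurable]: "F \<in> borel_measurable borel" and B: "\<And>\<xi>. norm (F \<xi>) \<le> B"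
  shows "extension unit_square F \<in> borel_measurable borel"
proof -
  interpret U: prob_space "unit_measure :: (real ^ 2) measure" by (rule prob_space_unit_measure)
  have "(\<lambda>x. \<integral>u. expsum N (\<lambda>q. F (grid_point N q u) / (real N)\<^sup>2) (\<lambda>_. u) x \<partial>(unit_measure :: (real ^ 2) measure)) \<in> borel_measurable lborel"
    by (rule U.borel_measurable_lebesgue_integral) (unfold expsum_def case_prod_unfold, measurable)
  moreover have "extension unit_square F = (\<lambda>x. \<integral>u. expsum N (\<lambda>q. F (grid_point N q u) / (real N)\<^sup>2) (\<lambda>_. u) x \<partial>unit_measure)"
    using extension_eq_average[OF N F B] by auto
  ultimately show ?thesis by simp
qed

lemma norm_extension_le:
  fixes N :: nat
  assumes N: "N > 0" and F [measurable]: "F \<in> borel_measurable borel" and B: "\<And>\<xi>. norm (F \<xi>) \<le> (real N)\<^sup>2"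
  shows "norm (extension unit_square F x) \<le> (real N)\<^sup>2"
proof -
  have nrm: "norm (F (grid_point N q u) / (real N)\<^sup>2) \<le> 1" for q u
    using B[of "grid_point N q u"] N by (simp add: norm_divide norm_power)
  show ?thesis
    unfolding extension_eq_average[OF N F B]
  proof (rule norm_integral_unit_measure_le)
    show "(\<lambda>u. expsum N (\<lambda>q. F (grid_point N q u) / (real N)\<^sup>2) (\<lambda>_. u) x) \<in> borel_measurable borel"
      unfolding expsum_def by measurable
  qed (rule norm_expsum_le[OF nrm])
qed

text \<open>Translations of space are modulations of \<open>F\<close>, which do not change its size.\<close>

lemma extension_translate:
  "extension S F (v + y) = extension S (\<lambda>\<xi>. F \<xi> * char_e (lift_paraboloid \<xi> \<bullet> v)) y"
  by (simp add: extension_def inner_add_right char_e_add mult.assoc)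

lemma Lp_mass_translate:
  fixes f :: "real ^ 3 \<Rightarrow> complex"
  assumes [measurable]: "f \<in> borel_measurable borel"
  shows "Lp_mass p (ball v r) f = Lp_mass p (ball 0 r) (\<lambda>y. f (v + y))"
proof -
  have m: "(\<lambda>x. ennreal (norm (f x) powr p) * indicator (ball v r) x) \<in> borel_measurable borel"
    by measurable
  have "Lp_mass p (ball v r) f = (\<integral>\<^sup>+y. ennreal (norm (f (v + y)) powr p) * indicator (ball v r) (v + y) \<partial>lborel)"
    unfolding Lp_mass_def using nn_integral_affine_cart3[OF m, of 1 v] by simp
  also have "\<dots> = Lp_mass p (ball 0 r) (\<lambda>y. f (v + y))"
    unfolding Lp_mass_def by (intro nn_integral_cong) (auto simp: indicator_def dist_norm)
  finally show ?thesis .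
qed

lemma Lp_mass_cover:
  assumes [measurable]: "f \<in> borel_measurable borel" and "finite K" "A \<subseteq> (\<Union>k\<in>K. B k)" and B: "\<And>k. k \<in> K \<Longrightarrow> B k \<in> sets borel"
  shows "Lp_mass p A f \<le> (\<Sum>k\<in>K. Lp_mass p (B k) f)"
proof -
  have "Lp_mass p A f \<le> (\<integral>\<^sup>+x. (\<Sum>k\<in>K. ennreal (norm (f x) powr p) * indicator (B k) x) \<partial>lborel)"
    unfolding Lp_mass_def
  proof (intro nn_integral_mono)
    fix x
    show "ennreal (norm (f x) powr p) * indicator A x \<le> (\<Sum>k\<in>K. ennreal (norm (f x) powr p) * indicator (B k) x)"
    proof (cases "x \<in> A")
      case True
      then obtain k where k: "k \<in> K" "x \<in> B k" using assms by auto
      have "ennreal (norm (f x) powr p) * indicator (B k) x \<le> (\<Sum>k\<in>K. ennreal (norm (f x) powr p) * indicator (B k) x)"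
        using \<open>finite K\<close> k by (intro member_le_sum) auto
      then show ?thesis using k True by simp
    qed simp
  qed
  also have "\<dots> = (\<Sum>k\<in>K. Lp_mass p (B k) f)"
    unfolding Lp_mass_def using B by (intro nn_integral_sum) auto
  finally show ?thesis .
qed

text \<open>Replacing \<open>F\<close> by step functions works on balls of radius \<open>N / 1000\<close>. A ball of radius \<open>N\<close> is covered by a
fixed number of these, each of which can be moved to the origin.\<close>

lemma extension_mass_le:
  fixes N :: nat and c :: "real ^ 3" and K :: "(real ^ 3) set"
  assumes N: "N > 0" and p: "2 \<le> p" "p \<le> 4"
    and F [measurable]: "F \<in> borel_measurable borel" and B: "\<And>\<xi>. norm (F \<xi>) \<le> (real N)\<^sup>2"
    and K: "finite K" "cball 0 1 \<subseteq> (\<Union>k\<in>K. ball k (1 / 1000))"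
    and T: "\<And>a. (\<And>q. q \<in> grid N \<Longrightarrow> norm (a q) \<le> 1) \<Longrightarrow> Lp_mass p (ball 0 (real N)) (packet_sum N a) \<le> T"
  shows "Lp_mass p (ball c (real N)) (extension unit_square F) \<le> of_nat (card K) * (32 * T)"
proof -
  have small: "Lp_mass p (ball v (real N / 1000)) (extension unit_square F) \<le> 32 * T" for v
  proof -
    define F' where "F' \<xi> = F \<xi> * char_e (lift_paraboloid \<xi> \<bullet> v)" for \<xi>
    have [measurable]: "F' \<in> borel_measurable borel" unfolding F'_def by measurable
    have B': "norm (F' \<xi>) \<le> (real N)\<^sup>2" for \<xi> using B by (simp add: F'_def norm_mult)
    have "Lp_mass p (ball v (real N / 1000)) (extension unit_square F)
       = Lp_mass p (ball 0 (real N / 1000)) (\<lambda>y. extension unit_square F (v + y))"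
      by (rule Lp_mass_translate) (rule measurable_extension[OF N F B])
    also have "\<dots> = Lp_mass p (ball 0 (real N / 1000)) (extension unit_square F')"
      unfolding extension_translate F'_def ..
    also have "\<dots> \<le> worst_expsum p N (ball 0 (real N / 1000))"
      using p by (intro Lp_mass_extension_le_worst N B') auto
    also have "\<dots> \<le> 32 * T"
    proof (rule worst_expsum_le_packet_sum[OF N p])
      show "emeasure lborel (ball 0 (real N / 1000) :: (real ^ 3) set) < \<infinity>"
        by (rule emeasure_lborel_ball_finite)
      show "\<bar>x $ k\<bar> \<le> real N / 1000" if "x \<in> ball 0 (real N / 1000)" for x :: "real ^ 3" and k
        using that component_le_norm_cart[of x k] by simp
      show "Lp_mass p (ball 0 (real N / 1000)) (packet_sum N a) \<le> T"
        if "\<And>q. q \<in> grid N \<Longrightarrow> norm (a q) \<le> 1" for a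
        using order_trans[OF Lp_mass_mono T[OF that]] by (simp add: ball_subset_ball_iff)
    qed simp
    finally show ?thesis .
  qed
  have "ball c (real N) \<subseteq> (\<Union>k\<in>K. ball (c + real N *\<^sub>R k) (real N / 1000))"
  proof
    fix x assume x: "x \<in> ball c (real N)"
    have "(x - c) /\<^sub>R N \<in> cball 0 1"
    proof -
      have "norm ((x - c) /\<^sub>R N) = norm (x - c) / N"
        by (simp only: norm_scaleR) (simp add: divide_inverse mult.commute)
      then show ?thesis using x N by (simp add: dist_norm norm_minus_commute)
    qed
    then have "(x - c) /\<^sub>R N \<in> (\<Union>k\<in>K. ball k (1 / 1000))" using K(2) by blast
    then obtain k where k: "k \<in> K" "dist k ((x - c) /\<^sub>R N) < 1 / 1000"
      unfolding UN_iff mem_ball by blast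
    have "dist (c + real N *\<^sub>R k) x = N * dist k ((x - c) /\<^sub>R N)"
    proof -
      have "c + real N *\<^sub>R k - x = real N *\<^sub>R (k - (x - c) /\<^sub>R N)" using N by (simp add: algebra_simps)
      then show ?thesis by (simp add: dist_norm)
    qed
    also have "\<dots> < N * (1 / 1000)" using k N by (intro mult_strict_left_mono) auto
    finally show "x \<in> (\<Union>k\<in>K. ball (c + real N *\<^sub>R k) (real N / 1000))" using k by auto
  qed
  then have "Lp_mass p (ball c (real N)) (extension unit_square F) \<le> (\<Sum>k\<in>K. Lp_mass p (ball (c + real N *\<^sub>R k) (real N / 1000)) (extension unit_square F))"
    by (intro Lp_mass_cover measurable_extension[OF N F B] K) auto
  also have "\<dots> \<le> (\<Sum>k\<in>K. 32 * T)" by (intro sum_mono small)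
  finally show ?thesis by simp
qed

text \<open>Changing \<open>F\<close> on a null set of the unit square does not affect its extension; a Borel measurable
version bounded everywhere is needed for integrals over products.\<close>

lemma borel_representative:
  fixes F :: "real ^ 2 \<Rightarrow> complex"
  assumes F: "F \<in> borel_measurable (lebesgue_on unit_square)"
    and bound: "Linf_norm (lebesgue_on unit_square) F \<le> ereal r" and r: "0 \<le> r"
  obtains G where "G \<in> borel_measurable borel" "\<And>\<xi>. norm (G \<xi>) \<le> r"
    "extension unit_square F = extension unit_square G"
proof -
  have us: "unit_square \<in> sets lebesgue" by (simp add: unit_square_def)
  define F0 where "F0 \<xi> = indicator unit_square \<xi> *\<^sub>R F \<xi>" for \<xi>
  have F0 [measurable]: "F0 \<in> borel_measurable lebesgue"
    unfolding F0_def using F us by (subst (asm) borel_measurable_restrict_space_iff) auto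
  have Re: "(\<lambda>\<xi>. Re (F0 \<xi>)) \<in> borel_measurable lebesgue" and Im: "(\<lambda>\<xi>. Im (F0 \<xi>)) \<in> borel_measurable lebesgue"
    by measurable
  obtain g where [measurable]: "g \<in> borel_measurable lborel" and g: "AE \<xi> in lborel. Re (F0 \<xi>) = g \<xi>"
    using completion_ex_borel_measurable_real[OF Re] by blast
  obtain h where [measurable]: "h \<in> borel_measurable lborel" and h: "AE \<xi> in lborel. Im (F0 \<xi>) = h \<xi>"
    using completion_ex_borel_measurable_real[OF Im] by blast
  define G where "G \<xi> = (if norm (Complex (g \<xi>) (h \<xi>)) \<le> r then Complex (g \<xi>) (h \<xi>) else 0)" for \<xi>
  have C: "(\<lambda>\<xi>. Complex (g \<xi>) (h \<xi>)) = (\<lambda>\<xi>. of_real (g \<xi>) + \<i> * of_real (h \<xi>))"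
    by (simp add: complex_eq_iff fun_eq_iff)
  have [measurable]: "(\<lambda>\<xi>. Complex (g \<xi>) (h \<xi>)) \<in> borel_measurable borel" unfolding C by measurable
  have Gm: "G \<in> borel_measurable borel" unfolding G_def by measurable
  have Gr: "norm (G \<xi>) \<le> r" for \<xi> using r by (simp add: G_def)
  have "AE \<xi> in lebesgue_on unit_square. ereal (norm (F \<xi>)) \<le> ereal r"
    by (rule eventually_mono[OF esssup_AE]) (rule order_trans[OF _ bound[unfolded Linf_norm_def]])
  then have "AE \<xi> in lebesgue. \<xi> \<in> unit_square \<longrightarrow> norm (F \<xi>) \<le> r"
    using us by (subst (asm) AE_restrict_space_iff) auto
  moreover have "AE \<xi> in lebesgue. Re (F0 \<xi>) = g \<xi>" "AE \<xi> in lebesgue. Im (F0 \<xi>) = h \<xi>"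
    using g h AE_completion by blast+
  ultimately have ae: "AE \<xi> in lebesgue. indicator unit_square \<xi> *\<^sub>R F \<xi> = indicator unit_square \<xi> *\<^sub>R G \<xi>"
  proof eventually_elim
    case (elim \<xi>)
    show ?case
    proof (cases "\<xi> \<in> unit_square")
      case True
      then have "F \<xi> = Complex (g \<xi>) (h \<xi>)" using elim by (simp add: complex_eq_iff F0_def)
      then show ?thesis using elim True by (simp add: G_def)
    qed simp
  qed
  have "extension unit_square F x = extension unit_square G x" for x
  proof -
    have ph: "(\<lambda>\<xi>. char_e (lift_paraboloid \<xi> \<bullet> x)) \<in> borel_measurable lebesgue"
      by (rule measurable_completion) measurable
    have Gl: "(\<lambda>\<xi>. indicator unit_square \<xi> *\<^sub>R G \<xi>) \<in> borel_measurable lebesgue"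
      using Gm by (intro measurable_completion) (auto simp: unit_square_def)
    have "extension unit_square F x = (\<integral>\<xi>. F0 \<xi> * char_e (lift_paraboloid \<xi> \<bullet> x) \<partial>lebesgue)"
      unfolding extension_def set_lebesgue_integral_def F0_def by simp
    also have "\<dots> = (\<integral>\<xi>. (indicator unit_square \<xi> *\<^sub>R G \<xi>) * char_e (lift_paraboloid \<xi> \<bullet> x) \<partial>lebesgue)"
    proof (intro integral_cong_AE borel_measurable_times F0 ph Gl)
      show "AE \<xi> in lebesgue. F0 \<xi> * char_e (lift_paraboloid \<xi> \<bullet> x)
          = (indicator unit_square \<xi> *\<^sub>R G \<xi>) * char_e (lift_paraboloid \<xi> \<bullet> x)"
        using ae by eventually_elim (simp only: F0_def)
    qed
    also have "\<dots> = extension unit_square G x"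
      unfolding extension_def set_lebesgue_integral_def by simp
    finally show ?thesis .
  qed
  then show ?thesis using that[OF Gm Gr] by blast
qed

theorem theorem2p1:
  fixes \<gamma> p :: real
  assumes "0 < \<gamma>" and "\<gamma> \<le> 1" and "2 \<le> p" and "p \<le> 4"
    and decoupling: "\<forall>\<epsilon>>0. \<exists>C::real. \<forall>R M c F P.
      admissible \<gamma> R M \<longrightarrow>
      integrable (lebesgue_on unit_square) F \<longrightarrow>
      M_set_partition R M P \<longrightarrow>
      Lp_norm p (lebesgue_on (ball c (real R))) (extension unit_square F) powr p
        \<le> C * real R powr \<epsilon> * (real R / real M) powr (p / 2 - 1) *
          (\<Sum>j = 1..R div M.
             Lp_norm p (weighted_ball c (real R)) (extension (\<Union>(P j)) F) powr p)"
  shows "\<forall>\<epsilon>>0. \<exists>C'::real. \<forall>R M c F.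
      admissible \<gamma> R M \<longrightarrow>
      F \<in> borel_measurable (lebesgue_on unit_square) \<longrightarrow>
      Linf_norm (lebesgue_on unit_square) F \<le> ereal (real R) \<longrightarrow>
      (LINT x:ball c (sqrt (real R))|lebesgue. norm (extension unit_square F x) powr p)
        \<le> C' * real R powr \<epsilon> *
          (real R powr ((3 + p) / 2) + real R ^ 3 * (real R / real M) powr (p / 2 - 1))"
proof (intro allI impI)
  fix \<epsilon> :: real assume \<epsilon>: "\<epsilon> > 0"
  note p = assms(3,4)
  \<comment> \<open>Half of \<open>\<epsilon>\<close> is reserved for the logarithm; \<open>\<epsilon>' \<le> \<gamma> / 2\<close> keeps the mean term small.\<close>
  define \<epsilon>' where "\<epsilon>' = min (\<epsilon> / 2) (\<gamma> / 2)"
  have \<epsilon>': "\<epsilon>' > 0" "\<epsilon>' \<le> \<epsilon> / 2" "\<epsilon>' \<le> \<gamma> / 2" using \<epsilon> assms(1) by (auto simp: \<epsilon>'_def)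
  obtain C0 where C0: "\<And>R M c F P. admissible \<gamma> R M \<Longrightarrow>
      integrable (lebesgue_on unit_square) F \<Longrightarrow> M_set_partition R M P \<Longrightarrow>
      Lp_norm p (lebesgue_on (ball c (real R))) (extension unit_square F) powr p
        \<le> C0 * real R powr \<epsilon>' * (real R / real M) powr (p / 2 - 1) *
          (\<Sum>j = 1..R div M. Lp_norm p (weighted_ball c (real R)) (extension (\<Union>(P j)) F) powr p)"
    using decoupling \<epsilon>'(1) by meson
  define C1 where "C1 = max C0 1"
  have C1: "C1 \<ge> 1" "C0 \<le> C1" by (auto simp: C1_def)
  obtain K :: "(real ^ 3) set" where K: "finite K" "cball 0 1 \<subseteq> (\<Union>k\<in>K. ball k (1 / 1000))"
    using compact_cball[of "0 :: real ^ 3" 1, unfolded compact_eq_totally_bounded] by (metis zero_less_divide_1_iff zero_less_numeral)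
  \<comment> \<open>Above \<open>R0\<close> the mean term can be absorbed; below it the trivial bound gives a constant.\<close>
  define R0 where "R0 = (2 ^ 35 * C1) powr (2 / \<gamma>)"
  define Ca where "Ca = real (card K) * (32 * (2 ^ 74 * C1 * (2 powr \<epsilon> / \<epsilon>)))"
  define Cb where "Cb = R0 powr p * (unit_ball_vol 3 * R0 ^ 3)"
  have Ca0: "Ca \<ge> 0" using C1 \<epsilon> by (simp add: Ca_def)
  have Cb0: "Cb \<ge> 0" by (simp add: Cb_def R0_def)
  show "\<exists>C'::real. \<forall>R M c F.
      admissible \<gamma> R M \<longrightarrow>
      F \<in> borel_measurable (lebesgue_on unit_square) \<longrightarrow>
      Linf_norm (lebesgue_on unit_square) F \<le> ereal (real R) \<longrightarrow>
      (LINT x:ball c (sqrt (real R))|lebesgue. norm (extension unit_square F x) powr p)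
        \<le> C' * real R powr \<epsilon> *
          (real R powr ((3 + p) / 2) + real R ^ 3 * (real R / real M) powr (p / 2 - 1))"
  proof (rule exI[of _ "Ca + Cb"], intro allI impI)
    fix n M :: nat and c :: "real ^ 3" and F :: "real ^ 2 \<Rightarrow> complex"
    assume adm: "admissible \<gamma> n M" and F: "F \<in> borel_measurable (lebesgue_on unit_square)"
      and bound: "Linf_norm (lebesgue_on unit_square) F \<le> ereal (real n)"
    obtain N where N: "sqrt (real n) = real N" using adm by (auto simp: admissible_def Nats_def)
    have nN: "real n = (real N)\<^sup>2" using N by (metis of_nat_0_le_iff real_sqrt_pow2)
    then have nN': "n = N\<^sup>2" by (metis of_nat_eq_iff of_nat_power)
    have M: "M > 0" "M dvd N\<^sup>2" and n1: "n \<ge> 1" and Mle: "real M \<le> 2 * real n powr (1 - \<gamma>)"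
      using adm by (auto simp: admissible_def nN')
    have N0: "N > 0" using n1 nN' by (cases N) auto
    define R where "R = real n"
    have R1: "R \<ge> 1" using n1 by (simp add: R_def)
    have RN: "R = (real N)\<^sup>2" by (simp add: R_def nN)
    define L where "L = N\<^sup>2 div M"
    have L: "real L = R / real M" using M by (simp add: L_def RN real_of_nat_div)
    have L1: "L > 0" unfolding L_def using N0 M by (auto simp: div_greater_zero_iff dvd_imp_le)
    define Z where "Z = R powr ((3 + p) / 2) + R ^ 3 * real L powr (p / 2 - 1)"
    have Z1: "1 \<le> Z"
    proof -
      have "1 \<le> R powr ((3 + p) / 2)" using R1 p by (intro ge_one_powr_ge_zero) auto
      then show ?thesis using R1 by (simp add: Z_def add_increasing2)
    qed
    obtain G where G: "G \<in> borel_measurable borel" "\<And>\<xi>. norm (G \<xi>) \<le> (real N)\<^sup>2"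
      and FG: "extension unit_square F = extension unit_square G"
      using borel_representative[OF F bound] by (metis nN of_nat_0_le_iff)
    define I where "I = (LINT x:ball c (sqrt (real n))|lebesgue. norm (extension unit_square F x) powr p)"
    have I_le: "ennreal I \<le> Lp_mass p (ball c (real N)) (extension unit_square G)"
    proof -
      have "ennreal I \<le> (\<integral>\<^sup>+x. ennreal (indicator (ball c (real N)) x *\<^sub>R (norm (extension unit_square G x) powr p)) \<partial>lebesgue)"
        unfolding I_def set_lebesgue_integral_def FG N by (rule ennreal_integral_le_nn_integral) auto
      also have "\<dots> = (\<integral>\<^sup>+x. ennreal (indicator (ball c (real N)) x *\<^sub>R (norm (extension unit_square G x) powr p)) \<partial>lborel)"
        by (rule nn_integral_completion)
      also have "\<dots> = Lp_mass p (ball c (real N)) (extension unit_square G)"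
        unfolding Lp_mass_def by (intro nn_integral_cong) (auto simp: indicator_def)
      finally show ?thesis .
    qed
    have "I \<le> (Ca + Cb) * R powr \<epsilon> * Z"
    proof (cases "R \<le> R0")
      case True
      have "Lp_mass p (ball c (real N)) (extension unit_square G) \<le> (\<integral>\<^sup>+x. ennreal (R powr p) * indicator (ball c (real N)) x \<partial>lborel)"
        unfolding Lp_mass_def RN using p norm_extension_le[OF N0 G]
        by (intro nn_integral_mono mult_right_mono ennreal_leI powr_mono2) auto
      also have "\<dots> = ennreal (R powr p) * ennreal (unit_ball_vol 3 * real N ^ 3)"
        by (subst nn_integral_cmult_indicator) (auto simp: emeasure_ball)
      also have "\<dots> = ennreal (R powr p * (unit_ball_vol 3 * real N ^ 3))"
        by (subst ennreal_mult) auto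
      also have "\<dots> \<le> ennreal Cb"
      proof (rule ennreal_leI)
        have "real N * 1 \<le> real N * real N" using N0 by (intro mult_left_mono) auto
        then have "real N \<le> R0" using True by (simp add: RN power2_eq_square)
        then show "R powr p * (unit_ball_vol 3 * real N ^ 3) \<le> Cb"
          unfolding Cb_def using True R1 p
          by (intro mult_mono powr_mono2 mult_left_mono power_mono) auto
      qed
      finally have "I \<le> Cb" using I_le Cb0 order_trans ennreal_le_iff by meson
      also have "\<dots> \<le> (Ca + Cb) * 1 * 1" using Ca0 by simp
      also have "\<dots> \<le> (Ca + Cb) * R powr \<epsilon> * Z"
        using Ca0 Cb0 Z1 R1 \<epsilon> by (intro mult_mono ge_one_powr_ge_zero mult_nonneg_nonneg) auto
      finally show ?thesis .
    next
      case False
      define C where "C = C1 * R powr \<epsilon>'"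
      have C: "C \<ge> 0" using C1 by (simp add: C_def)
      have small: "2 ^ 33 * C * real L powr (- (p / 2)) \<le> 1 / 2"
      proof -
        \<comment> \<open>The upper bound on \<open>M\<close> gives \<open>M / R \<le> 2 R powr (- \<gamma>)\<close>.\<close>
        have "real L powr (- (p / 2)) \<le> real L powr (- 1)" using L1 p by (intro powr_mono) auto
        also have "\<dots> = real M / R" using L L1 R1 by (simp add: powr_minus_divide)
        also have "\<dots> \<le> 2 * R powr (1 - \<gamma>) / R" using Mle R1 by (intro divide_right_mono) (auto simp: R_def)
        also have "\<dots> = 2 * R powr (- \<gamma>)" using R1 by (simp add: powr_diff powr_minus_divide)
        finally have "2 ^ 33 * C * real L powr (- (p / 2)) \<le> 2 ^ 33 * C * (2 * R powr (- \<gamma>))"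
          using C by (intro mult_left_mono) auto
        also have "\<dots> = 2 ^ 34 * C1 * R powr (\<epsilon>' - \<gamma>)"
          by (simp add: C_def powr_add[symmetric] mult.assoc)
        also have "\<dots> \<le> 2 ^ 34 * C1 * R powr (- (\<gamma> / 2))"
          using \<epsilon>' C1 R1 by (intro mult_left_mono powr_mono) auto
        also have "\<dots> \<le> 1 / 2"
        proof -
          have "2 ^ 35 * C1 = R0 powr (\<gamma> / 2)"
            using assms(1) C1 by (simp add: R0_def powr_powr)
          also have "\<dots> \<le> R powr (\<gamma> / 2)"
            using False assms(1) by (intro powr_mono2) (auto simp: R0_def)
          finally have "2 ^ 35 * C1 * R powr (- (\<gamma> / 2)) \<le> R powr (\<gamma> / 2) * R powr (- (\<gamma> / 2))"
            by (intro mult_right_mono) auto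
          also have "\<dots> = 1" using R1 by (simp add: powr_add[symmetric])
          finally show ?thesis by simp
        qed
        finally show ?thesis .
      qed
      have dec: "Lp_norm p (lebesgue_on (ball v ((real N)\<^sup>2))) (extension unit_square H) powr p
        \<le> C * real (N\<^sup>2 div M) powr (p / 2 - 1) * (\<Sum>j = 1..N\<^sup>2 div M. Lp_norm p (weighted_ball v ((real N)\<^sup>2)) (extension (\<Union>(P j)) H) powr p)"
        if "integrable (lebesgue_on unit_square) H" "M_set_partition (N\<^sup>2) M P" for v H P
      proof -
        have "Lp_norm p (lebesgue_on (ball v ((real N)\<^sup>2))) (extension unit_square H) powr p
          \<le> C0 * R powr \<epsilon>' * real (N\<^sup>2 div M) powr (p / 2 - 1) *
             (\<Sum>j = 1..N\<^sup>2 div M. Lp_norm p (weighted_ball v ((real N)\<^sup>2)) (extension (\<Union>(P j)) H) powr p)"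
          using C0[OF adm that(1), of P v] that(2) L unfolding nN R_def L_def nN' by simp
        also have "\<dots> \<le> C * real (N\<^sup>2 div M) powr (p / 2 - 1) *
             (\<Sum>j = 1..N\<^sup>2 div M. Lp_norm p (weighted_ball v ((real N)\<^sup>2)) (extension (\<Union>(P j)) H) powr p)"
          unfolding C_def using C1 by (intro mult_right_mono) (auto intro!: sum_nonneg)
        finally show ?thesis .
      qed
      define T where "T = 2 ^ 74 * C * ln (2 * real N) * Z"
      have T0: "0 \<le> T" using C N0 Z1 by (simp add: T_def)
      have "Lp_mass p (ball 0 (real N)) (packet_sum N a) \<le> ennreal T"
        if "\<And>q. q \<in> grid N \<Longrightarrow> norm (a q) \<le> 1" for a
        using packet_sum_bound[OF N0 M p C that dec small[unfolded L_def]]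
        unfolding T_def Z_def RN L_def by simp
      then have "ennreal I \<le> of_nat (card K) * (32 * ennreal T)"
        using order_trans[OF I_le extension_mass_le[OF N0 p G K, of "ennreal T" c]] by blast
      also have "\<dots> = ennreal (real (card K) * (32 * T))"
        using T0 by (simp add: ennreal_mult ennreal_of_nat_eq_real_of_nat)
      finally have "I \<le> real (card K) * (32 * T)"
        using T0 by (subst (asm) ennreal_le_iff) auto
      also have "\<dots> \<le> Ca * R powr \<epsilon> * Z"
      proof -
        have "ln (2 * real N) \<le> (2 * real N) powr \<epsilon> / \<epsilon>"
          using N0 \<epsilon> by (intro ln_powr_bound) auto
        also have "(2 * real N) powr \<epsilon> = 2 powr \<epsilon> * R powr (\<epsilon> / 2)"
        proof -
          have "real N = R powr (1 / 2)" using N0 by (simp add: RN powr_half_sqrt)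
          then show ?thesis by (simp add: powr_mult powr_powr)
        qed
        finally have "C * ln (2 * real N) \<le> C * (2 powr \<epsilon> * R powr (\<epsilon> / 2) / \<epsilon>)"
          using C by (intro mult_left_mono)
        also have "\<dots> = C1 * (2 powr \<epsilon> / \<epsilon>) * R powr (\<epsilon>' + \<epsilon> / 2)"
          by (simp add: C_def powr_add)
        also have "\<dots> \<le> C1 * (2 powr \<epsilon> / \<epsilon>) * R powr \<epsilon>"
          using C1 \<epsilon> \<epsilon>' R1 by (intro mult_left_mono powr_mono) auto
        finally have "real (card K) * 32 * 2 ^ 74 * (C * ln (2 * real N)) * Z
           \<le> real (card K) * 32 * 2 ^ 74 * (C1 * (2 powr \<epsilon> / \<epsilon>) * R powr \<epsilon>) * Z"
          using Z1 by (intro mult_right_mono mult_left_mono) auto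
        then show ?thesis unfolding T_def Ca_def by (simp only: mult_ac)
      qed
      also have "\<dots> \<le> (Ca + Cb) * R powr \<epsilon> * Z"
        using Cb0 Z1 by (intro mult_right_mono) auto
      finally show ?thesis .
    qed
    then show "(LINT x:ball c (sqrt (real n))|lebesgue. norm (extension unit_square F x) powr p)
        \<le> (Ca + Cb) * real n powr \<epsilon> *
          (real n powr ((3 + p) / 2) + real n ^ 3 * (real n / real M) powr (p / 2 - 1))"
      unfolding I_def Z_def L R_def by simp
  qed
qed

end
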